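(* Let $\beta\in\mathrm{Sym}(\mathfrak s)$ be such that $\beta=\mathrm m(\mu_C)$ for some critical point $\mu_C$ of $F$, and let $\bar\mu\in V^{\ge0}_{ss}$ be a solvsoliton bracket with $\mathrm{Ric}^*_{\bar\mu}=\beta$. Consider the vector field $\mathcal X(\nu)=-\pi\big((\mathrm{Ric}^*_\nu)_{\mathfrak q_\beta}+\|\mathrm{Ric}^*_\nu\|^2\mathrm{Id}\big)\nu$ (the $\mathrm{scal}^*$-normalized gauged bracket flow), which vanishes at $\bar\mu$. Its linearization at $\bar\mu$ restricts to a linear map $L_{\bar\mu}:T_{\bar\mu}(SL_\beta\cdot\bar\mu)\to T_{\bar\mu}(SL_\beta\cdot\bar\mu)$ whose kernel is $\pi(\mathfrak k_\beta)\bar\mu$ and whose non-zero eigenvalues are all negative.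
   Context: $(\mathfrak s,\langle\cdot,\cdot\rangle)$ Euclidean with orthonormal basis $(e_i)$; $V(\mathfrak s)=\Lambda^2\mathfrak s^*\otimes\mathfrak s$ with $\langle\mu,\lambda\rangle=\sum_{i,j}\langle\mu(e_i,e_j),\lambda(e_i,e_j)\rangle$; $\mathfrak{gl}(\mathfrak s)$ with $\langle A,B\rangle=\mathrm{tr}(AB^t)$. $\mathrm{GL}(\mathfrak s)$ acts by $(h\cdot\mu)(X,Y)=h\mu(h^{-1}X,h^{-1}Y)$, infinitesimally $\pi(A)\mu=A\mu(\cdot,\cdot)-\mu(A\cdot,\cdot)-\mu(\cdot,A\cdot)$. Moment map $\mathrm m(\mu)\in\mathrm{Sym}(\mathfrak s)$: $\langle\mathrm m(\mu),A\rangle=\langle\pi(A)\mu,\mu\rangle/\|\mu\|^2$; $F=\|\mathrm m\|^2$; $M_\mu=\tfrac14\|\mu\|^2\mathrm m(\mu)$; $\langle B_\mu X,Y\rangle=\mathrm{tr}(\mathrm{ad}_\mu X\mathrm{ad}_\mu Y)$; $\mathrm{Ric}^*_\mu=M_\mu-\tfrac12B_\mu$. Solvsoliton: solvable Lie bracket whose Ricci endomorphism (of the left-invariant metric on its simply-connected group given by $\langle\cdot,\cdot\rangle$) is $c\,\mathrm{Id}+D$, $D$ a derivation. Set $\beta^+=\beta+\|\beta\|^2\mathrm{Id}$. Let $\mathfrak{gl}(\mathfrak s)_r$ be the $r$-eigenspaces of $\mathrm{ad}(\beta):A\mapsto[\beta,A]$; $\mathfrak g_\beta=\mathfrak{gl}(\mathfrak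 s)_0$, $\mathfrak u_\beta=\bigoplus_{r>0}\mathfrak{gl}(\mathfrak s)_r$, $\mathfrak q_\beta=\mathfrak g_\beta\oplus\mathfrak u_\beta$, $\mathfrak h_\beta=\{A\in\mathfrak g_\beta:\langle A,\beta\rangle=0\}$, $\mathfrak k_\beta=\mathfrak{so}(\mathfrak s)\cap\mathfrak g_\beta$. With $\mathfrak k_{\mathfrak u_\beta}=\{A-A^t:A\in\mathfrak u_\beta\}$ one has $\mathfrak{gl}(\mathfrak s)=\mathfrak q_\beta\oplus\mathfrak k_{\mathfrak u_\beta}$, and $(\cdot)_{\mathfrak q_\beta}$ is the projection onto $\mathfrak q_\beta$ along $\mathfrak k_{\mathfrak u_\beta}$. $K_\beta=\mathrm O(\mathfrak s)\cap\{g:g\beta g^{-1}=\beta\}$, $H_\beta=K_\beta\exp(\mathfrak h_\beta\cap\mathrm{Sym}(\mathfrak s))$, $U_\beta=\exp(\mathfrak u_\beta)$, $SL_\beta=H_\beta U_\beta$ (Lie algebra $\mathfrak{sl}_\beta=\mathfrak h_\beta\oplus\mathfrak u_\beta$). Let $V^r_{\beta^+}$ be the $r$-eigenspaces of $\pi(\beta^+)$ on $V(\mathfrak s)$, $V^{\ge0}=\bigoplus_{r\ge0}V^r_{\beta^+}$, $p_\beta:V^{\ge0}\to V^0_{\beta^+}$ orthogonal projection, $V^0_{ss}=\{\mu\in V^0_{\beta^+}:0\notin\overline{H_\beta\cdot\mu}\}$, $V^{\ge0}_{ss}=p_\beta^{-1}(V^0_{ss})$. *)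

theory Defs
  imports "HOL-Analysis.Analysis"
begin

text \<open>Coordinates: the Euclidean space s is real^'n with the standard (orthonormal) basis
  e_i = axis i 1.  A bracket mu in Lambda^2 s^* (x) s is stored by its structure constants
  mu $ i $ j $ k = < mu(e_i,e_j), e_k >.  The Euclidean inner product of real^'n^'n^'n is then
  exactly the inner product of V(s) from the paper, and the inner product of real^'n^'n
  (Frobenius) is tr(A B^t).  Matrices act on column vectors, A $ k $ l = < A e_l, e_k >.\<close>

type_synonym 'n brk = "real^'n^'n^'n"
type_synonym 'n mat = "real^'n^'n"

definition br :: "'n::finite brk \<Rightarrow> real^'n \<Rightarrow> real^'n \<Rightarrow> real^'n" where
  "br \<mu> X Y = (\<chi> k. \<Sum>i\<in>UNIV. \<Sum>j\<in>UNIV. X$i * Y$j * \<mu>$i$j$k)"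

definition of_bil :: "(real^'n \<Rightarrow> real^'n \<Rightarrow> real^'n) \<Rightarrow> 'n::finite brk" where
  "of_bil f = (\<chi> i j k. f (axis i 1) (axis j 1) $ k)"

definition Vs :: "'n::finite brk set" where
  "Vs = {\<mu>. \<forall>i j. \<mu>$i$j = - (\<mu>$j$i)}"

definition pi_act :: "'n::finite mat \<Rightarrow> 'n brk \<Rightarrow> 'n brk" where
  "pi_act A \<mu> = of_bil (\<lambda>X Y. A *v br \<mu> X Y - br \<mu> (A *v X) Y - br \<mu> X (A *v Y))"

definition gl_act :: "'n::finite mat \<Rightarrow> 'n brk \<Rightarrow> 'n brk" where
  "gl_act h \<mu> = of_bil (\<lambda>X Y. h *v br \<mu> (matrix_inv h *v X) (matrix_inv h *v Y))"

definition Emat :: "'n::finite \<Rightarrow> 'n \<Rightarrow> 'n mat" where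
  "Emat a b = (\<chi> i j. if i = a \<and> j = b then 1 else 0)"

text \<open>Moment map: the (Riesz) representative of A |-> <pi(A)mu,mu>/|mu|^2 w.r.t. tr(AB^t).\<close>
definition mm :: "'n::finite brk \<Rightarrow> 'n mat" where
  "mm \<mu> = (\<chi> a b. inner (pi_act (Emat a b) \<mu>) \<mu> / (norm \<mu>)^2)"

definition Ffun :: "'n::finite brk \<Rightarrow> real" where
  "Ffun \<mu> = (norm (mm \<mu>))^2"

definition critF :: "'n::finite brk \<Rightarrow> bool" where
  "critF \<mu> \<longleftrightarrow> \<mu> \<in> Vs \<and> \<mu> \<noteq> 0 \<and> (Ffun has_derivative (\<lambda>_. 0)) (at \<mu> within Vs)"

definition Mop :: "'n::finite brk \<Rightarrow> 'n mat" where
  "Mop \<mu> = (1/4 * (norm \<mu>)^2) *\<^sub>R mm \<mu>"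

definition ad :: "'n::finite brk \<Rightarrow> real^'n \<Rightarrow> 'n mat" where
  "ad \<mu> X = (\<chi> k j. br \<mu> X (axis j 1) $ k)"

definition Bop :: "'n::finite brk \<Rightarrow> 'n mat" where
  "Bop \<mu> = (\<chi> a b. trace (ad \<mu> (axis a 1) ** ad \<mu> (axis b 1)))"

definition Ricst :: "'n::finite brk \<Rightarrow> 'n mat" where
  "Ricst \<mu> = Mop \<mu> - (1/2) *\<^sub>R Bop \<mu>"

definition is_lie :: "'n::finite brk \<Rightarrow> bool" where
  "is_lie \<mu> \<longleftrightarrow> \<mu> \<in> Vs \<and>
     (\<forall>X Y Z. br \<mu> X (br \<mu> Y Z) + br \<mu> Y (br \<mu> Z X) + br \<mu> Z (br \<mu> X Y) = 0)"

fun derived :: "'n::finite brk \<Rightarrow> nat \<Rightarrow> (real^'n) set" where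
  "derived \<mu> 0 = UNIV"
| "derived \<mu> (Suc k) = span {br \<mu> X Y | X Y. X \<in> derived \<mu> k \<and> Y \<in> derived \<mu> k}"

definition solvable_br :: "'n::finite brk \<Rightarrow> bool" where
  "solvable_br \<mu> \<longleftrightarrow> (\<exists>k. derived \<mu> k = {0})"

definition is_derivation :: "'n::finite brk \<Rightarrow> 'n mat \<Rightarrow> bool" where
  "is_derivation \<mu> D \<longleftrightarrow> (\<forall>X Y. D *v br \<mu> X Y = br \<mu> (D *v X) Y + br \<mu> X (D *v Y))"

text \<open>Riemannian geometry of the left-invariant metric on the simply connected Lie group,
  expressed on the Lie algebra: Levi-Civita connection (Koszul formula)
  2<nabla_X Y, Z> = <[X,Y],Z> - <[Y,Z],X> + <[Z,X],Y>,
  curvature R(X,Y) = nabla_X nabla_Y - nabla_Y nabla_X - nabla_[X,Y],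
  Ricci tensor ric(X,Y) = tr(Z |-> R(Z,X)Y), Ricci endomorphism <Ric X,Y> = ric(X,Y).\<close>
definition nabla :: "'n::finite brk \<Rightarrow> real^'n \<Rightarrow> real^'n \<Rightarrow> real^'n" where
  "nabla \<mu> X Y = (\<chi> k. (1/2) * (br \<mu> X Y $ k - inner (br \<mu> Y (axis k 1)) X
                                   + inner (br \<mu> (axis k 1) X) Y))"

definition curv :: "'n::finite brk \<Rightarrow> real^'n \<Rightarrow> real^'n \<Rightarrow> real^'n \<Rightarrow> real^'n" where
  "curv \<mu> X Y Z = nabla \<mu> X (nabla \<mu> Y Z) - nabla \<mu> Y (nabla \<mu> X Z) - nabla \<mu> (br \<mu> X Y) Z"

definition ric :: "'n::finite brk \<Rightarrow> real^'n \<Rightarrow> real^'n \<Rightarrow> real" where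
  "ric \<mu> X Y = (\<Sum>k\<in>UNIV. curv \<mu> (axis k 1) X Y $ k)"

definition Ric :: "'n::finite brk \<Rightarrow> 'n mat" where
  "Ric \<mu> = (\<chi> a b. ric \<mu> (axis b 1) (axis a 1))"

definition solvsoliton :: "'n::finite brk \<Rightarrow> bool" where
  "solvsoliton \<mu> \<longleftrightarrow> is_lie \<mu> \<and> solvable_br \<mu> \<and>
     (\<exists>c D. Ric \<mu> = c *\<^sub>R mat 1 + D \<and> is_derivation \<mu> D)"

definition betaplus :: "'n::finite mat \<Rightarrow> 'n mat" where
  "betaplus \<beta> = \<beta> + (norm \<beta>)^2 *\<^sub>R mat 1"

definition glr :: "'n::finite mat \<Rightarrow> real \<Rightarrow> 'n mat set" where
  "glr \<beta> r = {A. \<beta> ** A - A ** \<beta> = r *\<^sub>R A}"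

definition gb :: "'n::finite mat \<Rightarrow> 'n mat set" where
  "gb \<beta> = glr \<beta> 0"

definition ub :: "'n::finite mat \<Rightarrow> 'n mat set" where
  "ub \<beta> = span (\<Union>r\<in>{r. r > 0}. glr \<beta> r)"

definition qb :: "'n::finite mat \<Rightarrow> 'n mat set" where
  "qb \<beta> = {A + B | A B. A \<in> gb \<beta> \<and> B \<in> ub \<beta>}"

definition hb :: "'n::finite mat \<Rightarrow> 'n mat set" where
  "hb \<beta> = {A \<in> gb \<beta>. inner A \<beta> = 0}"

definition kb :: "'n::finite mat \<Rightarrow> 'n mat set" where
  "kb \<beta> = {A \<in> gb \<beta>. transpose A = - A}"

definition kub :: "'n::finite mat \<Rightarrow> 'n mat set" where
  "kub \<beta> = {A - transpose A | A. A \<in> ub \<beta>}"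

definition projq :: "'n::finite mat \<Rightarrow> 'n mat \<Rightarrow> 'n mat" where
  "projq \<beta> A = (THE Q. Q \<in> qb \<beta> \<and> A - Q \<in> kub \<beta>)"

definition slb :: "'n::finite mat \<Rightarrow> 'n mat set" where
  "slb \<beta> = {A + B | A B. A \<in> hb \<beta> \<and> B \<in> ub \<beta>}"

definition matpow :: "'n::finite mat \<Rightarrow> nat \<Rightarrow> 'n mat" where
  "matpow A k = ((\<lambda>B. A ** B) ^^ k) (mat 1)"

definition mexp :: "'n::finite mat \<Rightarrow> 'n mat" where
  "mexp A = (\<Sum>k. (1 / fact k) *\<^sub>R matpow A k)"

definition Kgrp :: "'n::finite mat \<Rightarrow> 'n mat set" where
  "Kgrp \<beta> = {g. orthogonal_matrix g \<and> g ** \<beta> ** matrix_inv g = \<beta>}"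

definition Hgrp :: "'n::finite mat \<Rightarrow> 'n mat set" where
  "Hgrp \<beta> = {k ** mexp S | k S. k \<in> Kgrp \<beta> \<and> S \<in> hb \<beta> \<and> transpose S = S}"

definition Veig :: "'n::finite mat \<Rightarrow> real \<Rightarrow> 'n brk set" where
  "Veig \<beta> r = {\<mu> \<in> Vs. pi_act (betaplus \<beta>) \<mu> = r *\<^sub>R \<mu>}"

definition Vge0 :: "'n::finite mat \<Rightarrow> 'n brk set" where
  "Vge0 \<beta> = span (\<Union>r\<in>{r. r \<ge> 0}. Veig \<beta> r)"

definition V0 :: "'n::finite mat \<Rightarrow> 'n brk set" where
  "V0 \<beta> = Veig \<beta> 0"

definition orthproj :: "'a::real_inner set \<Rightarrow> 'a \<Rightarrow> 'a" where
  "orthproj S x = (THE p. p \<in> S \<and> (\<forall>y\<in>S. inner (x - p) y = 0))"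

definition V0ss :: "'n::finite mat \<Rightarrow> 'n brk set" where
  "V0ss \<beta> = {\<mu> \<in> V0 \<beta>. 0 \<notin> closure ((\<lambda>h. gl_act h \<mu>) ` Hgrp \<beta>)}"

definition Vge0ss :: "'n::finite mat \<Rightarrow> 'n brk set" where
  "Vge0ss \<beta> = {\<mu> \<in> Vge0 \<beta>. orthproj (V0 \<beta>) \<mu> \<in> V0ss \<beta>}"

definition Xfield :: "'n::finite mat \<Rightarrow> 'n brk \<Rightarrow> 'n brk" where
  "Xfield \<beta> \<nu> = - pi_act (projq \<beta> (Ricst \<nu>) + (norm (Ricst \<nu>))^2 *\<^sub>R mat 1) \<nu>"

text \<open>Tangent space of the orbit SL_beta . mu at mu: pi(sl_beta) mu.\<close>
definition Tsp :: "'n::finite mat \<Rightarrow> 'n brk \<Rightarrow> 'n brk set" where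
  "Tsp \<beta> \<mu> = {pi_act A \<mu> | A. A \<in> slb \<beta>}"

end

theory Submission
  imports Defs
begin

text \<open>Derivations D of a Lie bracket mu with Killing form B satisfy tr(Ric* D) = 0 and tr(B D) = 0.
  For a solvsoliton with Ric* = beta this forces the pairing of pi(beta+) mu with mu to vanish, so that beta+ is a derivation
  because mu lies in the nonnegative part.  By semistability the orbit closure contains a nonzero
  bracket nu of minimal norm, whose moment map is a multiple of beta; for nu the standard argument
  (the identity 4 tr(M [E, E^t]) = |pi(E^t) nu|^2 for E = ad X) shows that beta+ is nonnegative and that
  no nonzero X in ker beta+ has vanishing traces tr (ad X)^m.  Both properties pass back to mu and
  make ker beta+ an abelian subalgebra acting by normal operators.  In terms of A in sl_beta the
  linearization is minus the operator A |-> (d Ric*(pi(A) mu))_q + [beta, A], which is symmetric and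
  positive semidefinite for a rescaled inner product on g_beta + u_beta.\<close>

text \<open>The obstacle is the Killing form: \<open>Mop \<mu>\<close> equals \<open>\<beta>\<close>
  plus half of \<open>Bop \<mu>\<close>, whose sign is not controlled, so the commutator identity
  says little about \<open>\<mu>\<close> directly. It is decisive for \<open>\<nu>\<close>, where
  the Killing term is absent from the moment map. What returns from \<open>\<nu>\<close> must
  survive a degeneration that can change the isomorphism type of the bracket. Nonnegativity of
  \<open>betaplus \<beta>\<close> survives since it does not mention the bracket; vanishing traces
  of powers of ad survive since they are invariant under conjugation and closed under limits, and
  nilpotency of ad is recovered from them. Once \<open>betaplus \<beta>\<close> grades the algebra
  in degrees at least 0, the Killing form lives in degree 0 and disturbs only the g_beta block of
  the linearization. There, half of |pi(S) mu|^2 contains the degree-zero rows once in full, which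
  pays for the Killing term. Skew directions contribute nothing because Ric* is equivariant under
  rotations. Complex eigenvalues are treated through pairs of real vectors.\<close>

declare transpose_matrix_vector [simp del]

section \<open>Matrix algebra and the Frobenius inner product\<close>

lemma transpose_add: "transpose (A + B) = transpose A + transpose (B :: 'a::comm_ring_1^'n^'m)"
  by (simp add: transpose_def vec_eq_iff)

lemma transpose_diff: "transpose (A - B) = transpose A - transpose (B :: 'a::comm_ring_1^'n^'m)"
  by (simp add: transpose_def vec_eq_iff)

lemma transpose_minus: "transpose (- B) = - transpose (B :: 'a::comm_ring_1^'n^'m)"
  by (simp add: transpose_def vec_eq_iff)

lemma transpose_zero: "transpose (0 :: 'a::comm_ring_1^'n^'m) = 0"
  by (simp add: transpose_def vec_eq_iff)

lemma mmul_add_left: "(A + B) ** C = A ** C + B ** (C :: real^'n^'m)"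
  by (simp add: matrix_matrix_mult_def vec_eq_iff algebra_simps sum.distrib)

lemma mmul_add_right: "C ** (A + B) = C ** A + C ** (B :: real^'n^'m)"
  by (simp add: matrix_matrix_mult_def vec_eq_iff algebra_simps sum.distrib)

lemma mmul_diff_left: "(A - B) ** C = A ** C - B ** (C :: real^'n^'m)"
  by (simp add: matrix_matrix_mult_def vec_eq_iff algebra_simps sum_subtractf)

lemma mmul_diff_right: "C ** (A - B) = C ** A - C ** (B :: real^'n^'m)"
  by (simp add: matrix_matrix_mult_def vec_eq_iff algebra_simps sum_subtractf)

lemma mmul_minus_left: "(- B) ** C = - (B ** (C :: real^'n^'m))"
  by (simp add: matrix_matrix_mult_def vec_eq_iff sum_negf)

lemma mmul_minus_right: "C ** (- B) = - (C ** (B :: real^'n^'m))"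
  by (simp add: matrix_matrix_mult_def vec_eq_iff sum_negf)

lemma mmul_scaleR_left: "(r *\<^sub>R B) ** C = r *\<^sub>R (B ** (C :: real^'n^'m))"
  by (simp add: matrix_matrix_mult_def vec_eq_iff sum_distrib_left mult.assoc)

lemma mmul_scaleR_right: "C ** (r *\<^sub>R B) = r *\<^sub>R (C ** (B :: real^'n^'m))"
  by (simp add: matrix_matrix_mult_def vec_eq_iff sum_distrib_left algebra_simps)

lemma mmul_zero_left: "0 ** (C :: real^'n^'m) = 0"
  by (simp add: matrix_matrix_mult_def vec_eq_iff)

lemma mmul_zero_right: "(C :: real^'n^'m) ** 0 = 0"
  by (simp add: matrix_matrix_mult_def vec_eq_iff)

text \<open>The reversed associativity law nests products to the right, a normal form for
  noncommutative products.\<close>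

lemmas mmul_simps = mmul_add_left mmul_add_right mmul_diff_left mmul_diff_right
  mmul_minus_left mmul_minus_right mmul_scaleR_left mmul_scaleR_right mmul_zero_left mmul_zero_right
  transpose_add transpose_diff transpose_minus transpose_zero transpose_scalar matrix_transpose_mul
  matrix_mul_assoc [symmetric]

lemma mvec_minus_left: "(- A) *v x = - (A *v (x :: real^'n))"
  by (simp add: matrix_vector_mult_def vec_eq_iff sum_negf)

lemma mvec_minus_right: "A *v (- x) = - (A *v (x :: real^'n))"
  by (simp add: matrix_vector_mult_def vec_eq_iff sum_negf)

lemmas mvec_simps = matrix_vector_mult_add_rdistrib matrix_vector_mult_diff_rdistrib
  matrix_vector_right_distrib matrix_vector_mult_diff_distrib matrix_vector_mult_scaleR
  scaleR_matrix_vector_assoc [symmetric] mvec_minus_left mvec_minus_right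

lemma inner_mvec_left: "inner (A *v x) y = inner x (transpose A *v (y :: real^'n))"
  using dot_lmul_matrix[of "y" A x] by (simp add: inner_commute transpose_matrix_vector)

lemma inner_mvec_right: "inner x (A *v y) = inner (transpose A *v x) (y :: real^'n)"
  using inner_mvec_left[of "transpose A" x y] by simp

lemma trace_transpose: "trace (transpose A) = trace (A :: 'a::semiring_1^'n^'n)"
  by (simp add: trace_def transpose_def)

lemma trace_minus: "trace (- A) = - trace (A :: real^'n^'n)"
  by (simp add: trace_def sum_negf)

lemma trace_scaleR: "trace (r *\<^sub>R A) = r * trace (A :: real^'n^'n)"
  by (simp add: trace_def sum_distrib_left)

lemma trace_zero: "trace (0 :: real^'n^'n) = 0"
  by (simp add: trace_def)

lemmas trace_simps = trace_add trace_sub trace_minus trace_scaleR trace_zero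

lemma inner_mat_trace: "inner A B = trace (A ** transpose (B :: real^'n^'n))"
  by (simp add: inner_vec_def trace_def matrix_matrix_mult_def transpose_def)

lemma inner_transpose: "inner (transpose A) (transpose B) = inner A (B :: real^'n^'n)"
  unfolding inner_vec_def transpose_def by simp (rule sum.swap)

lemma inner_mmul_left: "inner (A ** B) C = inner (B :: real^'n^'n) (transpose A ** C)" for A :: "real^'n^'n"
  using trace_mul_sym[of A "B ** transpose C"] by (simp add: inner_mat_trace mmul_simps)

lemma inner_mmul_right: "inner (A ** B) C = inner (A :: real^'n^'n) (C ** transpose B)" for B :: "real^'n^'n"
  by (simp add: inner_mat_trace mmul_simps)

lemma inner_sym_skew:
  assumes "transpose A = A" "transpose B = - B"
  shows "inner A (B :: real^'n^'n) = 0"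
  using inner_transpose[of A B] assms by simp

section \<open>Brackets, adjoint matrices and the action pi\<close>

lemma linear_br: "linear (br \<mu> X)" "linear (\<lambda>X. br \<mu> X Y)" "linear (\<lambda>\<mu>. br \<mu> X Y)"
  by (auto intro!: linearI simp: br_def vec_eq_iff sum.distrib algebra_simps sum_distrib_left)

lemmas br_simps =
  linear_add[OF linear_br(1)] linear_add[OF linear_br(2)] linear_add[OF linear_br(3)]
  linear_diff[OF linear_br(1)] linear_diff[OF linear_br(2)] linear_diff[OF linear_br(3)]
  linear_neg[OF linear_br(1)] linear_neg[OF linear_br(2)] linear_neg[OF linear_br(3)]
  linear_cmul[OF linear_br(1)] linear_cmul[OF linear_br(2)] linear_cmul[OF linear_br(3)]
  linear_0[OF linear_br(1)] linear_0[OF linear_br(2)] linear_0[OF linear_br(3)]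

lemma br_axis: "br \<mu> (axis i 1) (axis j 1) = \<mu> $ i $ j"
proof -
  have "(\<Sum>a\<in>UNIV. \<Sum>b\<in>UNIV. axis i 1 $ a * axis j 1 $ b * \<mu> $ a $ b $ k) =
        (\<Sum>a\<in>UNIV. if a = i then \<mu> $ i $ j $ k else 0)" for k
  proof (intro sum.cong refl)
    fix a
    have "(\<Sum>b\<in>UNIV. axis i 1 $ a * axis j 1 $ b * \<mu> $ a $ b $ k) =
      (\<Sum>b\<in>UNIV. if b = j then (if a = i then \<mu> $ i $ j $ k else 0) else 0)"
      by (intro sum.cong) (auto simp: axis_def)
    then show "(\<Sum>b\<in>UNIV. axis i 1 $ a * axis j 1 $ b * \<mu> $ a $ b $ k) =
      (if a = i then \<mu> $ i $ j $ k else 0)" by simp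
  qed
  then show ?thesis by (simp add: br_def vec_eq_iff)
qed

lemma brk_eqI:
  assumes "\<And>X Y. br \<mu> X Y = br \<nu> X Y"
  shows "\<mu> = \<nu>"
  using assms by (simp add: vec_eq_iff flip: br_axis)

lemma axis_expand: "X = (\<Sum>i\<in>UNIV. X$i *\<^sub>R axis i (1::real))"
  using basis_expansion[of X] by (simp add: scalar_mult_eq_scaleR)

lemma br_of_bil:
  assumes "\<And>X. linear (f X)" "\<And>Y. linear (\<lambda>X. f X Y)"
  shows "br (of_bil f) X Y = f X Y"
proof -
  have "f X Y = f (\<Sum>i\<in>UNIV. X$i *\<^sub>R axis i 1) (\<Sum>i\<in>UNIV. Y$i *\<^sub>R axis i 1)"
    by (simp flip: axis_expand)
  also have "\<dots> = (\<Sum>j\<in>UNIV. \<Sum>i\<in>UNIV. X$i *\<^sub>R Y$j *\<^sub>R f (axis i 1) (axis j 1))"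
    by (simp add: linear_sum[OF assms(1)] linear_sum[OF assms(2)] linear_cmul[OF assms(1)]
         linear_cmul[OF assms(2)] scaleR_sum_right mult.commute)
  also have "\<dots> = (\<Sum>i\<in>UNIV. \<Sum>j\<in>UNIV. X$i *\<^sub>R Y$j *\<^sub>R f (axis i 1) (axis j 1))"
    by (rule sum.swap)
  finally show ?thesis
    by (simp add: br_def of_bil_def vec_eq_iff mult.assoc)
qed

lemma br_pi_act: "br (pi_act A \<mu>) X Y = A *v br \<mu> X Y - br \<mu> (A *v X) Y - br \<mu> X (A *v Y)"
  unfolding pi_act_def
  by (subst br_of_bil) (auto intro!: linearI simp: br_simps mvec_simps algebra_simps)

lemma br_gl_act: "br (gl_act h \<mu>) X Y = h *v br \<mu> (matrix_inv h *v X) (matrix_inv h *v Y)"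
  unfolding gl_act_def
  by (subst br_of_bil) (auto intro!: linearI simp: br_simps mvec_simps algebra_simps)

lemma linear_pi_act: "linear (pi_act A)" "linear (\<lambda>A. pi_act A \<mu>)"
  by (auto intro!: linearI brk_eqI simp: br_pi_act br_simps mvec_simps algebra_simps)

lemmas pi_act_simps =
  linear_add[OF linear_pi_act(1)] linear_add[OF linear_pi_act(2)]
  linear_diff[OF linear_pi_act(1)] linear_diff[OF linear_pi_act(2)]
  linear_neg[OF linear_pi_act(1)] linear_neg[OF linear_pi_act(2)]
  linear_cmul[OF linear_pi_act(1)] linear_cmul[OF linear_pi_act(2)]
  linear_0[OF linear_pi_act(1)] linear_0[OF linear_pi_act(2)]

text \<open>One output slot against two input slots leaves the factor 1 - 2. This sign fixes the
  trace of moment maps and makes \<open>pi_act (betaplus \<beta>)\<close> equal to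
  \<open>pi_act \<beta>\<close> minus the scalar \<open>(norm \<beta>)^2\<close>.\<close>

lemma pi_act_id: "pi_act (mat 1) \<mu> = - \<mu>"
  by (rule brk_eqI) (simp add: br_pi_act br_simps)

text \<open>pi is a representation of the Lie algebra gl(s); this form moves one operator past
  another that acts on \<open>\<mu>\<close> by a known scalar.\<close>

lemma pi_act_commute: "pi_act A (pi_act C \<mu>) = pi_act C (pi_act A \<mu>) + pi_act (A ** C - C ** A) \<mu>"
  by (rule brk_eqI)
     (simp add: br_pi_act br_simps mvec_simps matrix_vector_mul_assoc[symmetric] algebra_simps)

lemma ad_mvec: "ad \<mu> X *v Y = br \<mu> X Y"
proof -
  have "ad \<mu> X = matrix (br \<mu> X)" by (simp add: ad_def matrix_def)
  then show ?thesis using fun_cong[OF matrix_vector_mul(2)[OF linear_br(1)[of \<mu> X]], of Y] by simp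
qed

lemma mat_eqI:
  assumes "\<And>x. A *v x = B *v (x :: real^'n)"
  shows "A = B"
  using assms by (simp add: matrix_eq)

lemma linear_ad: "linear (ad \<mu>)" "linear (\<lambda>\<mu>. ad \<mu> X)"
proof -
  show "linear (ad \<mu>)"
    by (rule linearI) (simp_all only: ad_def br_simps vec_eq_iff vec_lambda_beta vector_add_component vector_scaleR_component simp_thms)
  show "linear (\<lambda>\<mu>. ad \<mu> X)"
    by (rule linearI) (simp_all only: ad_def br_simps vec_eq_iff vec_lambda_beta vector_add_component vector_scaleR_component simp_thms)
qed

lemmas ad_simps =
  linear_add[OF linear_ad(1)] linear_add[OF linear_ad(2)]
  linear_diff[OF linear_ad(1)] linear_diff[OF linear_ad(2)]
  linear_neg[OF linear_ad(1)] linear_neg[OF linear_ad(2)]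
  linear_cmul[OF linear_ad(1)] linear_cmul[OF linear_ad(2)]
  linear_0[OF linear_ad(1)] linear_0[OF linear_ad(2)]

text \<open>The three terms are the output, second and first slot of the bracket. For a derivation
  the left side vanishes and ad(A X) = [A, ad X] remains.\<close>

lemma ad_pi_act: "ad (pi_act A \<mu>) X = A ** ad \<mu> X - ad \<mu> X ** A - ad \<mu> (A *v X)"
  by (rule mat_eqI) (simp add: ad_mvec br_pi_act mvec_simps matrix_vector_mul_assoc[symmetric])

text \<open>Moving a matrix across a full contraction transposes it. This handles the argument slots
  in the adjointness of both \<open>pi_act\<close> and \<open>gl_act\<close>.\<close>

lemma bilinear_sum_swap:
  fixes g :: "real^'n \<Rightarrow> real^'n \<Rightarrow> real" and A :: "real^'n^'n"
  assumes "\<And>X. linear (g X)" "\<And>Y. linear (\<lambda>X. g X Y)"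
  shows "(\<Sum>i\<in>UNIV. g (A *v axis i 1) (axis i 1)) = (\<Sum>i\<in>UNIV. g (axis i 1) (transpose A *v axis i 1))"
proof -
  have 1: "g (A *v axis i 1) (axis i 1) = (\<Sum>j\<in>UNIV. A$j$i * g (axis j 1) (axis i 1))" for i
    by (subst axis_expand[of "A *v axis i 1"])
       (simp add: linear_sum[OF assms(2)] linear_cmul[OF assms(2)] matrix_vector_mult_basis column_def)
  have 2: "g (axis i 1) (transpose A *v axis i 1) = (\<Sum>j\<in>UNIV. A$i$j * g (axis i 1) (axis j 1))" for i
    by (subst axis_expand[of "transpose A *v axis i 1"])
       (simp add: linear_sum[OF assms(1)] linear_cmul[OF assms(1)] matrix_vector_mult_basis
         column_def transpose_def)
  show ?thesis unfolding 1 2 by (rule sum.swap)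
qed

lemma inner_brk_ad: "inner \<mu> \<nu> = (\<Sum>i\<in>UNIV. inner (ad \<mu> (axis i 1)) (ad \<nu> (axis i 1)))"
proof -
  have *: "inner (ad \<mu> (axis i 1)) (ad \<nu> (axis i 1)) = inner (\<mu>$i) (\<nu>$i)" for i
    unfolding inner_vec_def ad_def br_axis vec_lambda_beta by (rule sum.swap)
  show ?thesis unfolding * by (rule inner_vec_def)
qed

text \<open>Each of the three slots dualizes separately, so the adjoint of pi(A) is pi(A^t).\<close>

lemma inner_pi_act: "inner (pi_act A \<mu>) \<nu> = inner \<mu> (pi_act (transpose A) \<nu>)"
proof -
  have 1: "(\<Sum>i\<in>UNIV. inner (ad \<mu> (A *v axis i 1)) (ad \<nu> (axis i 1))) =
        (\<Sum>i\<in>UNIV. inner (ad \<mu> (axis i 1)) (ad \<nu> (transpose A *v axis i 1)))"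
    by (rule bilinear_sum_swap) (auto intro!: linearI simp: ad_simps inner_simps)
  have 2: "inner (A ** ad \<mu> X) (ad \<nu> X) = inner (ad \<mu> X) (transpose A ** ad \<nu> X)" for X
    by (rule inner_mmul_left)
  have 3: "inner (ad \<mu> X ** A) (ad \<nu> X) = inner (ad \<mu> X) (ad \<nu> X ** transpose A)" for X
    by (rule inner_mmul_right)
  show ?thesis
    unfolding inner_brk_ad ad_pi_act inner_diff_left inner_diff_right sum_subtractf 1 2 3 ..
qed

section \<open>Killing form and moment map\<close>

lemma Bop_sym: "transpose (Bop \<mu>) = Bop \<mu>"
  unfolding Bop_def transpose_def vec_eq_iff vec_lambda_beta by (intro allI) (rule trace_mul_sym)

text \<open>Entry (a, b) is the form at (e_b, e_a): columns are indexed by the first argument, as in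
  the definition of \<open>Ric\<close>.\<close>

lemma inner_bilinear_matrix:
  fixes f :: "real^'n \<Rightarrow> real^'n \<Rightarrow> real"
  assumes "\<And>X. linear (f X)" "\<And>Y. linear (\<lambda>X. f X Y)"
  shows "inner ((\<chi> a b. f (axis b 1) (axis a 1)) *v X) Y = f X Y"
proof -
  have "f X Y = f (\<Sum>i\<in>UNIV. X$i *\<^sub>R axis i 1) (\<Sum>i\<in>UNIV. Y$i *\<^sub>R axis i 1)"
    by (simp flip: axis_expand)
  also have "\<dots> = (\<Sum>j\<in>UNIV. Y$j * (\<Sum>i\<in>UNIV. X$i * f (axis i 1) (axis j 1)))"
    by (simp only: linear_sum[OF assms(1)] linear_sum[OF assms(2)] linear_cmul[OF assms(1)]
         linear_cmul[OF assms(2)] real_scaleR_def)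
  finally show ?thesis
    by (simp add: inner_vec_def matrix_vector_mult_def mult.commute)
qed

lemma inner_Bop: "inner (Bop \<mu> *v X) Y = trace (ad \<mu> X ** ad \<mu> Y)"
proof -
  have "Bop \<mu> = (\<chi> a b. trace (ad \<mu> (axis b 1) ** ad \<mu> (axis a 1)))"
    unfolding Bop_def vec_eq_iff vec_lambda_beta by (intro allI trace_mul_sym)
  then show ?thesis
    by (simp only:) (rule inner_bilinear_matrix; rule linearI; simp add: ad_simps mmul_simps trace_simps)
qed

lemma Emat_expand: "A = (\<Sum>a\<in>UNIV. \<Sum>b\<in>UNIV. A$a$b *\<^sub>R Emat a b)"
proof -
  have "(\<Sum>a\<in>UNIV. \<Sum>b\<in>UNIV. A$a$b * (Emat a b $ i $ j)) = A $ i $ j" for i j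
  proof -
    have "(\<Sum>b\<in>UNIV. A$a$b * (Emat a b $ i $ j)) = (if a = i then A $ i $ j else 0)" for a
    proof (cases "a = i")
      case True
      then have "(\<Sum>b\<in>UNIV. A$a$b * (Emat a b $ i $ j)) = (\<Sum>b\<in>UNIV. if b = j then A$i$j else 0)"
        by (intro sum.cong) (auto simp: Emat_def)
      with True show ?thesis by simp
    qed (simp add: Emat_def)
    then show ?thesis by simp
  qed
  then show ?thesis by (simp add: vec_eq_iff)
qed

lemma inner_Mop: "inner (Mop \<mu>) A = inner (pi_act A \<mu>) \<mu> / 4"
proof -
  have l: "linear (\<lambda>A. inner (pi_act A \<mu>) \<mu>)"
    by (rule linearI) (simp_all add: pi_act_simps inner_simps)
  have "inner (pi_act A \<mu>) \<mu> = (\<Sum>a\<in>UNIV. \<Sum>b\<in>UNIV. A$a$b * inner (pi_act (Emat a b) \<mu>) \<mu>)"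
    by (subst Emat_expand[of A]) (simp only: linear_sum[OF l] linear_cmul[OF l] real_scaleR_def)
  then show ?thesis
    \<comment> \<open>For the zero bracket the quotient in \<open>mm\<close> takes the default value
      0 and both sides vanish.\<close>
    by (cases "\<mu> = 0")
       (simp_all add: Mop_def mm_def inner_vec_def sum_distrib_left sum_divide_distrib algebra_simps)
qed

lemma inner_mm: "inner (mm \<mu>) A = inner (pi_act A \<mu>) \<mu> / (norm \<mu>)^2"
proof (cases "\<mu> = 0")
  case True
  then have "mm \<mu> = 0" by (simp add: mm_def vec_eq_iff)
  with True show ?thesis by simp
qed (use inner_Mop[of \<mu> A] in \<open>simp add: Mop_def field_simps\<close>)

lemma Mop_sym: "transpose (Mop \<mu>) = Mop \<mu>"
proof -
  have "inner (transpose (Mop \<mu>)) A = inner (Mop \<mu>) A" for A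
  proof -
    have "inner (transpose (Mop \<mu>)) A = inner (Mop \<mu>) (transpose A)"
      by (metis inner_transpose transpose_transpose)
    also have "\<dots> = inner (Mop \<mu>) A"
      using inner_pi_act[of A \<mu> \<mu>]
      by (simp add: inner_Mop inner_commute[of "pi_act (transpose A) \<mu>"])
    finally show ?thesis .
  qed
  then show ?thesis by (metis vector_eq_rdot)
qed

lemma Ricst_sym: "transpose (Ricst \<mu>) = Ricst \<mu>"
  by (simp add: Ricst_def transpose_diff transpose_scalar Mop_sym Bop_sym)

lemma vec_eqI_inner:
  fixes x y :: "'a::real_inner"
  assumes "\<And>z. inner x z = inner y z"
  shows "x = y"
  using assms vector_eq_rdot by blast

lemma linear_axis_expand:
  assumes "linear f"
  shows "f X = (\<Sum>i\<in>UNIV. X$i *\<^sub>R f (axis i (1::real)))"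
proof -
  have "f (\<Sum>i\<in>UNIV. X$i *\<^sub>R axis i 1) = (\<Sum>i\<in>UNIV. X$i *\<^sub>R f (axis i 1))"
    by (simp add: linear_sum[OF assms] linear_cmul[OF assms])
  then show ?thesis by (simp flip: axis_expand)
qed

lemma inner_mat_columns: "inner A B = (\<Sum>i\<in>UNIV. inner (A *v axis i 1) (B *v axis i (1::real)))"
  unfolding matrix_vector_mult_basis column_def inner_vec_def by simp (rule sum.swap)

text \<open>The rank one matrix x y^t. Its Frobenius pairing with A is <A y, x>, so
  \<open>outer X X\<close> evaluates a quadratic form at X.\<close>

definition outer :: "real^'n \<Rightarrow> real^'n \<Rightarrow> real^'n^'n" where
  "outer x y = (\<chi> i j. x$i * y$j)"

lemma outer_mvec: "outer x y *v z = inner y z *\<^sub>R x"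
  by (simp add: outer_def matrix_vector_mult_def vec_eq_iff inner_vec_def sum_distrib_left
      sum_distrib_right algebra_simps)

lemma inner_outer: "inner A (outer x y) = inner (A *v y) x"
  by (simp add: outer_def inner_vec_def matrix_vector_mult_def sum_distrib_left sum_distrib_right algebra_simps)

lemma transpose_outer: "transpose (outer x y) = outer y x"
  by (simp add: outer_def transpose_def mult.commute)

lemma quadratic_form_zero:
  assumes "\<And>X. inner (A *v X) X = 0"
  shows "transpose A = - (A :: real^'n^'n)"
proof (rule mat_eqI, rule vec_eqI_inner)
  fix x y
  have "inner (transpose A *v x) y = inner (A *v y) x"
    by (metis inner_mvec_right inner_commute)
  then show "inner (transpose A *v x) y = inner (- A *v x) y"
    using assms[of "x + y"] assms[of x] assms[of y] by (simp add: mvec_simps inner_add_left inner_add_right inner_minus_left)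
qed

text \<open>The difference is skew by polarization, and skew matrices are orthogonal to symmetric
  ones. This allows \<open>Ric\<close> to be compared with a matrix containing the nonsymmetric ad
  H.\<close>

lemma quadratic_form_eq:
  assumes "\<And>X. inner (A *v X) X = inner (B *v X) X" and "transpose S = S"
  shows "inner A S = inner B (S :: real^'n^'n)"
proof -
  have "transpose (A - B) = - (A - B)"
    by (rule quadratic_form_zero) (simp add: mvec_simps inner_simps assms)
  from inner_sym_skew[OF assms(2) this] show ?thesis
    by (simp add: inner_diff_right inner_commute[of S])
qed

lemma br_skew:
  assumes "\<mu> \<in> Vs" shows "br \<mu> X Y = - br \<mu> Y X"
proof -
  have "br \<mu> X Y = (\<chi> k. \<Sum>i\<in>UNIV. \<Sum>j\<in>UNIV. - (Y$j * X$i * \<mu>$j$i$k))"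
    unfolding br_def vec_eq_iff vec_lambda_beta
  proof (intro allI sum.cong refl)
    fix k i j
    have "\<mu>$i$j = - (\<mu>$j$i)" using assms unfolding Vs_def by blast
    then have "\<mu>$i$j$k = - (\<mu>$j$i$k)" by (metis vector_uminus_component)
    moreover have "x * y * m = - (y * x * n)" if "m = - n" for x y m n :: real
      using that by simp
    ultimately show "X$i * Y$j * \<mu>$i$j$k = - (Y$j * X$i * \<mu>$j$i$k)" by blast
  qed
  also have "\<dots> = - br \<mu> Y X"
    unfolding br_def vec_eq_iff vector_uminus_component vec_lambda_beta sum_negf
    by (intro allI arg_cong[where f=uminus] sum.swap)
  finally show ?thesis .
qed

lemma br_self: "\<mu> \<in> Vs \<Longrightarrow> br \<mu> X X = 0"
  using br_skew[of \<mu> X X] by (simp only: eq_neg_iff_add_eq_0 scaleR_2[symmetric] scaleR_eq_0_iff) simp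

lemma Vs_iff: "\<mu> \<in> Vs \<longleftrightarrow> (\<forall>X Y. br \<mu> X Y = - br \<mu> Y X)"
proof
  assume "\<forall>X Y. br \<mu> X Y = - br \<mu> Y X"
  then show "\<mu> \<in> Vs" unfolding Vs_def mem_Collect_eq br_axis[symmetric] by blast
qed (use br_skew in blast)

text \<open>The skew operator J_X familiar from two-step nilpotent groups, <J_X U, W> = <[U, W], X>,
  here with X ranging over the whole algebra.\<close>

definition jmat :: "'n::finite brk \<Rightarrow> real^'n \<Rightarrow> 'n mat" where
  "jmat \<mu> X = (\<chi> a b. inner (br \<mu> (axis b 1) (axis a 1)) X)"

lemma inner_jmat: "inner (jmat \<mu> X *v U) W = inner (br \<mu> U W) X"
  unfolding jmat_def
  by (rule inner_bilinear_matrix) (auto intro!: linearI simp: br_simps inner_simps)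

lemma jmat_skew: "\<mu> \<in> Vs \<Longrightarrow> transpose (jmat \<mu> X) = - jmat \<mu> X"
  by (rule quadratic_form_zero) (simp add: inner_jmat br_self)

lemma jmat_mvec: "jmat \<mu> X *v U = transpose (ad \<mu> U) *v X"
  by (rule vec_eqI_inner) (metis inner_jmat inner_mvec_right ad_mvec inner_commute)

text \<open>Test the moment map on the rank one matrix X X^t: the output slot yields |J_X|^2, and
  each of the two input slots yields |ad X|^2 with a minus sign.\<close>

lemma inner_Mop_mvec:
  assumes "\<mu> \<in> Vs"
  shows "inner (Mop \<mu> *v X) X = inner (jmat \<mu> X) (jmat \<mu> X) / 4 - inner (ad \<mu> X) (ad \<mu> X) / 2"
proof -
  let ?P = "outer X X"
  have 1: "(\<Sum>i\<in>UNIV. inner (?P ** ad \<mu> (axis i 1)) (ad \<mu> (axis i 1))) = inner (jmat \<mu> X) (jmat \<mu> X)"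
  proof -
    have "inner (?P ** ad \<mu> U) (ad \<mu> U) = inner (jmat \<mu> X *v U) (jmat \<mu> X *v U)" for U
    proof -
      have "inner (?P ** ad \<mu> U) (ad \<mu> U) = inner (ad \<mu> U ** transpose (ad \<mu> U)) ?P"
        by (metis inner_mmul_right inner_commute transpose_transpose)
      then show ?thesis
        by (simp add: inner_outer jmat_mvec inner_mvec_left flip: matrix_vector_mul_assoc)
    qed
    then show ?thesis by (simp add: inner_mat_columns)
  qed
  have 2: "(\<Sum>i\<in>UNIV. inner (ad \<mu> (axis i 1) ** ?P) (ad \<mu> (axis i 1))) = inner (ad \<mu> X) (ad \<mu> X)"
  proof -
    have "inner (ad \<mu> U ** ?P) (ad \<mu> U) = inner (ad \<mu> X *v U) (ad \<mu> X *v U)" for U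
    proof -
      have "inner (ad \<mu> U ** ?P) (ad \<mu> U) = inner (transpose (ad \<mu> U) ** ad \<mu> U) ?P"
        by (metis inner_mmul_left inner_commute)
      then show ?thesis
        using br_skew[OF assms, of U X] inner_mvec_right[of X "transpose (ad \<mu> U)" "br \<mu> U X"]
        by (simp add: inner_outer ad_mvec inner_commute[of _ X] flip: matrix_vector_mul_assoc)
    qed
    then show ?thesis by (simp add: inner_mat_columns)
  qed
  have 3: "(\<Sum>i\<in>UNIV. inner (ad \<mu> (?P *v axis i 1)) (ad \<mu> (axis i 1))) = inner (ad \<mu> X) (ad \<mu> X)"
  proof -
    have "inner (ad \<mu> X) (ad \<mu> X) = inner (ad \<mu> X) (ad \<mu> (\<Sum>i\<in>UNIV. X$i *\<^sub>R axis i 1))"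
      by (simp flip: axis_expand)
    also have "\<dots> = (\<Sum>i\<in>UNIV. X$i * inner (ad \<mu> X) (ad \<mu> (axis i 1)))"
      by (simp add: linear_sum[OF linear_ad(1)] ad_simps inner_sum_right)
    finally show ?thesis
      by (simp add: outer_mvec inner_axis ad_simps)
  qed
  have "inner (Mop \<mu> *v X) X = inner (Mop \<mu>) ?P" by (simp add: inner_outer)
  also have "\<dots> = inner (pi_act ?P \<mu>) \<mu> / 4" by (rule inner_Mop)
  also have "inner (pi_act ?P \<mu>) \<mu> = inner (jmat \<mu> X) (jmat \<mu> X) - 2 * inner (ad \<mu> X) (ad \<mu> X)"
    unfolding inner_brk_ad[of "pi_act _ _"] ad_pi_act inner_diff_left sum_subtractf 1 2 3 by simp
  finally show ?thesis by simp
qed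

section \<open>Ricci curvature of the left-invariant metric\<close>

lemma inner_nabla: "inner (nabla \<mu> X Y) Z =
  (inner (br \<mu> X Y) Z - inner (br \<mu> Y Z) X + inner (br \<mu> Z X) Y) / 2"
proof -
  have "linear (\<lambda>Z. (inner (br \<mu> X Y) Z - inner (br \<mu> Y Z) X + inner (br \<mu> Z X) Y) / 2)"
    by (rule linearI) (simp_all add: br_simps inner_simps algebra_simps add_divide_distrib diff_divide_distrib)
  from linear_axis_expand[OF this, of Z] show ?thesis
    by (simp add: inner_commute[of _ Z])
       (simp add: nabla_def inner_axis inner_vec_def[of Z "vec_lambda _"])
qed

lemma linear_nabla: "linear (nabla \<mu> X)" "linear (\<lambda>X. nabla \<mu> X Y)"
  by (rule linearI; simp add: nabla_def vec_eq_iff br_simps inner_simps algebra_simps)+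

lemmas nabla_simps = linear_add[OF linear_nabla(1)] linear_add[OF linear_nabla(2)]
  linear_diff[OF linear_nabla(1)] linear_diff[OF linear_nabla(2)]
  linear_cmul[OF linear_nabla(1)] linear_cmul[OF linear_nabla(2)]

lemma inner_Ric: "inner (Ric \<mu> *v X) Y = ric \<mu> X Y"
  unfolding Ric_def
proof (rule inner_bilinear_matrix)
  show "linear (ric \<mu> X)" for X
    by (rule linearI) (simp_all add: ric_def curv_def nabla_simps sum.distrib sum_subtractf
        sum_distrib_left algebra_simps)
  show "linear (\<lambda>X. ric \<mu> X Y)" for Y
    by (rule linearI) (simp_all add: ric_def curv_def nabla_simps br_simps sum.distrib sum_subtractf
        sum_distrib_left algebra_simps)
qed

text \<open>The vector usually called the mean curvature vector H, representing X |-> tr ad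
  X.\<close>

definition mcurv :: "'n::finite brk \<Rightarrow> real^'n" where
  "mcurv \<mu> = (\<chi> i. trace (ad \<mu> (axis i 1)))"

lemma inner_mcurv: "inner (mcurv \<mu>) X = trace (ad \<mu> X)"
proof -
  have "linear (\<lambda>X. trace (ad \<mu> X))"
    by (rule linearI) (simp_all add: ad_simps trace_simps)
  from linear_axis_expand[OF this, of X] show ?thesis
    by (simp add: inner_vec_def mcurv_def mult.commute)
qed

lemma trace_columns: "trace A = (\<Sum>i\<in>UNIV. inner (A *v axis i 1) (axis i (1::real)))"
  by (simp add: trace_def matrix_vector_mult_basis column_def inner_axis)

text \<open>The covariant derivative of X is packed into one matrix N, after which contracting the
  curvature is a computation with Frobenius products. Quadratic forms are compared because only the
  symmetric part of ad H enters the Ricci endomorphism.\<close>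

lemma ric_quadratic:
  assumes "\<mu> \<in> Vs"
  shows "inner (Ric \<mu> *v X) X = inner ((Ricst \<mu> - ad \<mu> (mcurv \<mu>)) *v X) X"
proof -
  let ?A = "ad \<mu> X" and ?J = "jmat \<mu> X" and ?e = "\<lambda>k. axis k (1::real)"
  \<comment> \<open>Koszul's formula solved for the map U |-> nabla_U X.\<close>
  define N where "N = - (1/2) *\<^sub>R (?A + transpose ?A + ?J)"
  have skew: "br \<mu> U V = - br \<mu> V U" for U V using br_skew[OF assms] .
  have N: "N *v U = nabla \<mu> U X" for U
  proof -
    have "inner (transpose ?A *v U) W = inner (br \<mu> X W) U" for W
      by (metis inner_mvec_right ad_mvec inner_commute)
    then have "inner (N *v U) W = inner (nabla \<mu> U X) W" for W
      using skew[of U X] skew[of W U]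
      by (simp add: N_def mvec_simps inner_add_left inner_minus_left inner_scaleR_left inner_nabla inner_jmat ad_mvec
          algebra_simps add_divide_distrib diff_divide_distrib)
    then show ?thesis by (metis vector_eq_rdot)
  qed
  have nab_skew: "inner (nabla \<mu> U V) W = - inner V (nabla \<mu> U W)" for U V W
    unfolding inner_commute[of V] inner_nabla using skew[of U W] skew[of V W] skew[of U V]
    by (simp add: inner_simps algebra_simps add_divide_distrib diff_divide_distrib)
  have tors: "nabla \<mu> U V = nabla \<mu> V U + br \<mu> U V" for U V
  proof -
    have "inner (nabla \<mu> U V) W = inner (nabla \<mu> V U + br \<mu> U V) W" for W
      unfolding inner_add_left inner_nabla using skew[of U W] skew[of V W] skew[of U V]
      by (simp add: inner_simps algebra_simps add_divide_distrib diff_divide_distrib)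
    then show ?thesis by (metis vector_eq_rdot)
  qed
  have 1: "(\<Sum>k\<in>UNIV. inner (nabla \<mu> (?e k) V) (?e k)) = - inner (mcurv \<mu>) V" for V
  proof -
    have "inner (nabla \<mu> (?e k) V) (?e k) = - inner (ad \<mu> V *v ?e k) (?e k)" for k
      unfolding inner_nabla ad_mvec using skew[of "?e k" V] br_self[OF assms, of "?e k"]
      by (simp add: inner_simps)
    then show ?thesis by (simp add: inner_mcurv trace_columns sum_negf)
  qed
  have 2: "(\<Sum>k\<in>UNIV. inner (nabla \<mu> X (nabla \<mu> (?e k) X)) (?e k)) = - inner N N - inner N ?A"
  proof -
    have "inner (nabla \<mu> X (nabla \<mu> (?e k) X)) (?e k) =
        - inner (N *v ?e k) (N *v ?e k) - inner (N *v ?e k) (?A *v ?e k)" for k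
      unfolding nab_skew[of X "nabla \<mu> (?e k) X"] tors[of X "?e k"] N ad_mvec by (simp add: inner_simps)
    then show ?thesis unfolding inner_mat_columns by (simp add: sum_subtractf sum_negf)
  qed
  have 3: "(\<Sum>k\<in>UNIV. inner (nabla \<mu> (br \<mu> (?e k) X) X) (?e k)) = - trace (N ** ?A)"
  proof -
    have "nabla \<mu> (br \<mu> (?e k) X) X = - ((N ** ?A) *v ?e k)" for k
      using skew[of "?e k" X]
      by (simp add: ad_mvec mvec_simps flip: N matrix_vector_mul_assoc)
    then show ?thesis by (simp add: trace_columns sum_negf)
  qed
  have N1: "inner N N = inner (?A + transpose ?A) (?A + transpose ?A) / 4 + inner ?J ?J / 4"
  proof -
    have "inner (?A + transpose ?A) ?J = 0"
      by (rule inner_sym_skew) (simp_all add: mmul_simps jmat_skew assms add.commute)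
    then show ?thesis by (simp add: N_def inner_simps inner_commute[of ?J ?A] inner_commute[of ?J "transpose ?A"] algebra_simps)
  qed
  have N2: "inner N ?A + trace (N ** ?A) = - inner (?A + transpose ?A) (?A + transpose ?A) / 2"
  proof -
    have "inner (?A + transpose ?A) ?J = 0"
      by (rule inner_sym_skew) (simp_all add: mmul_simps jmat_skew assms add.commute)
    moreover have "inner N ?A + trace (N ** ?A) = inner N (?A + transpose ?A)"
      by (simp add: inner_mat_trace mmul_simps trace_simps)
    ultimately show ?thesis by (simp add: N_def inner_simps inner_commute[of ?J ?A] inner_commute[of ?J "transpose ?A"] algebra_simps)
  qed
  have N3: "inner (?A + transpose ?A) (?A + transpose ?A) = 2 * inner ?A ?A + 2 * trace (?A ** ?A)"
  proof -
    have "inner ?A (transpose ?A) = trace (?A ** ?A)" by (simp add: inner_mat_trace)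
    then show ?thesis by (simp add: inner_simps inner_transpose inner_commute[of "transpose ?A" ?A])
  qed
  have H: "inner (mcurv \<mu>) (nabla \<mu> X X) = inner (ad \<mu> (mcurv \<mu>) *v X) X"
    using inner_nabla[of \<mu> X X "mcurv \<mu>"] br_self[OF assms, of X]
    by (simp add: inner_commute[of "mcurv \<mu>"] ad_mvec skew[of X "mcurv \<mu>"])
  have "inner (Ric \<mu> *v X) X = (\<Sum>k\<in>UNIV. inner (curv \<mu> (?e k) X X) (?e k))"
    by (simp add: inner_Ric ric_def inner_axis)
  also have "\<dots> = - inner (ad \<mu> (mcurv \<mu>) *v X) X + inner N N + inner N ?A + trace (N ** ?A)"
    unfolding curv_def inner_diff_left sum_subtractf 1 2 3 H by simp
  also have "\<dots> = inner ?J ?J / 4 - inner ?A ?A / 2 - trace (?A ** ?A) / 2 - inner (ad \<mu> (mcurv \<mu>) *v X) X"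
    using N1 N2 N3 by argo
  finally show ?thesis
    by (simp add: Ricst_def mvec_simps inner_simps inner_Bop inner_Mop_mvec[OF assms])
qed

section \<open>Derivations and the trace of a moment map\<close>

lemma is_derivation_iff: "is_derivation \<mu> D \<longleftrightarrow> pi_act D \<mu> = 0"
proof
  assume "is_derivation \<mu> D"
  then show "pi_act D \<mu> = 0"
    by (intro brk_eqI) (simp add: br_pi_act br_simps is_derivation_def)
next
  assume "pi_act D \<mu> = 0"
  then have "br (pi_act D \<mu>) X Y = 0" for X Y by (simp add: br_simps)
  then show "is_derivation \<mu> D"
    by (simp add: br_pi_act is_derivation_def algebra_simps)
qed

lemma derivation_br: "pi_act D \<mu> = 0 \<Longrightarrow> D *v br \<mu> X Y = br \<mu> (D *v X) Y + br \<mu> X (D *v Y)"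
  using is_derivation_iff is_derivation_def by blast

lemma ad_derivation: "pi_act D \<mu> = 0 \<Longrightarrow> ad \<mu> (D *v X) = D ** ad \<mu> X - ad \<mu> X ** D"
  using ad_pi_act[of D \<mu> X] by (simp add: ad_simps)

text \<open>Infinitesimal equivariance of the Killing form: the terms with A as a separate factor
  cancel by cyclicity of the trace. It serves for derivations and again for the derivative of
  \<open>Ricst\<close>.\<close>

lemma Bop_pi_act:
  "inner (Bop \<mu> *v (A *v X)) Y + inner (Bop \<mu> *v X) (A *v Y) =
   - trace (ad (pi_act A \<mu>) X ** ad \<mu> Y) - trace (ad \<mu> X ** ad (pi_act A \<mu>) Y)"
proof -
  have "trace (A ** ad \<mu> X ** ad \<mu> Y) = trace (ad \<mu> X ** ad \<mu> Y ** A)"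
    using trace_mul_sym[of A "ad \<mu> X ** ad \<mu> Y"] by (simp add: mmul_simps)
  then show ?thesis
    by (simp add: inner_Bop ad_pi_act mmul_simps trace_simps)
qed

lemma Bop_derivation:
  assumes "pi_act D \<mu> = 0"
  shows "Bop \<mu> ** D + transpose D ** Bop \<mu> = 0"
proof (rule mat_eqI, rule vec_eqI_inner)
  fix X Y
  show "inner ((Bop \<mu> ** D + transpose D ** Bop \<mu>) *v X) Y = inner (0 *v X) Y"
    using Bop_pi_act[of \<mu> D X Y] assms
    by (simp add: mvec_simps inner_add_left inner_mvec_left ad_simps mmul_simps trace_simps
        flip: matrix_vector_mul_assoc)
qed

text \<open>A derivation is skew with respect to the Killing form; the trace of that relation is
  twice the pairing.\<close>

lemma inner_Bop_derivation:
  assumes "pi_act D \<mu> = 0" shows "inner (Bop \<mu>) D = 0"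
proof -
  have "inner (Bop \<mu>) D = trace (transpose D ** Bop \<mu>)" "inner (Bop \<mu>) D = trace (Bop \<mu> ** D)"
    using trace_transpose[of "Bop \<mu> ** D"] trace_mul_sym[of "Bop \<mu>" "transpose D"]
    by (simp_all add: inner_mat_trace mmul_simps Bop_sym)
  moreover have "trace (Bop \<mu> ** D) + trace (transpose D ** Bop \<mu>) = 0"
    using Bop_derivation[OF assms] by (simp add: trace_zero flip: trace_add)
  ultimately show ?thesis by simp
qed

lemma inner_Mop_derivation: "pi_act D \<mu> = 0 \<Longrightarrow> inner (Mop \<mu>) D = 0"
  by (simp add: inner_Mop)

lemma pi_act_ad:
  assumes "is_lie \<mu>" shows "pi_act (ad \<mu> X) \<mu> = 0"
proof (rule brk_eqI)
  fix Y Z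
  have V: "\<mu> \<in> Vs" and J: "br \<mu> X (br \<mu> Y Z) + br \<mu> Y (br \<mu> Z X) + br \<mu> Z (br \<mu> X Y) = 0"
    using assms by (auto simp: is_lie_def)
  show "br (pi_act (ad \<mu> X) \<mu>) Y Z = br 0 Y Z"
    using J br_skew[OF V, of "br \<mu> X Y" Z] br_skew[OF V, of Z X]
    by (simp add: br_pi_act ad_mvec br_simps algebra_simps)
qed

text \<open>Pair with the identity, on which pi is minus one. The value also shows that a
  \<open>\<beta>\<close> arising this way is not zero.\<close>

lemma trace_mm:
  assumes "\<mu> \<noteq> 0" shows "trace (mm \<mu>) = -1"
  using inner_mm[of \<mu> "mat 1"] assms
  by (simp add: inner_mat_trace pi_act_id power2_norm_eq_inner)

text \<open>Pairing the soliton equation with beta gives c = -|beta|^2; pairing it with the Killing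
  form B then gives tr(B beta+) = 0.\<close>
lemma solvsoliton_pi_betaplus:
  assumes lie: "is_lie \<mu>" and R: "Ricst \<mu> = \<beta>" and tr: "trace \<beta> = -1"
    and sol: "Ric \<mu> = c *\<^sub>R mat 1 + D" "pi_act D \<mu> = 0"
  shows "inner (pi_act (betaplus \<beta>) \<mu>) \<mu> = 0"
proof -
  have V: "\<mu> \<in> Vs" using lie by (simp add: is_lie_def)
  let ?H = "ad \<mu> (mcurv \<mu>)"
  have H: "pi_act ?H \<mu> = 0" using lie by (rule pi_act_ad)
  have \<beta>: "transpose \<beta> = \<beta>" using Ricst_sym[of \<mu>] R by simp
  have ort: "inner \<beta> E = 0" if "pi_act E \<mu> = 0" for E
    using inner_Mop_derivation[OF that] inner_Bop_derivation[OF that]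
    by (simp add: Ricst_def inner_diff_left flip: R)
  have q: "inner (Ric \<mu>) S = inner (\<beta> - ?H) S" if "transpose S = S" for S
    by (rule quadratic_form_eq[OF _ that]) (simp add: ric_quadratic[OF V] R)
  have id: "inner A (mat 1) = trace A" for A :: "real^'a^'a"
    by (simp add: inner_mat_trace)
  have "inner \<beta> \<beta> = inner (\<beta> - ?H) \<beta>"
    using ort[OF H] by (simp add: inner_diff_left inner_commute[of ?H])
  also have "\<dots> = c * trace \<beta> + inner D \<beta>"
    unfolding q[OF \<beta>, symmetric] sol(1) by (simp add: inner_add_left inner_commute[of "mat 1"] id)
  finally have c: "c = - inner \<beta> \<beta>"
    using ort[OF sol(2)] tr by (simp add: inner_commute[of D])
  have "inner (Bop \<mu>) \<beta> = inner (\<beta> - ?H) (Bop \<mu>)"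
    using inner_Bop_derivation[OF H] by (simp add: inner_diff_left inner_commute[of ?H] inner_commute[of \<beta> "Bop \<mu>"])
  also have "\<dots> = c * trace (Bop \<mu>) + inner D (Bop \<mu>)"
    unfolding q[OF Bop_sym, symmetric] sol(1) by (simp add: inner_add_left inner_commute[of "mat 1"] id)
  finally have B: "inner (Bop \<mu>) \<beta> = - inner \<beta> \<beta> * trace (Bop \<mu>)"
    using inner_Bop_derivation[OF sol(2)] c by (simp add: inner_commute[of D])
  have "inner (Mop \<mu>) (betaplus \<beta>) = inner \<beta> (betaplus \<beta>) + inner (Bop \<mu>) (betaplus \<beta>) / 2"
    by (simp add: Ricst_def inner_diff_left flip: R)
  also have "\<dots> = 0"
    using B tr by (simp add: betaplus_def inner_add_right id power2_norm_eq_inner)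
  finally show ?thesis by (simp add: inner_Mop)
qed

section \<open>Self-adjoint operators\<close>

text \<open>A maximizer of the Rayleigh quotient on the unit sphere of S is an eigenvector: the
  defect g is nonnegative on S and zero at the maximizer, so its first variation there
  vanishes.\<close>

lemma selfadjoint_eigenvector:
  fixes f :: "'a::euclidean_space \<Rightarrow> 'a"
  assumes lin: "linear f" and sa: "\<And>x y. inner (f x) y = inner x (f y)"
    and S: "subspace S" "S \<noteq> {0}" and inv: "f ` S \<subseteq> S"
  obtains x r where "x \<in> S" "x \<noteq> 0" "f x = r *\<^sub>R x"
proof -
  let ?K = "sphere 0 1 \<inter> S"
  obtain v where v: "v \<in> S" "v \<noteq> 0" using S subspace_0 by blast
  have "v /\<^sub>R norm v \<in> ?K" using v S(1) by (simp add: subspace_scale)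
  then have ne: "?K \<noteq> {}" by blast
  have cp: "compact ?K" using closed_subspace[OF S(1)] by (simp add: compact_Int_closed)
  have cont: "continuous_on ?K (\<lambda>x. inner (f x) x)"
    using linear_continuous_on[of f ?K] lin linear_conv_bounded_linear
    by (intro continuous_intros) auto
  obtain u where u: "u \<in> ?K" and max: "\<And>y. y \<in> ?K \<Longrightarrow> inner (f y) y \<le> inner (f u) u"
    using continuous_attains_sup[OF cp ne cont] by blast
  define l where "l = inner (f u) u"
  have uu: "inner u u = 1" "u \<in> S" "u \<noteq> 0" using u by (auto simp: dot_square_norm)
  define g where "g y = l * inner y y - inner (f y) y" for y
  have gpos: "g y \<ge> 0" if "y \<in> S" for y
  proof (cases "y = 0")
    case False
    have "y /\<^sub>R norm y \<in> ?K" using False that S(1) by (simp add: subspace_scale)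
    from max[OF this] have "inner (f y) y / (norm y)^2 \<le> l"
      by (simp add: linear_cmul[OF lin] l_def power2_eq_square divide_inverse mult.commute mult.left_commute)
    then show ?thesis using False
      by (simp add: g_def power2_norm_eq_inner field_simps)
  qed (simp add: g_def linear_0[OF lin])
  have z: "inner (l *\<^sub>R u - f u) y = 0" if y: "y \<in> S" for y
  proof (rule ccontr)
    let ?b = "inner (l *\<^sub>R u - f u) y"
    assume b: "?b \<noteq> 0"
    have quad: "2 * t * ?b + t^2 * g y \<ge> 0" for t
    proof -
      have "g (u + t *\<^sub>R y) = 2 * t * ?b + t^2 * g y"
        using sa[of y u] uu
        by (simp add: g_def linear_add[OF lin] linear_cmul[OF lin] inner_simps inner_commute
            algebra_simps power2_eq_square l_def)
      then show ?thesis
        using gpos[of "u + t *\<^sub>R y"] uu y S(1) by (simp add: subspace_add subspace_scale)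
    qed
    \<comment> \<open>The exact minimizer of the quadratic would divide by \<open>g y\<close>, which
      may be 0; adding 1 keeps the denominator positive and the value still negative.\<close>
    define t where "t = - ?b / (1 + g y)"
    have gy: "1 + g y > 0" using gpos[OF y] by linarith
    have "2 * (- b / (1 + c)) * b + (- b / (1 + c))^2 * c = b^2 * (- 2 - c) / (1 + c)^2"
      if "1 + c > 0" for b c :: real
    proof -
      have "2 * (- b / (1 + c)) * b = - (2 * b^2 * (1 + c)) / (1 + c)^2"
        using that by (simp add: power2_eq_square)
      then show ?thesis by (simp add: power_divide algebra_simps diff_divide_distrib add_divide_distrib)
    qed
    then have "2 * t * ?b + t^2 * g y = ?b^2 * (- 2 - g y) / (1 + g y)^2"
      using gy unfolding t_def by blast
    also have "\<dots> < 0"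
      using gy b gpos[OF y] by (intro divide_neg_pos mult_pos_neg) auto
    finally show False using quad[of t] by linarith
  qed
  have "l *\<^sub>R u - f u \<in> S"
    using S(1) uu inv by (auto intro!: subspace_diff subspace_scale)
  from z[OF this] have "f u = l *\<^sub>R u" by simp
  with uu that show thesis by blast
qed

text \<open>An orthonormal family of common eigenvectors of largest size must span: otherwise its
  orthogonal complement is invariant under f and g, and an eigenspace of f inside it is invariant
  under g.\<close>

lemma commuting_selfadjoint_basis:
  fixes f g :: "'a::euclidean_space \<Rightarrow> 'a"
  assumes lin: "linear f" "linear g"
    and sa: "\<And>x y. inner (f x) y = inner x (f y)" "\<And>x y. inner (g x) y = inner x (g y)"
    and comm: "\<And>x. f (g x) = g (f x)"
  obtains Bs where "finite Bs" "pairwise orthogonal Bs" "\<And>b. b \<in> Bs \<Longrightarrow> norm b = 1"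
    "span Bs = UNIV" "\<And>b. b \<in> Bs \<Longrightarrow> (\<exists>r. f b = r *\<^sub>R b) \<and> (\<exists>r. g b = r *\<^sub>R b)"
proof -
  define good where "good Bs \<longleftrightarrow> finite Bs \<and> pairwise orthogonal Bs \<and> (\<forall>b\<in>Bs. norm b = 1) \<and>
    (\<forall>b\<in>Bs. (\<exists>r. f b = r *\<^sub>R b) \<and> (\<exists>r. g b = r *\<^sub>R b))" for Bs
  have bound: "card Bs \<le> DIM('a)" if "good Bs" for Bs
  proof -
    have "independent Bs"
      using that by (intro pairwise_orthogonal_independent) (auto simp: good_def)
    then show ?thesis using independent_bound by blast
  qed
  have "good {}" by (simp add: good_def)
  then obtain Bs where Bs: "good Bs" and mx: "\<And>Cs. good Cs \<Longrightarrow> card Cs \<le> card Bs"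
    using ex_has_greatest_nat[of good "{}" card "Suc DIM('a)"] bound by (metis less_Suc_eq_le)
  have "span Bs = UNIV"
  proof (rule ccontr)
    assume ns: "span Bs \<noteq> UNIV"
    define W where "W = {x. \<forall>b\<in>Bs. inner x b = 0}"
    have W: "subspace W" by (auto simp: W_def subspace_def inner_simps)
    obtain a where a: "a \<noteq> 0" "\<And>x. x \<in> span Bs \<Longrightarrow> inner a x = 0"
      using span_not_UNIV_orthogonal[OF ns] by blast
    then have "a \<in> W" by (auto simp: W_def span_base)
    then have W0: "W \<noteq> {0}" using a by blast
    have fW: "f ` W \<subseteq> W"
    proof safe
      fix x assume x: "x \<in> W"
      have "inner (f x) b = 0" if b: "b \<in> Bs" for b
      proof -
        obtain r where "f b = r *\<^sub>R b" using Bs b by (auto simp: good_def)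
        then show ?thesis using x b by (simp add: sa W_def)
      qed
      then show "f x \<in> W" by (simp add: W_def)
    qed
    have gW: "g ` W \<subseteq> W"
    proof safe
      fix x assume x: "x \<in> W"
      have "inner (g x) b = 0" if b: "b \<in> Bs" for b
      proof -
        obtain r where "g b = r *\<^sub>R b" using Bs b by (auto simp: good_def)
        then show ?thesis using x b by (simp add: sa W_def)
      qed
      then show "g x \<in> W" by (simp add: W_def)
    qed
    obtain x r where x: "x \<in> W" "x \<noteq> 0" "f x = r *\<^sub>R x"
      using selfadjoint_eigenvector[OF lin(1) sa(1) W W0 fW] by blast
    define W' where "W' = W \<inter> {x. f x = r *\<^sub>R x}"
    have W': "subspace W'"
      unfolding W'_def by (intro subspace_inter W)
        (auto simp: subspace_def linear_add[OF lin(1)] linear_cmul[OF lin(1)] linear_0[OF lin(1)] algebra_simps)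
    have "x \<in> W'" using x by (simp add: W'_def)
    then have W'0: "W' \<noteq> {0}" using x by blast
    have gW': "g ` W' \<subseteq> W'"
      using gW by (auto simp: W'_def comm linear_cmul[OF lin(2)])
    obtain y s where y: "y \<in> W'" "y \<noteq> 0" "g y = s *\<^sub>R y"
      using selfadjoint_eigenvector[OF lin(2) sa(2) W' W'0 gW'] by blast
    define u where "u = y /\<^sub>R norm y"
    have u: "norm u = 1" "f u = r *\<^sub>R u" "g u = s *\<^sub>R u" "\<forall>b\<in>Bs. inner u b = 0"
      using y by (auto simp: u_def W'_def W_def linear_cmul[OF lin(1)] linear_cmul[OF lin(2)])
    have "u \<notin> Bs" using u by (metis inner_eq_zero_iff norm_zero zero_neq_one)
    moreover have "good (insert u Bs)"
      using Bs u by (auto simp: good_def pairwise_insert orthogonal_def inner_commute)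
    ultimately show False using mx[of "insert u Bs"] Bs by (simp add: good_def)
  qed
  with Bs that show thesis by (auto simp: good_def)
qed

text \<open>Eigenvectors with negative eigenvalue are orthogonal to the span, so the quadratic form
  is a sum of nonnegative terms. This turns <pi(beta+) mu, mu> = 0 into the statement that beta+ is
  a derivation.\<close>

lemma selfadjoint_nonneg_part:
  fixes f :: "'a::euclidean_space \<Rightarrow> 'a"
  assumes lin: "linear f" and sa: "\<And>x y. inner (f x) y = inner x (f y)"
    and x: "x \<in> span {y. \<exists>r\<ge>0. f y = r *\<^sub>R y}"
  shows "inner (f x) x \<ge> 0" and "inner (f x) x = 0 \<Longrightarrow> f x = 0"
proof -
  obtain Bs where Bs: "finite Bs" "pairwise orthogonal Bs" "\<And>b. b \<in> Bs \<Longrightarrow> norm b = 1"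
    "span Bs = UNIV" "\<And>b. b \<in> Bs \<Longrightarrow> \<exists>r. f b = r *\<^sub>R b"
    using commuting_selfadjoint_basis[OF lin lin sa sa] by (metis (no_types, lifting))
  then obtain e where e: "\<And>b. b \<in> Bs \<Longrightarrow> f b = e b *\<^sub>R b" by metis
  have ex: "(\<Sum>b\<in>Bs. inner y b *\<^sub>R b) = y" for y
    using orthonormal_basis_expand[OF Bs(2,3) _ Bs(1)] Bs(4) by simp
  have z: "inner x b = 0" if b: "b \<in> Bs" "e b < 0" for b
  proof -
    have "orthogonal b x"
    proof (rule orthogonal_to_span[OF x])
      fix y assume "y \<in> {y. \<exists>r\<ge>0. f y = r *\<^sub>R y}"
      then obtain r where r: "r \<ge> 0" "f y = r *\<^sub>R y" by blast
      have "r * inner b y = e b * inner b y"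
        using sa[of b y] e[OF b(1)] r by auto
      then show "orthogonal b y" using r b by (metis mult_cancel_right not_le orthogonal_def)
    qed
    then show ?thesis by (simp add: orthogonal_def inner_commute)
  qed
  have fx: "f x = (\<Sum>b\<in>Bs. (inner x b * e b) *\<^sub>R b)"
  proof -
    have "f (\<Sum>b\<in>Bs. inner x b *\<^sub>R b) = (\<Sum>b\<in>Bs. (inner x b * e b) *\<^sub>R b)"
      by (simp add: linear_sum[OF lin] linear_cmul[OF lin] e)
    then show ?thesis by (simp add: ex)
  qed
  have q: "inner (f x) x = (\<Sum>b\<in>Bs. e b * (inner x b)^2)"
    unfolding fx inner_sum_left
    by (intro sum.cong) (simp_all add: inner_commute power2_eq_square algebra_simps)
  have nn: "e b * (inner x b)^2 \<ge> 0" if "b \<in> Bs" for b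
    using z[OF that] by (cases "e b < 0") auto
  show "inner (f x) x \<ge> 0" unfolding q by (intro sum_nonneg nn)
  assume "inner (f x) x = 0"
  then have "\<forall>b\<in>Bs. e b * (inner x b)^2 = 0"
    unfolding q using sum_nonneg_eq_0_iff[OF Bs(1), of "\<lambda>b. e b * (inner x b)^2"] nn by blast
  then show "f x = 0" unfolding fx by (intro sum.neutral) auto
qed

text \<open>Splitting an eigenbasis expansion by the sign of the eigenvalue. Applied to A |->
  [beta, A] it gives the existence half of \<open>projq\<close>.\<close>

lemma selfadjoint_trichotomy:
  fixes f :: "'a::euclidean_space \<Rightarrow> 'a"
  assumes lin: "linear f" and sa: "\<And>x y. inner (f x) y = inner x (f y)"
  obtains u v w where "x = u + v + w" "u \<in> span {y. \<exists>r<0. f y = r *\<^sub>R y}" "f v = 0"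
    "w \<in> span {y. \<exists>r>0. f y = r *\<^sub>R y}"
proof -
  obtain Bs where Bs: "finite Bs" "pairwise orthogonal Bs" "\<And>b. b \<in> Bs \<Longrightarrow> norm b = 1"
    "span Bs = UNIV" "\<And>b. b \<in> Bs \<Longrightarrow> \<exists>r. f b = r *\<^sub>R b"
    using commuting_selfadjoint_basis[OF lin lin sa sa] by (metis (no_types, lifting))
  then obtain e where e: "\<And>b. b \<in> Bs \<Longrightarrow> f b = e b *\<^sub>R b" by metis
  have ex: "(\<Sum>b\<in>Bs. inner x b *\<^sub>R b) = x"
    using orthonormal_basis_expand[OF Bs(2,3) _ Bs(1)] Bs(4) by simp
  let ?s = "\<lambda>P. \<Sum>b\<in>{b\<in>Bs. P (e b)}. inner x b *\<^sub>R b"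
  have "x = ?s (\<lambda>r. r < 0) + ?s (\<lambda>r. r = 0) + ?s (\<lambda>r. r > 0)"
  proof -
    have "Bs = {b\<in>Bs. e b < 0} \<union> {b\<in>Bs. e b = 0} \<union> {b\<in>Bs. e b > 0}" by force
    then have "(\<Sum>b\<in>Bs. inner x b *\<^sub>R b) =
      (\<Sum>b\<in>{b\<in>Bs. e b < 0} \<union> {b\<in>Bs. e b = 0} \<union> {b\<in>Bs. e b > 0}. inner x b *\<^sub>R b)" by simp
    also have "\<dots> = ?s (\<lambda>r. r < 0) + ?s (\<lambda>r. r = 0) + ?s (\<lambda>r. r > 0)"
      using Bs(1) by (subst sum.union_disjoint; auto)+
    finally show ?thesis by (simp add: ex)
  qed
  moreover have "?s (\<lambda>r. r < 0) \<in> span {y. \<exists>r<0. f y = r *\<^sub>R y}"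
    by (intro span_sum span_scale span_base) (use e in auto)
  moreover have "?s (\<lambda>r. r > 0) \<in> span {y. \<exists>r>0. f y = r *\<^sub>R y}"
    by (intro span_sum span_scale span_base) (use e in auto)
  moreover have "f (?s (\<lambda>r. r = 0)) = 0"
    by (simp add: linear_sum[OF lin] linear_cmul[OF lin] e)
  ultimately show thesis using that by blast
qed

lemma selfadjoint_span_orthogonal:
  fixes f :: "'a::real_inner \<Rightarrow> 'a"
  assumes sa: "\<And>x y. inner (f x) y = inner x (f y)"
    and x: "x \<in> span {y. \<exists>r. P r \<and> f y = r *\<^sub>R y}" and y: "y \<in> span {y. \<exists>r. Q r \<and> f y = r *\<^sub>R y}"
    and PQ: "\<And>r. P r \<Longrightarrow> Q r \<Longrightarrow> False"
  shows "inner x y = 0"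
proof -
  have 1: "orthogonal u v" if "P r" "f u = r *\<^sub>R u" "Q s" "f v = s *\<^sub>R v" for u v r s
    using sa[of u v] that PQ[of r] by (auto simp: orthogonal_def)
  have "orthogonal u y" if "P r" "f u = r *\<^sub>R u" for u r
    by (rule orthogonal_to_span[OF y]) (use 1 that in blast)
  then have "orthogonal y x"
    by (intro orthogonal_to_span[OF x]) (auto simp: orthogonal_commute)
  then show ?thesis by (simp add: orthogonal_def inner_commute)
qed

section \<open>Trace criteria for matrices\<close>

lemma matpow_0: "matpow A 0 = mat 1"
  by (simp add: matpow_def)

lemma matpow_Suc: "matpow A (Suc k) = A ** matpow A k"
  by (simp add: matpow_def)

lemma matpow_add: "matpow A (m + k) = matpow A m ** matpow A k"
  by (induction m) (simp_all add: matpow_0 matpow_Suc mmul_simps)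

lemma matpow_commute: "A ** M = M ** A \<Longrightarrow> matpow A k ** M = M ** matpow A k"
proof (induction k)
  case (Suc k)
  then show ?case by (metis matpow_Suc matrix_mul_assoc)
qed (simp add: matpow_0)

text \<open>Cyclicity moves A past M. This is how traces of powers of ad are shown to
  vanish.\<close>

lemma trace_commutator_zero:
  fixes A M Y :: "real^'n^'n"
  assumes "A ** M = M ** A" shows "trace ((Y ** A - A ** Y) ** M) = 0"
  using trace_mul_sym[of A "Y ** M"] assms by (simp add: mmul_simps trace_simps)

text \<open>The trace of an idempotent is its rank: for the orthogonal projection P onto the range,
  P e = e, so tr e = tr(e P), and each vector of an orthonormal basis of the range contributes
  1.\<close>

lemma idempotent_trace_zero:
  fixes e :: "real^'n^'n"
  assumes "e ** e = e" "trace e = 0"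
  shows "e = 0"
proof -
  define R where "R = {x. e *v x = x}"
  have R: "subspace R" by (auto simp: R_def subspace_def mvec_simps)
  obtain B where B: "B \<subseteq> R" "pairwise orthogonal B" "\<And>x. x \<in> B \<Longrightarrow> norm x = 1"
    "independent B" "span B = R"
    using orthonormal_basis_subspace[OF R] by metis
  have fin: "finite B" using B(4) by (rule independent_imp_finite)
  define P where "P = (\<Sum>b\<in>B. outer b b)"
  have P: "P *v x = (\<Sum>b\<in>B. inner x b *\<^sub>R b)" for x
  proof -
    have l: "linear (\<lambda>A. A *v x)" by (rule linearI) (simp_all add: mvec_simps)
    show ?thesis unfolding P_def linear_sum[OF l] by (simp add: outer_mvec inner_commute)
  qed
  have "P ** e = e"
  proof (rule mat_eqI)
    fix x
    have "e *v x \<in> span B" unfolding B(5) R_def using assms(1) by (simp add: matrix_vector_mul_assoc)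
    then have "P *v (e *v x) = e *v x"
      unfolding P using B(2,3) fin by (intro orthonormal_basis_expand)
    then show "(P ** e) *v x = e *v x" by (simp flip: matrix_vector_mul_assoc)
  qed
  moreover have "transpose P = P"
  proof -
    have l: "linear (transpose :: real^'n^'n \<Rightarrow> _)" by (rule linearI) (simp_all add: mmul_simps)
    show ?thesis unfolding P_def linear_sum[OF l] by (simp add: transpose_outer)
  qed
  ultimately have "trace e = inner e P"
    using trace_mul_sym[of P e] by (simp add: inner_mat_trace)
  also have "\<dots> = (\<Sum>b\<in>B. 1)"
    unfolding P_def inner_sum_right using B(1,3)
    by (intro sum.cong) (auto simp: inner_outer R_def dot_square_norm)
  finally have "B = {}" using assms(2) fin by simp
  then have R0: "R = {0}" using B(5) by simp
  show ?thesis
  proof (rule mat_eqI)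
    fix x
    have "e *v x \<in> R" unfolding R_def using assms(1) by (simp add: matrix_vector_mul_assoc)
    then show "e *v x = 0 *v x" using R0 by simp
  qed
qed

text \<open>An argument over the reals without eigenvalues. The spans of high powers stabilize, so
  c^k = c^k e for some e in the span of the powers from k on; such an e is idempotent and traceless,
  hence zero.\<close>

lemma nilpotent_of_traces:
  fixes c :: "real^'n^'n"
  assumes tr: "\<And>m. trace (matpow c (Suc m)) = 0"
  obtains k where "matpow c k = 0"
proof -
  define T where "T k = span {matpow c m | m. m \<ge> k}" for k
  have T: "subspace (T k)" for k by (simp add: T_def)
  have Tmono: "T m \<subseteq> T k" if "k \<le> m" for k m
    unfolding T_def using that by (intro span_mono) auto
  \<comment> \<open>Starting at 1 keeps the identity, whose trace is not assumed to vanish, out of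
    the generators.\<close>
  have "\<exists>k\<in>{1..}. \<forall>m\<in>{1..}. dim (T k) \<le> dim (T m)"
    using ex_has_least_nat[of "\<lambda>k. k \<ge> 1" 1 "\<lambda>k. dim (T k)"] by auto
  then obtain k where k: "k \<ge> 1" "\<And>m. m \<ge> 1 \<Longrightarrow> dim (T k) \<le> dim (T m)" by auto
  have "T (2 * k) = T k"
    by (rule subspace_dim_equal[OF T T Tmono]) (use k in auto)
  moreover have "T (2 * k) \<subseteq> (\<lambda>e. matpow c k ** e) ` T k"
    unfolding T_def[of "2 * k"]
  proof (rule span_minimal)
    show "subspace ((\<lambda>e. matpow c k ** e) ` T k)"
      by (intro linear_subspace_image T linearI) (simp_all add: mmul_simps)
    show "{matpow c m |m. 2 * k \<le> m} \<subseteq> (\<lambda>e. matpow c k ** e) ` T k"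
    proof safe
      fix m assume m: "2 * k \<le> m"
      have "matpow c m = matpow c k ** matpow c (m - k)"
        using m by (simp flip: matpow_add)
      moreover have "matpow c (m - k) \<in> T k"
        unfolding T_def by (intro span_base) (use m in auto)
      ultimately show "matpow c m \<in> (\<lambda>e. matpow c k ** e) ` T k" by blast
    qed
  qed
  moreover have "matpow c k \<in> T k" unfolding T_def by (intro span_base) auto
  ultimately obtain e where e: "e \<in> T k" "matpow c k ** e = matpow c k" by (metis imageE subsetD)
  have xe: "x ** e = x" if "x \<in> T k" for x
    using that unfolding T_def
  proof (induction rule: span_induct)
    case base
    show ?case by (auto simp: subspace_def mmul_simps)
  next
    case (step x)
    then obtain m where m: "x = matpow c m" "m \<ge> k" by blast
    have "matpow c m = matpow c (m - k) ** matpow c k"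
      using m by (simp flip: matpow_add)
    then show ?case using e(2) m by (simp add: matrix_mul_assoc[symmetric])
  qed
  have tr0: "trace x = 0" if "x \<in> T k" for x
    using that unfolding T_def
  proof (induction rule: span_induct)
    case base
    show ?case by (auto simp: subspace_def trace_simps)
  next
    case (step x)
    then obtain m where "x = matpow c m" "m \<ge> k" by blast
    then show ?case using k(1) tr[of "m - 1"] by simp
  qed
  have "e = 0" using idempotent_trace_zero xe tr0 e(1) by blast
  then show thesis using e(2) that by (simp add: mmul_simps)
qed

text \<open>Normality gives |N^t y| = |N y|, so N and N^2 have the same kernel.\<close>

lemma normal_nilpotent_zero:
  fixes N :: "real^'n^'n"
  assumes "transpose N ** N = N ** transpose N" "matpow N k = 0"
  shows "N = 0"
proof -
  have ker: "N *v x = 0" if "N *v (N *v x) = 0" for x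
  proof -
    have "inner (transpose N *v y) (transpose N *v y) = inner (N *v y) (N *v y)" for y
      by (simp add: inner_mvec_left matrix_vector_mul_assoc assms(1))
    from this[of "N *v x"]
    have "transpose N *v (N *v x) = 0" using that by simp
    then have "inner (N *v x) (N *v x) = 0" by (simp add: inner_mvec_left)
    then show ?thesis by simp
  qed
  have "N *v x = 0" if "matpow N (Suc k) *v x = 0" for x
    using that
  proof (induction k)
    case (Suc k)
    then have "N *v (N *v (matpow N k *v x)) = 0"
      by (simp add: matpow_Suc matrix_vector_mul_assoc)
    from ker[OF this] show ?case by (intro Suc.IH) (simp add: matpow_Suc matrix_vector_mul_assoc)
  qed (simp add: matpow_Suc matpow_0)
  then show ?thesis using assms(2) by (intro mat_eqI) (simp add: matpow_Suc mmul_simps)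
qed

section \<open>Solvability and abelian subalgebras\<close>

text \<open>Iterated brackets of full binary shape: unlike the derived series, their vanishing is
  evidently a closed condition on the bracket.\<close>
fun dword :: "'n::finite brk \<Rightarrow> nat \<Rightarrow> (nat \<Rightarrow> real^'n) \<Rightarrow> real^'n" where
  "dword \<mu> 0 f = f 0"
| "dword \<mu> (Suc k) f = br \<mu> (dword \<mu> k (\<lambda>i. f (2 * i))) (dword \<mu> k (\<lambda>i. f (2 * i + 1)))"

lemma dword_in_derived: "dword \<mu> k f \<in> derived \<mu> k"
proof (induction k arbitrary: f)
  case (Suc k)
  then show ?case by (auto intro!: span_base)
qed simp

lemma solvable_dword:
  assumes "solvable_br \<mu>" obtains K where "\<And>f. dword \<mu> K f = 0"
  using assms dword_in_derived unfolding solvable_br_def by (metis singletonD)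

text \<open>Plays the part of the k-th derived algebra of a subalgebra S, spanned by words so that
  vanishing of words transfers to it.\<close>

definition dset :: "'n::finite brk \<Rightarrow> (real^'n) set \<Rightarrow> nat \<Rightarrow> (real^'n) set" where
  "dset \<mu> S k = span {dword \<mu> k f | f. \<forall>i. f i \<in> S}"

lemma dset_0: "subspace S \<Longrightarrow> dset \<mu> S 0 = S"
proof -
  assume S: "subspace S"
  have "{dword \<mu> 0 f | f. \<forall>i. f i \<in> S} = S"
    by (auto intro: exI[of _ "\<lambda>_. _"])
  then show ?thesis using S by (simp add: dset_def span_eq_iff)
qed

lemma dword_dset: "(\<And>i. f i \<in> S) \<Longrightarrow> dword \<mu> k f \<in> dset \<mu> S k"
  unfolding dset_def by (intro span_base) blast

lemma br_dset:
  assumes "X \<in> dset \<mu> S k" "Y \<in> dset \<mu> S k"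
  shows "br \<mu> X Y \<in> dset \<mu> S (Suc k)"
proof -
  have sub: "subspace (dset \<mu> S (Suc k))" by (simp add: dset_def)
  have gen: "br \<mu> (dword \<mu> k f) (dword \<mu> k g) \<in> dset \<mu> S (Suc k)"
    if "\<forall>i. f i \<in> S" "\<forall>i. g i \<in> S" for f g
    \<comment> \<open>Even positions feed the left factor and odd positions the right one.\<close>
    using dword_dset[of "\<lambda>i. if even i then f (i div 2) else g (i div 2)" S \<mu> "Suc k"] that by simp
  have 1: "br \<mu> (dword \<mu> k f) Y \<in> dset \<mu> S (Suc k)" if f: "\<forall>i. f i \<in> S" for f
    using assms(2) unfolding dset_def[of \<mu> S k]
  proof (induction rule: span_induct)
    case base
    show ?case using sub by (auto simp: subspace_def br_simps)
  qed (use gen f in auto)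
  show ?thesis
    using assms(1) unfolding dset_def[of \<mu> S k]
  proof (induction rule: span_induct)
    case base
    show ?case using sub by (auto simp: subspace_def br_simps)
  qed (use 1 in auto)
qed

lemma dset_Suc_induct:
  assumes "X \<in> dset \<mu> S (Suc k)" "subspace T"
    and "\<And>x y. x \<in> dset \<mu> S k \<Longrightarrow> y \<in> dset \<mu> S k \<Longrightarrow> br \<mu> x y \<in> T"
  shows "X \<in> T"
proof -
  have "{dword \<mu> (Suc k) f | f. \<forall>i. f i \<in> S} \<subseteq> T"
  proof safe
    fix f :: "nat \<Rightarrow> _" assume "\<forall>i. f i \<in> S"
    then show "dword \<mu> (Suc k) f \<in> T" using assms(3) by (simp add: dword_dset)
  qed
  then show ?thesis using assms(1,2) span_minimal unfolding dset_def by blast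
qed

lemma subspace_dset: "subspace (dset \<mu> S k)"
  by (simp add: dset_def)

lemma dset_decreasing:
  assumes "subspace S" "\<And>X Y. X \<in> S \<Longrightarrow> Y \<in> S \<Longrightarrow> br \<mu> X Y \<in> S"
  shows "dset \<mu> S (Suc k) \<subseteq> dset \<mu> S k"
proof (induction k)
  case 0
  show ?case
  proof
    fix X assume "X \<in> dset \<mu> S (Suc 0)"
    then show "X \<in> dset \<mu> S 0"
      unfolding dset_0[OF assms(1)]
      by (rule dset_Suc_induct[OF _ assms(1)]) (use assms in \<open>simp add: dset_0\<close>)
  qed
next
  case (Suc k)
  show ?case
  proof
    fix X assume "X \<in> dset \<mu> S (Suc (Suc k))"
    then show "X \<in> dset \<mu> S (Suc k)"
      by (rule dset_Suc_induct[OF _ subspace_dset]) (use Suc br_dset in blast)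
  qed
qed

lemma dset_subset:
  assumes "subspace S" "\<And>X Y. X \<in> S \<Longrightarrow> Y \<in> S \<Longrightarrow> br \<mu> X Y \<in> S"
  shows "dset \<mu> S k \<subseteq> S"
proof (induction k)
  case (Suc k)
  then show ?case using dset_decreasing[OF assms, of k] by blast
qed (simp add: dset_0 assms)

text \<open>The derived series is characteristic: by the Leibniz rule, a derivation that preserves S
  preserves every term. Transposes of ad will be such derivations.\<close>

lemma dset_derivation:
  assumes S: "subspace S" and T: "pi_act T \<mu> = 0" "\<And>X. X \<in> S \<Longrightarrow> T *v X \<in> S"
    and X: "X \<in> dset \<mu> S k"
  shows "T *v X \<in> dset \<mu> S k"
  using X
proof (induction k arbitrary: X)
  case 0
  then show ?case using T(2) by (simp add: dset_0 S)
next
  case (Suc k)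
  have "X \<in> {X. T *v X \<in> dset \<mu> S (Suc k)}"
  proof (rule dset_Suc_induct[OF Suc.prems])
    show "subspace {X. T *v X \<in> dset \<mu> S (Suc k)}"
      using subspace_dset[of \<mu> S "Suc k"] by (auto simp: subspace_def mvec_simps)
    fix x y assume "x \<in> dset \<mu> S k" "y \<in> dset \<mu> S k"
    then show "br \<mu> x y \<in> {X. T *v X \<in> dset \<mu> S (Suc k)}"
      unfolding mem_Collect_eq derivation_br[OF T(1)]
      by (intro subspace_add[OF subspace_dset] br_dset Suc.IH)
  qed
  then show ?case by simp
qed

text \<open>For W the last nonzero term of the derived series, both the elements of [S, W] and, once
  these vanish, those of W itself are ad-traceless in all powers.\<close>
lemma solvable_subalgebra_abelian:
  assumes lie: "is_lie \<mu>" and solv: "\<And>f. dword \<mu> K f = 0"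
    and S: "subspace S" "\<And>X Y. X \<in> S \<Longrightarrow> Y \<in> S \<Longrightarrow> br \<mu> X Y \<in> S"
    and P: "\<And>W X. W \<subseteq> S \<Longrightarrow> (\<And>X Y. X \<in> W \<Longrightarrow> Y \<in> W \<Longrightarrow> br \<mu> X Y = 0) \<Longrightarrow>
       (\<And>T X. pi_act T \<mu> = 0 \<Longrightarrow> (\<And>Z. Z \<in> S \<Longrightarrow> T *v Z \<in> S) \<Longrightarrow> X \<in> W \<Longrightarrow> T *v X \<in> W) \<Longrightarrow>
       X \<in> W \<Longrightarrow> (\<And>m. trace (matpow (ad \<mu> X) (Suc m)) = 0) \<Longrightarrow> X = 0"
    and XY: "X \<in> S" "Y \<in> S"
  shows "br \<mu> X Y = 0"
proof (rule ccontr)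
  assume n: "br \<mu> X Y \<noteq> 0"
  have V: "\<mu> \<in> Vs" using lie by (simp add: is_lie_def)
  have "dset \<mu> S K \<subseteq> {0}"
    unfolding dset_def by (rule span_minimal) (auto simp: solv)
  define k where "k = (LEAST k. dset \<mu> S k \<subseteq> {0})"
  have k: "dset \<mu> S k \<subseteq> {0}"
    unfolding k_def by (rule LeastI, fact)
  have below: "\<not> dset \<mu> S j \<subseteq> {0}" if "j < k" for j
    using not_less_Least that unfolding k_def by blast
  have XY0: "X \<in> dset \<mu> S 0" "Y \<in> dset \<mu> S 0" using XY S(1) by (simp_all add: dset_0)
  have "k \<noteq> 0"
  proof
    assume "k = 0"
    then have "X = 0" using k XY0 by auto
    with n show False by (simp add: br_simps)
  qed
  \<comment> \<open>The nonzero bracket of X and Y excludes k = 1, so the last nonzero term lies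
    inside [S, S].\<close>
  moreover have "k \<noteq> Suc 0" using k n br_dset[OF XY0] by auto
  ultimately obtain j where j: "k = Suc (Suc j)" by (metis not0_implies_Suc)
  define W where "W = dset \<mu> S (Suc j)"
  have WS: "W \<subseteq> S" unfolding W_def by (rule dset_subset[OF S])
  have WW: "br \<mu> x y = 0" if "x \<in> W" "y \<in> W" for x y
    using br_dset[of x \<mu> S "Suc j" y] that k unfolding W_def j by auto
  have WT: "T *v x \<in> W" if "pi_act T \<mu> = 0" "\<And>Z. Z \<in> S \<Longrightarrow> T *v Z \<in> S" "x \<in> W" for T x
    using dset_derivation[OF S(1)] that unfolding W_def by blast
  have Wid: "br \<mu> y a \<in> W" if "y \<in> S" "a \<in> W" for y a
    using WT[OF pi_act_ad[OF lie, of y] _ that(2)] S(2) that(1) by (simp add: ad_mvec)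
  have adbr: "ad \<mu> (br \<mu> x y) = ad \<mu> x ** ad \<mu> y - ad \<mu> y ** ad \<mu> x" for x y
    using ad_derivation[OF pi_act_ad[OF lie, of x], of y] by (simp add: ad_mvec)
  have comm: "ad \<mu> x ** ad \<mu> y = ad \<mu> y ** ad \<mu> x" if "br \<mu> x y = 0" for x y
    using adbr[of x y] that by (simp add: ad_simps)
  have P': "x = 0" if "x \<in> W" "\<And>m. trace (matpow (ad \<mu> x) (Suc m)) = 0" for x
    by (rule P[of W]) (use WS WW WT that in blast)+
  have SW: "br \<mu> y a = 0" if y: "y \<in> S" and a: "a \<in> W" for y a
  proof (rule P')
    show c: "br \<mu> y a \<in> W" using Wid y a .
    \<comment> \<open>Both [y, a] and a lie in the abelian ideal W, so ad a commutes with every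
      power of ad [y, a], while ad [y, a] is itself a commutator with ad a.\<close>
    have "ad \<mu> (br \<mu> y a) ** ad \<mu> a = ad \<mu> a ** ad \<mu> (br \<mu> y a)"
      by (rule comm) (rule WW[OF c a])
    from matpow_commute[OF this]
    have "ad \<mu> a ** matpow (ad \<mu> (br \<mu> y a)) m = matpow (ad \<mu> (br \<mu> y a)) m ** ad \<mu> a" for m by simp
    from trace_commutator_zero[OF this]
    show "trace (matpow (ad \<mu> (br \<mu> y a)) (Suc m)) = 0" for m
      unfolding matpow_Suc by (subst adbr)
  qed
  have W1: "W \<subseteq> dset \<mu> S (Suc 0)"
    unfolding W_def
  proof (induction j)
    case (Suc j)
    then show ?case using dset_decreasing[OF S, of "Suc j"] by blast
  qed simp
  have "x = 0" if x: "x \<in> W" for x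
  proof (rule P'[OF x])
    fix m
    \<comment> \<open>W now centralizes S, so ad z commutes with ad x for z in S; the trace is
      linear in u and vanishes on the generators [y, z] of [S, S].\<close>
    have "x \<in> {u. trace (ad \<mu> u ** matpow (ad \<mu> x) m) = 0}"
    proof (rule dset_Suc_induct)
      show "x \<in> dset \<mu> S (Suc 0)" using x W1 by blast
      show "subspace {u. trace (ad \<mu> u ** matpow (ad \<mu> x) m) = 0}"
        by (auto simp: subspace_def ad_simps mmul_simps trace_simps)
      fix y z assume "y \<in> dset \<mu> S 0" "z \<in> dset \<mu> S 0"
      then have "br \<mu> z x = 0" using SW x S(1) by (simp add: dset_0)
      then have "ad \<mu> z ** matpow (ad \<mu> x) m = matpow (ad \<mu> x) m ** ad \<mu> z"
        using matpow_commute[OF comm, of x z m] br_skew[OF V, of z x] by simp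
      from trace_commutator_zero[OF this]
      show "br \<mu> y z \<in> {u. trace (ad \<mu> u ** matpow (ad \<mu> x) m) = 0}" by (simp add: adbr)
    qed
    then show "trace (matpow (ad \<mu> x) (Suc m)) = 0" by (simp add: matpow_Suc)
  qed
  then have "W \<subseteq> {0}" by blast
  with below[of "Suc j"] j W_def show False by simp
qed

section \<open>Brackets whose moment map is a multiple of beta\<close>

lemma inner_pi_commutator_transpose:
  "inner (pi_act (E ** transpose E - transpose E ** E) \<mu>) \<mu> =
   (norm (pi_act (transpose E) \<mu>))^2 - (norm (pi_act E \<mu>))^2"
proof -
  have "pi_act (E ** transpose E - transpose E ** E) \<mu> =
    pi_act E (pi_act (transpose E) \<mu>) - pi_act (transpose E) (pi_act E \<mu>)"
    using pi_act_commute[of E "transpose E" \<mu>] by simp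
  then show ?thesis
    by (simp add: inner_diff_left inner_pi_act power2_norm_eq_inner)
qed

text \<open>Since the adjoint of pi(E) is pi(E^t), pairing the moment map with [E, E^t] gives a
  difference of two squared norms, and for a derivation one of them is zero. This is how
  \<open>Mop\<close> yields inequalities.\<close>

lemma Mop_commutator_derivation:
  assumes "pi_act E \<mu> = 0"
  shows "(norm (pi_act (transpose E) \<mu>))^2 = 4 * inner (Mop \<mu>) (E ** transpose E - transpose E ** E)"
  using inner_pi_commutator_transpose[of E \<mu>] assms by (simp add: inner_Mop)

text \<open>For E of degree r under [beta, .] the pairing is r |E|^2, which links the sign of r to a
  squared norm.\<close>

lemma inner_commutator_transpose:
  fixes \<beta> :: "real^'n^'n"
  assumes "transpose \<beta> = \<beta>"
  shows "inner \<beta> (E ** transpose E - transpose E ** E) = inner (\<beta> ** E - E ** \<beta>) E"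
proof -
  have "inner \<beta> (E ** transpose E) = inner (\<beta> ** E) E"
    using inner_mmul_right[of E "transpose E" \<beta>] by (simp add: inner_commute)
  moreover have "inner \<beta> (transpose E ** E) = inner (E ** \<beta>) E"
    using inner_mmul_left[of E \<beta> E] by simp
  ultimately show ?thesis by (simp add: inner_diff_right inner_diff_left)
qed

lemma betaplus_mvec: "betaplus \<beta> *v X = \<beta> *v X + (norm \<beta>)^2 *\<^sub>R X"
  by (simp add: betaplus_def mvec_simps)

lemma betaplus_commutator: "betaplus \<beta> ** A - A ** betaplus \<beta> = \<beta> ** A - A ** \<beta>"
  by (simp add: betaplus_def mmul_simps)

lemma betaplus_sym: "transpose \<beta> = \<beta> \<Longrightarrow> transpose (betaplus \<beta>) = betaplus \<beta>"
  by (simp add: betaplus_def mmul_simps)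

definition szero :: "'n::finite mat \<Rightarrow> (real^'n) set" where
  "szero \<beta> = {X. betaplus \<beta> *v X = 0}"

lemma subspace_szero: "subspace (szero \<beta>)"
  by (auto simp: szero_def subspace_def mvec_simps)

lemma szero_br:
  assumes "pi_act (betaplus \<beta>) \<mu> = 0" "X \<in> szero \<beta>" "Y \<in> szero \<beta>"
  shows "br \<mu> X Y \<in> szero \<beta>"
  using derivation_br[OF assms(1), of X Y] assms(2,3) by (simp add: szero_def br_simps)

lemma betaplus_br:
  assumes "pi_act (betaplus \<beta>) \<mu> = 0" "betaplus \<beta> *v X = r *\<^sub>R X" "betaplus \<beta> *v Y = s *\<^sub>R Y"
  shows "betaplus \<beta> *v br \<mu> X Y = (r + s) *\<^sub>R br \<mu> X Y"
  using derivation_br[OF assms(1), of X Y] assms(2,3) by (simp add: br_simps algebra_simps)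

lemma ad_szero_commute:
  assumes "pi_act (betaplus \<beta>) \<mu> = 0" "X \<in> szero \<beta>"
  shows "\<beta> ** ad \<mu> X - ad \<mu> X ** \<beta> = 0"
  using ad_derivation[OF assms(1), of X] assms(2) betaplus_commutator[of \<beta> "ad \<mu> X"]
  by (simp add: szero_def ad_simps)

lemma preserves_szero:
  assumes "\<beta> ** T - T ** \<beta> = 0" "X \<in> szero \<beta>"
  shows "T *v X \<in> szero \<beta>"
proof -
  have "betaplus \<beta> ** T = T ** betaplus \<beta>"
    using assms(1) betaplus_commutator[of \<beta> T] by simp
  then show ?thesis using assms(2)
    by (simp add: szero_def matrix_vector_mul_assoc) (simp flip: matrix_vector_mul_assoc)
qed

lemma transpose_commute:
  assumes "transpose \<beta> = \<beta>" "\<beta> ** T - T ** \<beta> = 0"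
  shows "\<beta> ** transpose T - transpose T ** \<beta> = (0 :: real^'n^'n)"
  using arg_cong[OF assms(2), of transpose] assms(1) by (simp add: mmul_simps)

lemma betaplus_eigenbasis:
  assumes "transpose \<beta> = \<beta>"
  obtains Bs e where "finite Bs" "pairwise orthogonal Bs" "\<And>b. b \<in> Bs \<Longrightarrow> norm b = 1"
    "span Bs = (UNIV :: (real^'n::finite) set)" "\<And>b. b \<in> Bs \<Longrightarrow> betaplus \<beta> *v b = e b *\<^sub>R b"
proof -
  have sa: "inner (betaplus \<beta> *v x) y = inner x (betaplus \<beta> *v y)" for x y
    by (simp add: inner_mvec_left betaplus_sym assms)
  obtain Bs where Bs: "finite Bs" "pairwise orthogonal Bs" "\<And>b. b \<in> Bs \<Longrightarrow> norm b = 1"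
    "span Bs = UNIV" "\<And>b. b \<in> Bs \<Longrightarrow> (\<exists>r. betaplus \<beta> *v b = r *\<^sub>R b) \<and> (\<exists>r. betaplus \<beta> *v b = r *\<^sub>R b)"
    using commuting_selfadjoint_basis[OF matrix_vector_mul_linear matrix_vector_mul_linear sa sa refl]
    by blast
  then obtain e where "\<And>b. b \<in> Bs \<Longrightarrow> betaplus \<beta> *v b = e b *\<^sub>R b" by metis
  with Bs that show thesis by blast
qed

lemma betaplus_eigen_orthogonal:
  assumes "transpose \<beta> = \<beta>" "betaplus \<beta> *v x = r *\<^sub>R x" "betaplus \<beta> *v y = s *\<^sub>R y" "r \<noteq> s"
  shows "inner x y = 0"
  using inner_mvec_left[of "betaplus \<beta>" x y] assms by (simp add: betaplus_sym)

text \<open>Test on an eigenbasis of beta+: ad X kills degree zero and preserves every other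
  eigenspace, and those are orthogonal to Y.\<close>

lemma transpose_ad_szero:
  assumes \<beta>: "transpose \<beta> = \<beta>" and D: "pi_act (betaplus \<beta>) \<mu> = 0"
    and ab: "\<And>X Y. X \<in> szero \<beta> \<Longrightarrow> Y \<in> szero \<beta> \<Longrightarrow> br \<mu> X Y = 0"
    and X: "X \<in> szero \<beta>" and Y: "Y \<in> szero \<beta>"
  shows "transpose (ad \<mu> X) *v Y = 0"
proof -
  obtain Bs e where Bs: "finite Bs" "pairwise orthogonal Bs" "\<And>b. b \<in> Bs \<Longrightarrow> norm b = 1"
    "span Bs = UNIV" "\<And>b. b \<in> Bs \<Longrightarrow> betaplus \<beta> *v b = e b *\<^sub>R b"
    using betaplus_eigenbasis[OF \<beta>] by metis
  have "orthogonal (transpose (ad \<mu> X) *v Y) b" if b: "b \<in> Bs" for b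
  proof -
    have "inner (transpose (ad \<mu> X) *v Y) b = inner Y (br \<mu> X b)"
      by (simp add: inner_mvec_left ad_mvec)
    also have "\<dots> = 0"
    proof (cases "e b = 0")
      case True
      then show ?thesis using ab[OF X, of b] Bs(5)[OF b] by (simp add: szero_def)
    next
      case False
      show ?thesis
        by (rule betaplus_eigen_orthogonal[OF \<beta>, of _ 0 _ "0 + e b"])
           (use False Y X betaplus_br[OF D, of X 0 b "e b"] Bs(5)[OF b] in \<open>auto simp: szero_def\<close>)
    qed
    finally show ?thesis by (simp add: orthogonal_def)
  qed
  then have "orthogonal (transpose (ad \<mu> X) *v Y) y" for y
    using orthogonal_to_span[of y Bs] Bs(4) by blast
  then show ?thesis by (metis orthogonal_self)
qed

text \<open>The properties used of a shortest vector in the orbit closure. There \<open>c\<close>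
  will be a quarter of its squared norm, and \<open>K\<close> is inherited from the original
  bracket.\<close>

locale minimal_bracket =
  fixes \<nu> :: "'n::finite brk" and \<beta> :: "'n mat" and c :: real and K :: nat
  assumes lie: "is_lie \<nu>" and solv: "\<And>f. dword \<nu> K f = 0"
    and \<beta>: "transpose \<beta> = \<beta>" "\<beta> \<noteq> 0" and c: "c > 0"
    and M: "Mop \<nu> = c *\<^sub>R \<beta>" and D: "pi_act (betaplus \<beta>) \<nu> = 0"
begin

lemma Vs: "\<nu> \<in> Vs" using lie by (simp add: is_lie_def)

text \<open>With ad X = 0 only the |J_X|^2 term remains in the quadratic form of \<open>Mop\<close>,
  and it cannot be negative.\<close>

lemma no_center:
  assumes "\<beta> *v X = b *\<^sub>R X" "b < 0" "ad \<nu> X = 0"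
  shows "X = 0"
proof (rule ccontr)
  assume "X \<noteq> 0"
  have "0 \<le> inner (Mop \<nu> *v X) X"
    using inner_Mop_mvec[OF Vs, of X] inner_ge_zero[of "jmat \<nu> X"]
    unfolding assms(3) inner_zero_left by linarith
  also have "\<dots> = c * b * inner X X" by (simp add: M mvec_simps assms(1))
  also have "\<dots> < 0" using c assms(2) \<open>X \<noteq> 0\<close> by (simp add: mult_pos_neg mult_neg_pos)
  finally show False by simp
qed

lemma no_center_szero: "X \<in> szero \<beta> \<Longrightarrow> ad \<nu> X = 0 \<Longrightarrow> X = 0"
proof (rule no_center)
  assume "X \<in> szero \<beta>"
  then show "\<beta> *v X = (- ((norm \<beta>)^2)) *\<^sub>R X"
    using eq_neg_iff_add_eq_0[of "\<beta> *v X"] by (simp add: szero_def betaplus_mvec)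
qed (use \<beta> in auto)

text \<open>ad X has the same degree r as X because beta+ is a derivation. The squared norm forces r
  to be nonnegative unless ad X vanishes, and r = 0 makes the transpose of ad X a
  derivation.\<close>

lemma norm_pi_transpose_ad:
  assumes "betaplus \<beta> *v X = r *\<^sub>R X"
  shows "(norm (pi_act (transpose (ad \<nu> X)) \<nu>))^2 = 4 * c * r * (norm (ad \<nu> X))^2"
proof -
  have "\<beta> ** ad \<nu> X - ad \<nu> X ** \<beta> = r *\<^sub>R ad \<nu> X"
    using ad_derivation[OF D, of X] assms by (simp add: ad_simps betaplus_commutator)
  then show ?thesis
    using Mop_commutator_derivation[OF pi_act_ad[OF lie], of X] inner_commutator_transpose[OF \<beta>(1), of "ad \<nu> X"]
    by (simp add: M power2_norm_eq_inner)
qed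

lemma betaplus_nonneg:
  assumes "betaplus \<beta> *v X = r *\<^sub>R X" "r < 0" shows "X = 0"
proof (rule no_center)
  show "\<beta> *v X = (r - (norm \<beta>)^2) *\<^sub>R X"
    using assms(1) by (simp add: betaplus_mvec algebra_simps)
  show "r - (norm \<beta>)^2 < 0" using assms(2) by (smt (verit) zero_le_power2)
  have "0 \<le> 4 * c * r * (norm (ad \<nu> X))^2"
    using norm_pi_transpose_ad[OF assms(1)] by (metis zero_le_power2)
  moreover have "4 * c * r < 0" using c assms(2) by (simp add: mult_pos_neg)
  ultimately show "ad \<nu> X = 0" by (metis linorder_not_le mult_neg_pos norm_eq_zero zero_less_power2)
qed

lemma transpose_ad_derivation:
  assumes "X \<in> szero \<beta>" shows "pi_act (transpose (ad \<nu> X)) \<nu> = 0"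
  using norm_pi_transpose_ad[of X 0] assms by (simp add: szero_def)

lemma commutator_transpose_ad:
  assumes "X \<in> szero \<beta>"
  shows "transpose (ad \<nu> X) ** ad \<nu> X - ad \<nu> X ** transpose (ad \<nu> X) = ad \<nu> (transpose (ad \<nu> X) *v X)"
  using ad_derivation[OF transpose_ad_derivation[OF assms], of X] by simp

text \<open>Vanishing traces make ad X nilpotent, normality then makes it zero, and degree zero
  contains no nonzero central element.\<close>

lemma normal_traceless:
  assumes "X \<in> szero \<beta>" "transpose (ad \<nu> X) ** ad \<nu> X = ad \<nu> X ** transpose (ad \<nu> X)"
    "\<And>m. trace (matpow (ad \<nu> X) (Suc m)) = 0"
  shows "X = 0"
  using nilpotent_of_traces[OF assms(3)] normal_nilpotent_zero[OF assms(2)] no_center_szero[OF assms(1)]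
  by metis

lemma szero_abelian:
  assumes "X \<in> szero \<beta>" "Y \<in> szero \<beta>" shows "br \<nu> X Y = 0"
  using lie solv subspace_szero szero_br[OF D] _ assms
proof (rule solvable_subalgebra_abelian)
  fix W X
  assume W: "W \<subseteq> szero \<beta>" "\<And>X Y. X \<in> W \<Longrightarrow> Y \<in> W \<Longrightarrow> br \<nu> X Y = 0"
    and T: "\<And>T X. pi_act T \<nu> = 0 \<Longrightarrow> (\<And>Z. Z \<in> szero \<beta> \<Longrightarrow> T *v Z \<in> szero \<beta>) \<Longrightarrow> X \<in> W \<Longrightarrow> T *v X \<in> W"
    and X: "X \<in> W" and tr: "\<And>m. trace (matpow (ad \<nu> X) (Suc m)) = 0"
  have X0: "X \<in> szero \<beta>" using W X by blast
  let ?E = "ad \<nu> X"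
  \<comment> \<open>C will turn out to be [E^t, E]. It is ad of an element of the abelian W, hence
    commutes with E, and then |C|^2 = tr([E^t, E] C) = 0 by cyclicity.\<close>
  define C where "C = ad \<nu> (transpose ?E *v X)"
  have "transpose ?E *v X \<in> W"
  proof (rule T[OF transpose_ad_derivation[OF X0] _ X])
    show "transpose ?E *v Z \<in> szero \<beta>" if "Z \<in> szero \<beta>" for Z
      by (rule preserves_szero[OF transpose_commute[OF \<beta>(1)] that])
         (rule ad_szero_commute[OF D X0])
  qed
  then have "br \<nu> X (transpose ?E *v X) = 0" using W(2) X by blast
  then have comm: "?E ** C = C ** ?E"
    using ad_derivation[OF pi_act_ad[OF lie], of X "transpose ?E *v X"]
    by (simp add: C_def ad_mvec ad_simps)
  have C: "transpose ?E ** ?E - ?E ** transpose ?E = C"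
    unfolding C_def by (rule commutator_transpose_ad[OF X0])
  have "transpose C = C" unfolding C[symmetric] by (simp add: mmul_simps)
  then have "inner C C = trace (C ** C)" by (simp add: inner_mat_trace)
  also have "\<dots> = 0" using trace_commutator_zero[OF comm, of "transpose ?E"] by (simp add: C)
  finally have "C = 0" by simp
  then show "X = 0" using normal_traceless[OF X0 _ tr] C by simp
qed

text \<open>With degree zero known to be abelian, (ad X)^t X = 0, so ad X is normal for every X
  there.\<close>

lemma traceless_zero:
  assumes "X \<in> szero \<beta>" "\<And>m. trace (matpow (ad \<nu> X) (Suc m)) = 0"
  shows "X = 0"
proof (rule normal_traceless[OF assms(1) _ assms(2)])
  show "transpose (ad \<nu> X) ** ad \<nu> X = ad \<nu> X ** transpose (ad \<nu> X)"
    using commutator_transpose_ad[OF assms(1)]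
      transpose_ad_szero[OF \<beta>(1) D szero_abelian assms(1) assms(1)] by (simp add: ad_simps)
qed

end

section \<open>Simultaneous diagonalization and the exponential\<close>

definition diagm :: "real^'n \<Rightarrow> real^'n^'n" where
  "diagm d = (\<chi> i j. if i = j then d$i else 0)"

lemma diagm_mult: "diagm d ** A = (\<chi> i j. d$i * A$i$j)"
  by (simp add: diagm_def matrix_matrix_mult_def vec_eq_iff if_distrib[of "\<lambda>x. x * _"] cong: if_cong)

lemma diagm_diagm: "diagm d ** diagm e = diagm (\<chi> i. d$i * e$i)"
  unfolding diagm_mult by (simp add: diagm_def vec_eq_iff)

lemma mult_diagm: "A ** diagm d = (\<chi> i j. A$i$j * d$j)"
  by (simp add: diagm_def matrix_matrix_mult_def vec_eq_iff if_distrib[of "\<lambda>x. _ * x"] cong: if_cong)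

lemma diagm_transpose: "transpose (diagm d) = diagm d"
  by (simp add: diagm_def transpose_def vec_eq_iff)

lemma diagm_one: "diagm (\<chi> i. 1) = mat 1"
  by (simp add: diagm_def mat_def vec_eq_iff)

lemma linear_diagm: "linear diagm"
  by (rule linearI) (simp_all add: diagm_def vec_eq_iff)

lemma det_diagm: "det (diagm d) = (\<Prod>i\<in>UNIV. d$i)"
  using det_diagonal[of "diagm d"] by (simp add: diagm_def)

lemma inner_diagm: "inner (diagm d) (diagm e) = (\<Sum>i\<in>UNIV. d$i * e$i)"
proof -
  have "inner (diagm d $ i) (diagm e $ i) = d$i * e$i" for i
  proof -
    have "inner (diagm d $ i) (diagm e $ i) = (\<Sum>j\<in>UNIV. if j = i then d$i * e$i else 0)"
      unfolding inner_vec_def[of "diagm d $ i"] by (intro sum.cong) (auto simp: diagm_def)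
    then show ?thesis by simp
  qed
  then show ?thesis by (simp add: inner_vec_def[of "diagm d"])
qed

lemma diagm_axis: "diagm d *v axis i 1 = d$i *\<^sub>R axis i 1"
  unfolding matrix_vector_mult_basis by (simp add: column_def diagm_def axis_def vec_eq_iff)

text \<open>A diagonal matrix in the frame given by the columns of P. Exponentials, logarithms and
  products of commuting symmetric matrices become entrywise operations on d.\<close>

definition conjd :: "real^'n^'n \<Rightarrow> real^'n \<Rightarrow> real^'n^'n" where
  "conjd P d = P ** diagm d ** transpose P"

definition orthm :: "real^'n^'n \<Rightarrow> bool" where
  "orthm P \<longleftrightarrow> transpose P ** P = mat 1 \<and> P ** transpose P = mat 1"

lemma linear_conjd: "linear (conjd P)"
  by (rule linearI)
     (simp_all add: conjd_def linear_add[OF linear_diagm] linear_cmul[OF linear_diagm] mmul_simps)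

lemma conjd_mult: "orthm P \<Longrightarrow> conjd P d ** conjd P e = conjd P (\<chi> i. d$i * e$i)"
proof -
  assume "orthm P"
  then have "transpose P ** (P ** A) = A" for A :: "real^'a^'a"
    by (simp add: orthm_def matrix_mul_assoc)
  then show ?thesis
    by (simp add: conjd_def mmul_simps flip: diagm_diagm)
qed

lemma conjd_transpose: "transpose (conjd P d) = conjd P d"
  by (simp add: conjd_def mmul_simps diagm_transpose)

lemma conjd_one: "orthm P \<Longrightarrow> conjd P (\<chi> i. 1) = mat 1"
  by (simp add: conjd_def diagm_one orthm_def)

lemma det_conjd: "orthm P \<Longrightarrow> det (conjd P d) = (\<Prod>i\<in>UNIV. d$i)"
proof -
  assume P: "orthm P"
  have "det P * det P = 1"
    using P det_mul[of P "transpose P"] by (simp add: orthm_def)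
  then show ?thesis by (simp add: conjd_def det_mul det_diagm)
qed

lemma inner_conjd: "orthm P \<Longrightarrow> inner (conjd P d) (conjd P e) = (\<Sum>i\<in>UNIV. d$i * e$i)"
proof -
  assume P: "orthm P"
  have "inner (conjd P d) (conjd P e) = inner (diagm d) (transpose P ** conjd P e ** P)"
    unfolding conjd_def[of P d] matrix_mul_assoc[symmetric]
    using inner_mmul_left[of P "diagm d ** transpose P" "conjd P e"]
      inner_mmul_right[of "diagm d" "transpose P" "transpose P ** conjd P e"]
    by (simp add: matrix_mul_assoc)
  also have "transpose P ** conjd P e ** P = diagm e"
    using P by (simp add: conjd_def orthm_def) (metis matrix_mul_assoc matrix_mul_lid matrix_mul_rid)
  finally show ?thesis by (simp add: inner_diagm)
qed

lemma conjd_mvec: "orthm P \<Longrightarrow> conjd P d *v (P *v axis i 1) = d$i *\<^sub>R (P *v axis i 1)"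
proof -
  assume P: "orthm P"
  have "conjd P d *v (P *v axis i 1) = P *v (diagm d *v axis i 1)"
    using P by (simp add: conjd_def orthm_def matrix_vector_mul_assoc) (metis matrix_mul_assoc matrix_mul_rid)
  also have "diagm d *v axis i 1 = d$i *\<^sub>R axis i 1" by (rule diagm_axis)
  finally show ?thesis by (simp add: mvec_simps)
qed

lemma simultaneous_diagonalization:
  fixes A C :: "real^'n^'n"
  assumes sym: "transpose A = A" "transpose C = C" and comm: "A ** C = C ** A"
  obtains P a c where "orthm P" "A = conjd P a" "C = conjd P c"
proof -
  have sa: "inner (A *v x) y = inner x (A *v y)" "inner (C *v x) y = inner x (C *v y)" for x y
    by (simp_all add: inner_mvec_left sym)
  have "A *v (C *v x) = C *v (A *v x)" for x
    by (simp add: matrix_vector_mul_assoc comm)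
  from commuting_selfadjoint_basis[OF matrix_vector_mul_linear matrix_vector_mul_linear sa this]
  obtain Bs where Bs: "finite Bs" "pairwise orthogonal Bs" "\<And>b. b \<in> Bs \<Longrightarrow> norm b = 1"
    "span Bs = (UNIV :: (real^'n) set)"
    "\<And>b. b \<in> Bs \<Longrightarrow> (\<exists>r. A *v b = r *\<^sub>R b) \<and> (\<exists>r. C *v b = r *\<^sub>R b)" by blast
  have ind: "independent Bs"
    using Bs(2) Bs(3)[of 0] by (intro pairwise_orthogonal_independent) auto
  have "card Bs = dim (span Bs)" using dim_span_eq_card_independent[OF ind] by simp
  then have "card Bs = CARD('n)" unfolding Bs(4) by simp
  then obtain h where h: "bij_betw h (UNIV :: 'n set) Bs"
    using finite_same_card_bij[of "UNIV :: 'n set" Bs] Bs(1) by auto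
  have hB: "h j \<in> Bs" for j using h by (auto simp: bij_betw_def)
  have hi: "inner (h i) (h j) = (if i = j then 1 else 0)" for i j
  proof (cases "i = j")
    case False
    then have "h i \<noteq> h j" using h by (auto simp: bij_betw_def inj_on_def)
    then show ?thesis using False Bs(2) hB by (auto simp: pairwise_def orthogonal_def)
  qed (use Bs(3) hB in \<open>simp add: dot_square_norm\<close>)
  have "\<forall>j. \<exists>r. A *v h j = r *\<^sub>R h j" "\<forall>j. \<exists>r. C *v h j = r *\<^sub>R h j"
    using Bs(5) hB by blast+
  then obtain a c where a: "\<And>j. A *v h j = a j *\<^sub>R h j" and c: "\<And>j. C *v h j = c j *\<^sub>R h j"
    unfolding choice_iff by blast
  define P where "P = (\<chi> i j. h j $ i)"
  have "transpose P ** P = mat 1"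
    using hi by (simp add: P_def transpose_def matrix_matrix_mult_def mat_def vec_eq_iff inner_vec_def)
  then have P: "orthm P" by (simp add: orthm_def matrix_left_right_inverse)
  have eq: "M = conjd P (\<chi> j. m j)" if m: "\<And>j. M *v h j = m j *\<^sub>R h j" for M m
  proof -
    have "(M ** P) $ i $ j = (P ** diagm (\<chi> j. m j)) $ i $ j" for i j
    proof -
      have "(M ** P) $ i $ j = (M *v h j) $ i"
        by (simp add: P_def matrix_matrix_mult_def matrix_vector_mult_def)
      then show ?thesis by (simp add: m mult_diagm P_def)
    qed
    then have "M ** P = P ** diagm (\<chi> j. m j)" by (simp add: vec_eq_iff)
    then have "M ** (P ** transpose P) = conjd P (\<chi> j. m j)"
      by (simp add: conjd_def matrix_mul_assoc)
    then show ?thesis using P by (simp add: orthm_def)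
  qed
  show thesis using that[OF P eq eq] a c by blast
qed

lemma matpow_conjd: "orthm P \<Longrightarrow> matpow (conjd P d) k = conjd P (\<chi> i. d$i ^ k)"
  by (induction k) (simp_all add: matpow_0 matpow_Suc conjd_one conjd_mult)

lemma mexp_conjd:
  assumes "orthm P" shows "mexp (conjd P d) = conjd P (\<chi> i. exp (d$i))"
proof -
  have "(\<lambda>k. (1 / fact k) *\<^sub>R (\<chi> i. d$i ^ k)) sums (\<chi> i. exp (d$i))"
    unfolding sums_def
  proof (rule vec_tendstoI)
    fix i
    have "(\<lambda>k. d$i ^ k /\<^sub>R fact k) sums exp (d$i)" by (rule exp_converges)
    then show "(\<lambda>n. (\<Sum>k<n. (1 / fact k) *\<^sub>R (\<chi> i. d$i ^ k)) $ i) \<longlonglongrightarrow> (\<chi> i. exp (d$i)) $ i"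
      by (simp add: sums_def field_simps)
  qed
  from bounded_linear.sums[OF linear_conv_bounded_linear[THEN iffD1, OF linear_conjd] this]
  have "(\<lambda>k. (1 / fact k) *\<^sub>R matpow (conjd P d) k) sums conjd P (\<chi> i. exp (d$i))"
    by (simp add: linear_cmul[OF linear_conjd] matpow_conjd[OF assms])
  then show ?thesis by (simp add: mexp_def sums_iff)
qed

lemma mexp_scaleR_conjd:
  assumes "orthm P" shows "mexp (t *\<^sub>R conjd P d) = conjd P (\<chi> i. exp (t * d$i))"
proof -
  have "t *\<^sub>R conjd P d = conjd P (\<chi> i. t * d$i)"
    unfolding linear_cmul[OF linear_conjd, symmetric] by (rule arg_cong[where f="conjd P"]) (simp add: vec_eq_iff)
  then show ?thesis by (simp add: mexp_conjd[OF assms])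
qed

lemma mexp_sym_inverse:
  assumes "transpose S = S"
  shows "transpose (mexp S) = mexp S" "mexp S ** mexp (- S) = mat 1" "mexp (- S) ** mexp S = mat 1"
proof -
  obtain P s where P: "orthm P" "S = conjd P s"
    using simultaneous_diagonalization[OF assms assms refl] by metis
  have m: "mexp (- S) = conjd P (\<chi> i. exp (- s$i))" "mexp S = conjd P (\<chi> i. exp (s$i))"
    using mexp_scaleR_conjd[OF P(1), of "-1" s] mexp_conjd[OF P(1), of s] by (simp_all add: P(2))
  show "transpose (mexp S) = mexp S" by (simp add: m conjd_transpose)
  show "mexp S ** mexp (- S) = mat 1" "mexp (- S) ** mexp S = mat 1"
    using conjd_one[OF P(1)] by (simp_all add: m conjd_mult[OF P(1)] exp_minus)
qed

lemma mexp_commute: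
  assumes "transpose S = S" "transpose \<beta> = \<beta>" "\<beta> ** S = S ** \<beta>"
  shows "\<beta> ** mexp S = mexp S ** \<beta>"
proof -
  obtain P b s where P: "orthm P" "\<beta> = conjd P b" "S = conjd P s"
    using simultaneous_diagonalization[OF assms(2,1,3)] by metis
  show ?thesis by (simp add: P(2,3) mexp_conjd[OF P(1)] conjd_mult[OF P(1)] mult.commute)
qed

text \<open>The projector onto the r-eigenspace of beta does not depend on the diagonalizing frame:
  two such projectors fix each other's range and both are symmetric. \<open>mexp_polar\<close> needs
  this because it diagonalizes S, A and q in different frames.\<close>

lemma spectral_projector:
  fixes \<beta> :: "real^'n^'n"
  assumes "transpose \<beta> = \<beta>"
  obtains \<Phi> where "\<And>P b. orthm P \<Longrightarrow> \<beta> = conjd P b \<Longrightarrow> \<Phi> = conjd P (\<chi> i. if b$i = r then 1 else 0)"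
proof -
  have props: "\<beta> ** Q = r *\<^sub>R Q" "\<And>x. \<beta> *v x = r *\<^sub>R x \<Longrightarrow> Q *v x = x"
    if P: "orthm P" "\<beta> = conjd P b" and Q: "Q = conjd P (\<chi> i. if b$i = r then 1 else 0)" for P b Q
  proof -
    show "\<beta> ** Q = r *\<^sub>R Q"
      unfolding Q P(2) conjd_mult[OF P(1)] linear_cmul[OF linear_conjd, symmetric]
      by (rule arg_cong[where f="conjd P"]) (simp add: vec_eq_iff)
    fix x assume x: "\<beta> *v x = r *\<^sub>R x"
    define y where "y = transpose P *v x"
    have xy: "x = P *v y" using P(1) by (simp add: y_def orthm_def matrix_vector_mul_assoc)
    have cy: "conjd P d *v (P *v y) = P *v (\<chi> i. d$i * y$i)" for d
    proof -
      have "conjd P d *v (P *v y) = P *v (diagm d *v y)"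
        using P(1) by (simp add: conjd_def orthm_def matrix_vector_mul_assoc) (metis matrix_mul_assoc matrix_mul_rid)
      also have "diagm d *v y = (\<chi> i. d$i * y$i)"
        by (simp add: diagm_def matrix_vector_mult_def vec_eq_iff if_distrib[of "\<lambda>x. x * _"] cong: if_cong)
      finally show ?thesis .
    qed
    have "P *v (\<chi> i. b$i * y$i) = P *v (r *\<^sub>R y)"
      using x unfolding xy P(2) cy by (simp add: mvec_simps)
    then have "transpose P *v (P *v (\<chi> i. b$i * y$i)) = transpose P *v (P *v (r *\<^sub>R y))" by simp
    then have "(\<chi> i. b$i * y$i) = r *\<^sub>R y" using P(1) by (simp add: orthm_def matrix_vector_mul_assoc)
    then have "b$i * y$i = r * y$i" for i by (simp add: vec_eq_iff)
    then have "(if b$i = r then 1 else 0) * y$i = y$i" for i by (metis mult_1 mult_cancel_right mult_zero_left)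
    then have "(\<chi> i. (if b$i = r then 1 else 0) * y$i) = y" by (simp add: vec_eq_iff)
    then show "Q *v x = x" unfolding Q xy cy by simp
  qed
  have mult: "Q' ** Q = Q"
    if "\<beta> ** Q = r *\<^sub>R Q" "\<And>x. \<beta> *v x = r *\<^sub>R x \<Longrightarrow> Q' *v x = x" for Q Q'
  proof (rule mat_eqI)
    fix x
    have "\<beta> *v (Q *v x) = r *\<^sub>R (Q *v x)" using that(1) by (simp add: matrix_vector_mul_assoc mvec_simps)
    from that(2)[OF this] show "(Q' ** Q) *v x = Q *v x" by (simp add: matrix_vector_mul_assoc)
  qed
  obtain P0 b0 where P0: "orthm P0" "\<beta> = conjd P0 b0"
    using simultaneous_diagonalization[OF assms assms refl] by metis
  let ?M = "conjd P0 (\<chi> i. if b0$i = r then 1 else 0)"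
  show thesis
  proof (rule that)
    fix P b assume P: "orthm P" "\<beta> = conjd P b"
    let ?Q = "conjd P (\<chi> i. if b$i = r then 1 else 0)"
    have 1: "?M ** ?Q = ?Q" by (rule mult, rule props(1)[OF P refl], rule props(2)[OF P0 refl])
    have 2: "?Q ** ?M = ?M" by (rule mult, rule props(1)[OF P0 refl], rule props(2)[OF P refl])
    have "?Q = transpose (?M ** ?Q)" unfolding 1 by (simp add: conjd_transpose)
    also have "\<dots> = ?M" by (simp add: matrix_transpose_mul conjd_transpose 2)
    finally show "?M = ?Q" ..
  qed
qed

text \<open>The symmetric factor of a polar decomposition.  Orthogonality to beta persists because
  tr(S beta) is a combination of logarithms of determinants on the eigenspaces of beta.\<close>
lemma mexp_polar:
  fixes \<beta> :: "real^'n^'n"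
  assumes \<beta>: "transpose \<beta> = \<beta>"
    and S: "transpose S = S" "\<beta> ** S = S ** \<beta>" "inner S \<beta> = 0"
    and A: "transpose A = A" "\<beta> ** A = A ** \<beta>" "inner A \<beta> = 0"
  obtains S' where "transpose S' = S'" "\<beta> ** S' = S' ** \<beta>" "inner S' \<beta> = 0"
    "mexp S' ** mexp S' = transpose (mexp A ** mexp S) ** (mexp A ** mexp S)"
proof -
  define g where "g = mexp A ** mexp S"
  define q where "q = transpose g ** g"
  have eA: "transpose (mexp A) = mexp A" and eS: "transpose (mexp S) = mexp S"
    by (rule mexp_sym_inverse, fact)+
  have qe: "q = mexp S ** (mexp A ** (mexp A ** mexp S))"
    by (simp add: q_def g_def mmul_simps eA eS)
  have qs: "transpose q = q" by (simp add: q_def mmul_simps)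
  note cA = mexp_commute[OF A(1) \<beta> A(2)] and cS = mexp_commute[OF S(1) \<beta> S(2)]
  have qc: "\<beta> ** q = q ** \<beta>"
  proof -
    have "\<beta> ** (mexp S ** X) = mexp S ** (\<beta> ** X)" "\<beta> ** (mexp A ** X) = mexp A ** (\<beta> ** X)" for X :: "real^'n^'n"
      by (simp_all add: matrix_mul_assoc cA cS)
    then show ?thesis unfolding qe by (simp add: cS mmul_simps)
  qed
  obtain P b d where P: "orthm P" "\<beta> = conjd P b" "q = conjd P d"
    using simultaneous_diagonalization[OF \<beta> qs qc] by metis
  have gi: "mexp (- S) ** mexp (- A) ** g = mat 1"
  proof -
    have "mexp (- A) ** (mexp A ** X) = X" for X :: "real^'n^'n"
      by (simp add: matrix_mul_assoc mexp_sym_inverse(3)[OF A(1)])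
    then show ?thesis by (simp add: g_def mmul_simps mexp_sym_inverse(3)[OF S(1)])
  qed
  have dpos: "d$i > 0" for i
  proof -
    let ?x = "P *v axis i 1"
    have "transpose P *v ?x = axis i 1"
      using P(1) by (simp add: orthm_def matrix_vector_mul_assoc)
    then have x0: "?x \<noteq> 0" by (metis axis_eq_0_iff matrix_vector_mult_0_right zero_neq_one)
    have "g *v ?x \<noteq> 0"
    proof
      assume "g *v ?x = 0"
      then have "(mexp (- S) ** mexp (- A) ** g) *v ?x = 0"
        by (metis matrix_vector_mul_assoc matrix_vector_mult_0_right)
      then show False using x0 gi by simp
    qed
    then have "0 < inner (g *v ?x) (g *v ?x)" by simp
    also have "\<dots> = inner (q *v ?x) ?x"
      by (simp add: q_def inner_mvec_left flip: matrix_vector_mul_assoc)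
    also have "\<dots> = d$i * inner ?x ?x" unfolding P(3) conjd_mvec[OF P(1)] by simp
    finally show ?thesis using inner_ge_zero[of ?x] by (metis linorder_not_le mult_nonpos_nonneg)
  qed
  \<comment> \<open>Half the logarithm of q = g^t g, taken in the common frame of beta and
    q.\<close>
  define S' where "S' = conjd P (\<chi> i. ln (d$i) / 2)"
  have chi: "(\<Sum>i\<in>UNIV. if b$i = r then ln (d$i) else 0) =
      2 * inner S (conjd P (\<chi> i. if b$i = r then 1 else 0)) + 2 * inner A (conjd P (\<chi> i. if b$i = r then 1 else 0))" for r
  proof -
    obtain Q where pr: "\<And>P b. orthm P \<Longrightarrow> \<beta> = conjd P b \<Longrightarrow> Q = conjd P (\<chi> i. if b$i = r then 1 else 0)"
      using spectral_projector[OF \<beta>] by metis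
    \<comment> \<open>For h commuting with Q this is h on the r-eigenspace of beta and the identity
      on the others, so its determinant is that of h restricted to the eigenspace.\<close>
    define X where "X h = h ** Q + (mat 1 - Q)" for h
    have Xconj: "det (X (conjd R e)) = (\<Prod>i\<in>UNIV. if c$i = r then e$i else 1)"
      if R: "orthm R" "\<beta> = conjd R c" for R c e
    proof -
      have "X (conjd R e) = conjd R (\<chi> i. if c$i = r then e$i else 1)"
        unfolding X_def pr[OF R] conjd_mult[OF R(1)] conjd_one[OF R(1), symmetric]
          linear_add[OF linear_conjd, symmetric] linear_diff[OF linear_conjd, symmetric]
        by (rule arg_cong[where f="conjd R"]) (simp add: vec_eq_iff)
      then show ?thesis by (simp add: det_conjd[OF R(1)])
    qed
    have QQ: "Q ** Q = Q"
      unfolding pr[OF P(1,2)] conjd_mult[OF P(1)]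
      by (rule arg_cong[where f="conjd P"]) (simp add: vec_eq_iff)
    have comm: "h ** Q = Q ** h" if "orthm R" "\<beta> = conjd R c" "h = conjd R e" for h R c e
      unfolding pr[OF that(1,2)] that(3) conjd_mult[OF that(1)] by (simp add: mult.commute)
    have expdet: "det (X (mexp T)) = exp (inner T Q) \<and> mexp T ** Q = Q ** mexp T"
      if T: "transpose T = T" "\<beta> ** T = T ** \<beta>" for T
    proof -
      obtain R c t where R: "orthm R" "\<beta> = conjd R c" "T = conjd R t"
        using simultaneous_diagonalization[OF \<beta> T] by metis
      have "det (X (mexp T)) = (\<Prod>i\<in>UNIV. if c$i = r then exp (t$i) else 1)"
        unfolding R(3) mexp_conjd[OF R(1)] by (simp only: Xconj[OF R(1,2)] vec_lambda_beta)
      also have "\<dots> = (\<Prod>i\<in>UNIV. exp (if c$i = r then t$i else 0))"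
        by (intro prod.cong) auto
      also have "\<dots> = exp (\<Sum>i\<in>UNIV. if c$i = r then t$i else 0)" by (simp add: exp_sum)
      also have "(\<Sum>i\<in>UNIV. if c$i = r then t$i else 0) = inner T Q"
        unfolding pr[OF R(1,2)] R(3) inner_conjd[OF R(1)] by (intro sum.cong) auto
      finally show ?thesis
        using comm[OF R(1,2) mexp_conjd[OF R(1)]] by (simp add: R(3))
    qed
    have Xmult: "X (h ** k) = X h ** X k" if "k ** Q = Q ** k" for h k
    proof -
      have "Q ** (k ** Q) = k ** Q" using that QQ by (metis matrix_mul_assoc)
      then show ?thesis by (simp add: X_def mmul_simps QQ)
    qed
    have c1: "(mexp A ** mexp S) ** Q = Q ** (mexp A ** mexp S)"
      using expdet[OF A(1,2)] expdet[OF S(1,2)] by (metis matrix_mul_assoc)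
    have c2: "(mexp A ** (mexp A ** mexp S)) ** Q = Q ** (mexp A ** (mexp A ** mexp S))"
      using expdet[OF A(1,2)] c1 by (metis matrix_mul_assoc)
    have "det (X q) = exp (inner S Q) * (exp (inner A Q) * (exp (inner A Q) * exp (inner S Q)))"
      unfolding qe using expdet[OF A(1,2)] expdet[OF S(1,2)] c1 c2 by (simp add: Xmult det_mul)
    also have "\<dots> = exp (2 * inner S Q + 2 * inner A Q)"
      by (simp flip: exp_add)
    finally have "(\<Prod>i\<in>UNIV. if b$i = r then d$i else 1) = exp (2 * inner S Q + 2 * inner A Q)"
      using Xconj[OF P(1,2), of d] P(3) by simp
    moreover have "(\<Prod>i\<in>UNIV. if b$i = r then d$i else 1) = exp (\<Sum>i\<in>UNIV. if b$i = r then ln (d$i) else 0)"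
      unfolding exp_sum[OF finite] using dpos by (intro prod.cong) (auto simp: exp_ln)
    ultimately show ?thesis by (simp add: pr[OF P(1,2)])
  qed
  \<comment> \<open>The sum runs over the distinct eigenvalues, so each eigenspace is counted
    once.\<close>
  have decomp: "b = (\<Sum>r\<in>range (($) b). r *\<^sub>R (\<chi> i. if b$i = r then 1 else 0))"
  proof -
    have "b $ i = (\<Sum>r\<in>range (($) b). if b$i = r then r else 0)" for i
      by simp
    then show ?thesis by (simp add: vec_eq_iff if_distrib cong: if_cong)
  qed
  have \<beta>sum: "\<beta> = (\<Sum>r\<in>range (($) b). r *\<^sub>R conjd P (\<chi> i. if b$i = r then 1 else 0))"
    unfolding P(2) by (subst (1) decomp)
      (simp only: linear_sum[OF linear_conjd] linear_cmul[OF linear_conjd])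
  have "2 * inner S' \<beta> = (\<Sum>i\<in>UNIV. b$i * ln (d$i))"
    unfolding S'_def P(2) inner_conjd[OF P(1)] by (simp add: sum_distrib_left mult.commute)
  also have "\<dots> = (\<Sum>i\<in>UNIV. \<Sum>r\<in>range (($) b). r * (if b$i = r then ln (d$i) else 0))"
    by (intro sum.cong) (simp_all add: if_distrib cong: if_cong)
  also have "\<dots> = (\<Sum>r\<in>range (($) b). r * (\<Sum>i\<in>UNIV. if b$i = r then ln (d$i) else 0))"
    by (subst sum.swap) (simp add: sum_distrib_left)
  also have "\<dots> = 2 * inner S \<beta> + 2 * inner A \<beta>"
    unfolding chi by (subst (1 2) \<beta>sum) (simp add: inner_sum_right sum_distrib_left sum.distrib algebra_simps)
  finally have "inner S' \<beta> = 0" using S(3) A(3) by simp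
  moreover have "mexp S' ** mexp S' = q"
    unfolding S'_def mexp_conjd[OF P(1)] conjd_mult[OF P(1)] P(3)
    by (rule arg_cong[where f="conjd P"]) (use dpos in \<open>simp add: vec_eq_iff flip: exp_add\<close>)
  moreover have "\<beta> ** S' = S' ** \<beta>"
    unfolding S'_def P(2) conjd_mult[OF P(1)] by (simp add: mult.commute)
  ultimately show thesis
    using that[of S'] unfolding q_def g_def S'_def by (simp add: conjd_transpose)
qed

section \<open>The action of the general linear group\<close>

text \<open>Carrying the inverse as a witness avoids reasoning about the choice operator in
  \<open>matrix_inv\<close>.\<close>

definition minverse :: "real^'n^'n \<Rightarrow> real^'n^'n \<Rightarrow> bool" where
  "minverse h k \<longleftrightarrow> h ** k = mat 1 \<and> k ** h = mat 1"

lemma matrix_inv_minverse: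
  assumes "minverse h k" shows "matrix_inv h = k"
proof -
  have "matrix_inv h ** h = mat 1"
    using assms someI[of "\<lambda>k. h ** k = mat 1 \<and> k ** h = mat 1" k]
    unfolding matrix_inv_def minverse_def by blast
  then have "matrix_inv h ** (h ** k) = k" by (simp add: matrix_mul_assoc)
  then show ?thesis using assms by (simp add: minverse_def)
qed

lemma minverse_mult: "minverse h k \<Longrightarrow> minverse g l \<Longrightarrow> minverse (h ** g) (l ** k)"
  unfolding minverse_def by (metis matrix_mul_assoc matrix_mul_rid)

lemma minverse_transpose: "minverse h k \<Longrightarrow> minverse (transpose h) (transpose k)"
  unfolding minverse_def by (metis matrix_transpose_mul transpose_mat)

lemma minverse_orthm: "orthm P \<Longrightarrow> minverse (transpose P) P" "orthm P \<Longrightarrow> minverse P (transpose P)"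
  by (auto simp: orthm_def minverse_def)

lemma minverse_mexp: "transpose S = S \<Longrightarrow> minverse (mexp S) (mexp (- S))"
  by (simp add: minverse_def mexp_sym_inverse)

lemma minverse_diagm_exp: "minverse (diagm (\<chi> i. exp (d$i))) (diagm (\<chi> i. exp (- d$i)))"
  by (simp add: minverse_def diagm_diagm diagm_one exp_minus)

lemma br_gl: "minverse h k \<Longrightarrow> br (gl_act h \<mu>) X Y = h *v br \<mu> (k *v X) (k *v Y)"
  by (simp add: br_gl_act matrix_inv_minverse)

lemma ad_gl: "minverse h k \<Longrightarrow> ad (gl_act h \<mu>) X = h ** ad \<mu> (k *v X) ** k"
  by (rule mat_eqI) (simp add: ad_mvec br_gl flip: matrix_vector_mul_assoc)

lemma gl_mult:
  assumes "minverse h k" "minverse g l"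
  shows "gl_act (h ** g) \<mu> = gl_act h (gl_act g \<mu>)"
  by (rule brk_eqI)
     (simp add: br_gl[OF assms(1)] br_gl[OF assms(2)] br_gl[OF minverse_mult[OF assms]]
       matrix_vector_mul_assoc)

lemma gl_one: "gl_act (mat 1) \<mu> = \<mu>"
  by (rule brk_eqI) (simp add: br_gl[of "mat 1" "mat 1"] minverse_def)

lemma linear_gl: "linear (gl_act h)"
  by (auto intro!: linearI brk_eqI simp: br_gl_act br_simps mvec_simps)

lemma gl_pi:
  assumes "minverse h k"
  shows "gl_act h (pi_act A \<mu>) = pi_act (h ** A ** k) (gl_act h \<mu>)"
proof (rule brk_eqI)
  have "k *v (h *v x) = x" for x
    using assms by (simp add: minverse_def matrix_vector_mul_assoc)
  then show "br (gl_act h (pi_act A \<mu>)) X Y = br (pi_act (h ** A ** k) (gl_act h \<mu>)) X Y" for X Y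
    by (simp add: br_gl[OF assms] br_pi_act mvec_simps flip: matrix_vector_mul_assoc)
qed

lemma inner_gl:
  assumes h: "minverse h k"
  shows "inner (gl_act h \<mu>) \<nu> = inner \<mu> (gl_act (transpose h) \<nu>)"
proof -
  have 1: "inner (h ** A ** k) C = inner A (transpose h ** C ** transpose k)" for A C :: "real^'a^'a"
    using inner_mmul_right[of "h ** A" k C] inner_mmul_left[of h A "C ** transpose k"]
    by (simp add: matrix_mul_assoc)
  have "inner (gl_act h \<mu>) \<nu> = (\<Sum>i\<in>UNIV. inner (ad \<mu> (k *v axis i 1)) (transpose h ** ad \<nu> (axis i 1) ** transpose k))"
    unfolding inner_brk_ad[of "gl_act h \<mu>"] ad_gl[OF h] 1 ..
  also have "\<dots> = (\<Sum>i\<in>UNIV. inner (ad \<mu> (axis i 1)) (transpose h ** ad \<nu> (transpose k *v axis i 1) ** transpose k))"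
    by (rule bilinear_sum_swap) (auto intro!: linearI simp: ad_simps inner_simps mmul_simps)
  also have "\<dots> = inner \<mu> (gl_act (transpose h) \<nu>)"
    unfolding inner_brk_ad[of \<mu>] ad_gl[OF minverse_transpose[OF h]] ..
  finally show ?thesis .
qed

text \<open>The length depends on h only through h^t h. Hence a product of exponentials may be
  replaced by the symmetric factor of its polar decomposition.\<close>

lemma norm_gl:
  assumes "minverse h k"
  shows "(norm (gl_act h \<mu>))^2 = inner \<mu> (gl_act (transpose h ** h) \<mu>)"
  by (simp add: power2_norm_eq_inner inner_gl[OF assms] gl_mult[OF minverse_transpose[OF assms] assms])

lemma norm_gl_orthm: "orthm P \<Longrightarrow> norm (gl_act P \<mu>) = norm \<mu>"
  using norm_gl[OF minverse_orthm(2), of P \<mu>]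
  by (simp add: orthm_def gl_one norm_eq_square power2_norm_eq_inner flip: dot_square_norm)

lemma inner_brk_nth: "inner \<mu> \<nu> = (\<Sum>i\<in>UNIV. \<Sum>j\<in>UNIV. \<Sum>k\<in>UNIV. \<mu>$i$j$k * \<nu>$i$j$k)"
  by (simp add: inner_vec_def)

text \<open>In an eigenframe of A the structure constant with indices i, j, k is scaled by exp(t
  (a_k - a_i - a_j)), so the squared norm is an explicit sum of exponentials; the change of frame is
  an isometry.\<close>

lemma norm_mexp_deriv:
  assumes A: "transpose A = A"
  shows "((\<lambda>t. (norm (gl_act (mexp (t *\<^sub>R A)) \<nu>))^2) has_real_derivative 2 * inner (pi_act A \<nu>) \<nu>) (at 0)"
proof -
  obtain P a where P: "orthm P" "A = conjd P a"
    using simultaneous_diagonalization[OF A A refl] by metis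
  define w where "w = gl_act (transpose P) \<nu>"
  define e where "e t i j k = exp (t * (a$k - a$i - a$j))" for t i j k
  note PP = minverse_orthm[OF P(1)]
  have diag: "(diagm d *v x) $ k = d$k * x$k" for d x k
    by (simp add: diagm_def matrix_vector_mult_def if_distrib[of "\<lambda>x. x * _"] cong: if_cong)
  have n: "(norm (gl_act (mexp (t *\<^sub>R A)) \<nu>))^2 = (\<Sum>i\<in>UNIV. \<Sum>j\<in>UNIV. \<Sum>k\<in>UNIV. (e t i j k * w$i$j$k)^2)" for t
  proof -
    let ?D = "diagm (\<chi> i. exp ((t *\<^sub>R a)$i))" and ?D' = "diagm (\<chi> i. exp (- (t *\<^sub>R a)$i))"
    have D: "minverse ?D ?D'" by (rule minverse_diagm_exp)
    have "mexp (t *\<^sub>R A) = P ** ?D ** transpose P"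
      unfolding P(2) mexp_scaleR_conjd[OF P(1)] by (simp add: conjd_def)
    then have "gl_act (mexp (t *\<^sub>R A)) \<nu> = gl_act P (gl_act ?D w)"
      unfolding w_def by (simp only: gl_mult[OF minverse_mult[OF PP(2) D] PP(1)] gl_mult[OF PP(2) D])
    then have 1: "norm (gl_act (mexp (t *\<^sub>R A)) \<nu>) = norm (gl_act ?D w)"
      by (simp add: norm_gl_orthm[OF P(1)])
    have "gl_act ?D w $ i $ j $ k = e t i j k * w$i$j$k" for i j k
    proof -
      have "gl_act ?D w $ i $ j = ?D *v br w (?D' *v axis i 1) (?D' *v axis j 1)"
        unfolding br_axis[symmetric] by (rule br_gl[OF D])
      also have "\<dots> $ k = e t i j k * w$i$j$k"
        unfolding diag by (simp add: diagm_axis br_simps br_axis e_def algebra_simps exp_add exp_diff exp_minus divide_inverse)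
      finally show ?thesis .
    qed
    then show ?thesis unfolding 1 power2_norm_eq_inner inner_brk_nth by (simp add: power2_eq_square)
  qed
  have "((\<lambda>t. \<Sum>i\<in>UNIV. \<Sum>j\<in>UNIV. \<Sum>k\<in>UNIV. (e t i j k * w$i$j$k)^2) has_real_derivative
     (\<Sum>i\<in>UNIV. \<Sum>j\<in>UNIV. \<Sum>k\<in>UNIV. 2 * ((a$k - a$i - a$j) * w$i$j$k * w$i$j$k))) (at 0)"
    unfolding e_def
    by (intro DERIV_sum) (auto intro!: derivative_eq_intros simp: power2_eq_square algebra_simps)
  also have "(\<Sum>i\<in>UNIV. \<Sum>j\<in>UNIV. \<Sum>k\<in>UNIV. 2 * ((a$k - a$i - a$j) * w$i$j$k * w$i$j$k)) =
     2 * inner (pi_act (diagm a) w) w"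
  proof -
    have "pi_act (diagm a) w $ i $ j $ k = (a$k - a$i - a$j) * w$i$j$k" for i j k
      unfolding br_axis[symmetric] br_pi_act
      by (simp add: diag diagm_axis br_simps) (simp add: br_axis algebra_simps)
    then show ?thesis unfolding inner_brk_nth sum_distrib_left by simp
  qed
  also have "inner (pi_act (diagm a) w) w = inner (pi_act A \<nu>) \<nu>"
  proof -
    have "transpose P ** A ** P = diagm a"
      using P(1) by (simp add: P(2) conjd_def orthm_def) (metis matrix_mul_assoc matrix_mul_lid matrix_mul_rid)
    then have "pi_act (diagm a) w = gl_act (transpose P) (pi_act A \<nu>)"
      unfolding w_def using gl_pi[OF PP(1), of A \<nu>] by simp
    then have "inner (pi_act (diagm a) w) w = inner (pi_act A \<nu>) (gl_act P (gl_act (transpose P) \<nu>))"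
      by (simp add: inner_gl[OF PP(1)] w_def)
    then show ?thesis using P(1) by (simp add: gl_mult[OF PP(2,1), symmetric] orthm_def gl_one)
  qed
  finally show ?thesis unfolding n .
qed

lemma is_lie_gl:
  assumes "minverse h k" "is_lie \<mu>" shows "is_lie (gl_act h \<mu>)"
proof -
  have kh: "k *v (h *v x) = x" for x
    using assms by (simp add: minverse_def matrix_vector_mul_assoc)
  have "gl_act h \<mu> \<in> Vs"
    using assms(2) br_skew[of \<mu>] unfolding Vs_iff is_lie_def br_gl[OF assms(1)] by (metis mvec_minus_right)
  moreover have "br \<mu> X (br \<mu> Y Z) + br \<mu> Y (br \<mu> Z X) + br \<mu> Z (br \<mu> X Y) = 0" for X Y Z
    using assms(2) by (simp add: is_lie_def)
  then have "h *v br \<mu> X (br \<mu> Y Z) + h *v br \<mu> Y (br \<mu> Z X) + h *v br \<mu> Z (br \<mu> X Y) = 0" for X Y Z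
    by (metis matrix_vector_mult_0_right matrix_vector_right_distrib)
  ultimately show ?thesis by (simp add: is_lie_def br_gl[OF assms(1)] kh)
qed

lemma dword_gl:
  assumes "minverse h k"
  shows "dword (gl_act h \<mu>) m f = h *v dword \<mu> m (\<lambda>i. k *v f i)"
proof (induction m arbitrary: f)
  case 0
  then show ?case using assms by (simp add: minverse_def matrix_vector_mul_assoc)
next
  case (Suc m)
  have kh: "k *v (h *v x) = x" for x
    using assms by (simp add: minverse_def matrix_vector_mul_assoc)
  show ?case by (simp add: Suc br_gl[OF assms] kh)
qed

section \<open>Limits of brackets\<close>

lemma tendsto_br:
  assumes "(m \<longlongrightarrow> \<mu>) F" "(f \<longlongrightarrow> X) F" "(g \<longlongrightarrow> Y) F"
  shows "((\<lambda>n. br (m n) (f n) (g n)) \<longlongrightarrow> br \<mu> X Y) F"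
  unfolding br_def
  by (rule vec_tendstoI) (auto intro!: tendsto_intros assms)

lemma tendsto_ad:
  assumes "(m \<longlongrightarrow> \<mu>) F" "(f \<longlongrightarrow> X) F"
  shows "((\<lambda>n. ad (m n) (f n)) \<longlongrightarrow> ad \<mu> X) F"
  unfolding ad_def
  by (rule vec_tendstoI, rule vec_tendstoI) (auto intro!: tendsto_vec_nth tendsto_br assms)

lemma tendsto_mmul:
  fixes A B :: "_ \<Rightarrow> real^'n^'n"
  assumes "(A \<longlongrightarrow> a) F" "(B \<longlongrightarrow> b) F"
  shows "((\<lambda>n. A n ** B n) \<longlongrightarrow> a ** b) F"
  unfolding matrix_matrix_mult_def
  by (rule vec_tendstoI, rule vec_tendstoI) (auto intro!: tendsto_intros assms)

lemma tendsto_matpow: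
  assumes "(A \<longlongrightarrow> a) F" shows "((\<lambda>n. matpow (A n) k) \<longlongrightarrow> matpow a k) F"
  by (induction k) (auto simp: matpow_0 matpow_Suc intro: tendsto_mmul assms)

lemma tendsto_trace:
  fixes A :: "_ \<Rightarrow> real^'n^'n"
  assumes "(A \<longlongrightarrow> a) F" shows "((\<lambda>n. trace (A n)) \<longlongrightarrow> trace a) F"
  unfolding trace_def by (auto intro!: tendsto_intros assms)

lemma tendsto_linear:
  fixes f :: "'a::euclidean_space \<Rightarrow> 'b::real_normed_vector"
  assumes "linear f" "(x \<longlongrightarrow> a) F" shows "((\<lambda>n. f (x n)) \<longlongrightarrow> f a) F"
  using assms bounded_linear.tendsto linear_conv_bounded_linear by blast

lemma is_lie_closed:
  assumes lim: "m \<longlonglongrightarrow> \<mu>" and lie: "\<And>n. is_lie (m n)"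
  shows "is_lie \<mu>"
proof -
  have "br \<mu> X Y = - br \<mu> Y X" for X Y
  proof (rule LIMSEQ_unique)
    show "(\<lambda>n. br (m n) X Y) \<longlonglongrightarrow> br \<mu> X Y" by (intro tendsto_br lim tendsto_const)
    have "(\<lambda>n. - br (m n) Y X) \<longlonglongrightarrow> - br \<mu> Y X" by (intro tendsto_minus tendsto_br lim tendsto_const)
    moreover have "br (m n) X Y = - br (m n) Y X" for n
      using lie[of n] br_skew by (auto simp: is_lie_def)
    ultimately show "(\<lambda>n. br (m n) X Y) \<longlonglongrightarrow> - br \<mu> Y X" by simp
  qed
  moreover have "br \<mu> X (br \<mu> Y Z) + br \<mu> Y (br \<mu> Z X) + br \<mu> Z (br \<mu> X Y) = 0" for X Y Z
  proof (rule LIMSEQ_unique)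
    show "(\<lambda>n. br (m n) X (br (m n) Y Z) + br (m n) Y (br (m n) Z X) + br (m n) Z (br (m n) X Y))
      \<longlonglongrightarrow> br \<mu> X (br \<mu> Y Z) + br \<mu> Y (br \<mu> Z X) + br \<mu> Z (br \<mu> X Y)"
      by (intro tendsto_add tendsto_br lim tendsto_const)
    show "(\<lambda>n. br (m n) X (br (m n) Y Z) + br (m n) Y (br (m n) Z X) + br (m n) Z (br (m n) X Y)) \<longlonglongrightarrow> 0"
      using lie by (simp add: is_lie_def)
  qed
  ultimately show ?thesis unfolding is_lie_def Vs_iff by blast
qed

lemma dword_closed:
  assumes lim: "m \<longlonglongrightarrow> \<mu>" and z: "\<And>n. dword (m n) K f = 0"
  shows "dword \<mu> K f = 0"
proof (rule LIMSEQ_unique)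
  show "(\<lambda>n. dword (m n) K f) \<longlonglongrightarrow> dword \<mu> K f"
    by (induction K arbitrary: f) (auto intro!: tendsto_br lim)
qed (simp add: z)

section \<open>The vector of minimal norm in an orbit closure\<close>

text \<open>The symmetric directions of H_beta; the other factor of H_beta consists of isometries
  and does not affect lengths.\<close>

definition psym :: "'n::finite mat \<Rightarrow> 'n mat set" where
  "psym \<beta> = {S. transpose S = S \<and> \<beta> ** S = S ** \<beta> \<and> inner S \<beta> = 0}"

lemma psym_hb: "psym \<beta> = {S \<in> hb \<beta>. transpose S = S}"
  by (auto simp: psym_def hb_def gb_def glr_def)

lemma psym_scaleR: "S \<in> psym \<beta> \<Longrightarrow> t *\<^sub>R S \<in> psym \<beta>"
  by (simp add: psym_def mmul_simps)

lemma mexp_psym_in_Hgrp: "S \<in> psym \<beta> \<Longrightarrow> mexp S \<in> Hgrp \<beta>"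
proof -
  assume S: "S \<in> psym \<beta>"
  have "matrix_inv (mat 1 :: 'a mat) = mat 1" by (rule matrix_inv_minverse) (simp add: minverse_def)
  then have "mat 1 \<in> Kgrp \<beta>" by (simp add: Kgrp_def orthogonal_matrix_id)
  moreover have "mexp S = mat 1 ** mexp S" by simp
  ultimately show ?thesis using S unfolding Hgrp_def psym_hb by blast
qed

text \<open>A Kempf-Ness argument. A sequence along which the length tends to its infimum is
  bounded, and a limit point is nonzero by semistability. The limit is still shortest along the
  exponentials of \<open>psym\<close>, so the first variation of length vanishes in all these
  directions.\<close>

lemma orbit_minimal_bracket:
  assumes lie: "is_lie \<mu>" and solv: "\<And>f. dword \<mu> K f = 0" and D: "pi_act (betaplus \<beta>) \<mu> = 0"
    and \<beta>: "transpose \<beta> = \<beta>" "\<beta> \<noteq> 0"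
    and ss: "0 \<notin> closure ((\<lambda>h. gl_act h \<mu>) ` Hgrp \<beta>)"
  obtains \<nu> c S where "minimal_bracket \<nu> \<beta> c K" "\<And>n::nat. S n \<in> psym \<beta>"
    "(\<lambda>n. gl_act (mexp (S n)) \<mu>) \<longlonglongrightarrow> \<nu>"
proof -
  define N where "N S = norm (gl_act (mexp S) \<mu>)" for S
  obtain \<epsilon> where \<epsilon>: "\<epsilon> > 0" "\<And>S. S \<in> psym \<beta> \<Longrightarrow> N S \<ge> \<epsilon>"
  proof -
    obtain e where "e > 0" "\<And>y. y \<in> (\<lambda>h. gl_act h \<mu>) ` Hgrp \<beta> \<Longrightarrow> \<not> dist y 0 < e"
      using ss by (auto simp: closure_approachable)
    then show thesis using that[of e] mexp_psym_in_Hgrp by (fastforce simp: N_def)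
  qed
  define m where "m = Inf (N ` psym \<beta>)"
  have 0: "0 \<in> psym \<beta>" by (simp add: psym_def mmul_simps)
  have bb: "bdd_below (N ` psym \<beta>)" using \<epsilon> by (intro bdd_belowI2[of _ \<epsilon>])
  have m: "m \<le> N S" if "S \<in> psym \<beta>" for S
    unfolding m_def by (intro cInf_lower bb imageI that)
  have m0: "m \<ge> \<epsilon>" unfolding m_def using 0 \<epsilon> by (intro cInf_greatest) auto
  have "\<exists>S\<in>psym \<beta>. N S < m + 1 / Suc n" for n
  proof -
    have "\<exists>y\<in>N ` psym \<beta>. y < m + 1 / Suc n"
      unfolding m_def by (rule cInf_lessD) (use 0 in auto)
    then show ?thesis by blast
  qed
  then obtain S where S: "\<And>n. S n \<in> psym \<beta>" "\<And>n. N (S n) < m + 1 / Suc n" by metis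
  have Nlim: "(\<lambda>n. N (S n)) \<longlonglongrightarrow> m"
  proof (rule real_tendsto_sandwich)
    show "\<forall>\<^sub>F n in sequentially. m \<le> N (S n)" using m S(1) by simp
    show "\<forall>\<^sub>F n in sequentially. N (S n) \<le> m + 1 / Suc n" using S(2) by (simp add: less_imp_le)
    show "(\<lambda>n. m + 1 / Suc n) \<longlonglongrightarrow> m"
      using tendsto_add[OF tendsto_const LIMSEQ_inverse_real_of_nat] by (simp add: inverse_eq_divide)
  qed simp
  have "gl_act (mexp (S n)) \<mu> \<in> cball 0 (m + 1)" for n
  proof -
    have "N (S n) \<le> m + 1 / Suc n" using S(2) by (simp add: less_imp_le)
    also have "\<dots> \<le> m + 1" by simp
    finally show ?thesis by (simp add: N_def)
  qed
  then obtain \<nu> r where r: "strict_mono r" "((\<lambda>n. gl_act (mexp (S n)) \<mu>) \<circ> r) \<longlonglongrightarrow> \<nu>"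
    using compact_imp_seq_compact[OF compact_cball] unfolding seq_compact_def by metis
  define s where "s n = S (r n)" for n
  have s: "s n \<in> psym \<beta>" for n using S by (simp add: s_def)
  have lim: "(\<lambda>n. gl_act (mexp (s n)) \<mu>) \<longlonglongrightarrow> \<nu>" using r(2) by (simp add: s_def o_def)
  have inv: "minverse (mexp (s n)) (mexp (- s n))" for n
    using s by (intro minverse_mexp) (simp add: psym_def)
  have norm\<nu>: "norm \<nu> = m"
  proof (rule LIMSEQ_unique)
    show "(\<lambda>n. N (s n)) \<longlonglongrightarrow> norm \<nu>" unfolding N_def by (intro tendsto_norm lim)
    show "(\<lambda>n. N (s n)) \<longlonglongrightarrow> m" using LIMSEQ_subseq_LIMSEQ[OF Nlim r(1)] by (simp add: s_def o_def)
  qed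
  have D\<nu>: "pi_act (betaplus \<beta>) \<nu> = 0"
  proof (rule LIMSEQ_unique)
    show "(\<lambda>n. pi_act (betaplus \<beta>) (gl_act (mexp (s n)) \<mu>)) \<longlonglongrightarrow> pi_act (betaplus \<beta>) \<nu>"
      by (rule tendsto_linear[OF linear_pi_act(1) lim])
    have "pi_act (betaplus \<beta>) (gl_act (mexp (s n)) \<mu>) = 0" for n
    proof -
      have "\<beta> ** mexp (s n) = mexp (s n) ** \<beta>"
        using s[of n] \<beta> by (intro mexp_commute) (auto simp: psym_def)
      then have "mexp (s n) ** betaplus \<beta> = betaplus \<beta> ** mexp (s n)"
        by (simp add: betaplus_def mmul_simps)
      then have "mexp (s n) ** betaplus \<beta> ** mexp (- s n) = betaplus \<beta>"
        using inv[of n] by (simp add: minverse_def flip: matrix_mul_assoc)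
      then show ?thesis
        using gl_pi[OF inv, of n "betaplus \<beta>" \<mu>] D by (simp add: linear_0[OF linear_gl])
    qed
    then show "(\<lambda>n. pi_act (betaplus \<beta>) (gl_act (mexp (s n)) \<mu>)) \<longlonglongrightarrow> 0" by simp
  qed
  have min: "norm (gl_act (mexp A) \<nu>) \<ge> m" if A: "A \<in> psym \<beta>" for A
  proof (rule LIMSEQ_le_const)
    show "(\<lambda>n. norm (gl_act (mexp A) (gl_act (mexp (s n)) \<mu>))) \<longlonglongrightarrow> norm (gl_act (mexp A) \<nu>)"
      by (rule tendsto_norm[OF tendsto_linear[OF linear_gl lim]])
    have "m \<le> norm (gl_act (mexp A) (gl_act (mexp (s n)) \<mu>))" for n
    proof -
      \<comment> \<open>Polar decomposition replaces two successive exponentials by one from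
        \<open>psym\<close> with the same effect on length, so the infimum bounds it.\<close>
      obtain S' where S': "transpose S' = S'" "\<beta> ** S' = S' ** \<beta>" "inner S' \<beta> = 0"
        "mexp S' ** mexp S' = transpose (mexp A ** mexp (s n)) ** (mexp A ** mexp (s n))"
        using mexp_polar[OF \<beta>(1), of "s n" A] A s[of n] by (auto simp: psym_def)
      have As: "minverse (mexp A) (mexp (- A))" using A by (intro minverse_mexp) (simp add: psym_def)
      have "(norm (gl_act (mexp A) (gl_act (mexp (s n)) \<mu>)))^2 = (N S')^2"
        unfolding N_def norm_gl[OF minverse_mexp[OF S'(1)]] gl_mult[OF As inv, symmetric]
          norm_gl[OF minverse_mult[OF As inv]] mexp_sym_inverse(1)[OF S'(1)] S'(4) ..
      then have "norm (gl_act (mexp A) (gl_act (mexp (s n)) \<mu>)) = N S'"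
        by (simp add: N_def)
      then show ?thesis using m[of S'] S' by (simp add: psym_def)
    qed
    then show "\<exists>N. \<forall>n\<ge>N. m \<le> norm (gl_act (mexp A) (gl_act (mexp (s n)) \<mu>))" by blast
  qed
  have crit: "inner (pi_act A \<nu>) \<nu> = 0" if A: "A \<in> psym \<beta>" for A
  proof -
    have "transpose A = A" using A by (simp add: psym_def)
    from norm_mexp_deriv[OF this, of \<nu>]
    have "2 * inner (pi_act A \<nu>) \<nu> = 0"
    proof (rule DERIV_local_min)
      show "\<forall>y. \<bar>0 - y\<bar> < 1 \<longrightarrow> (norm (gl_act (mexp (0 *\<^sub>R A)) \<nu>))^2 \<le> (norm (gl_act (mexp (y *\<^sub>R A)) \<nu>))^2"
      proof (intro allI impI)
        fix y :: real
        have "mexp (0 :: 'a mat) = mat 1"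
          using mexp_sym_inverse(2)[of "0 :: 'a mat"] mexp_scaleR_conjd[of "mat 1 :: 'a mat" 0 0]
          by (simp add: orthm_def mmul_simps conjd_one)
        then show "(norm (gl_act (mexp (0 *\<^sub>R A)) \<nu>))^2 \<le> (norm (gl_act (mexp (y *\<^sub>R A)) \<nu>))^2"
          using min[OF psym_scaleR[OF A], of y] norm\<nu> m0 \<epsilon>(1) by (intro power_mono) (simp_all add: gl_one)
      qed
    qed simp
    then show ?thesis by simp
  qed
  have pi\<beta>: "pi_act \<beta> \<nu> = (norm \<beta>)^2 *\<^sub>R \<nu>"
    using D\<nu> by (simp add: betaplus_def pi_act_simps pi_act_id)
  \<comment> \<open>\<open>\<nu>\<close> is an eigenvector of the self-adjoint pi(beta), so pi of a
    commutator [beta, F] pairs to zero with it.\<close>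
  have comm: "\<beta> ** Mop \<nu> = Mop \<nu> ** \<beta>"
  proof -
    have "inner (\<beta> ** Mop \<nu> - Mop \<nu> ** \<beta>) F = 0" for F
    proof -
      have "inner (\<beta> ** Mop \<nu> - Mop \<nu> ** \<beta>) F = inner (Mop \<nu>) (\<beta> ** F - F ** \<beta>)"
        using inner_mmul_left[of \<beta> "Mop \<nu>" F] inner_mmul_right[of "Mop \<nu>" \<beta> F] \<beta>(1)
        by (simp add: inner_diff_left inner_diff_right)
      also have "\<dots> = inner (pi_act (\<beta> ** F - F ** \<beta>) \<nu>) \<nu> / 4" by (rule inner_Mop)
      also have "pi_act (\<beta> ** F - F ** \<beta>) \<nu> = pi_act \<beta> (pi_act F \<nu>) - pi_act F (pi_act \<beta> \<nu>)"
        using pi_act_commute[of \<beta> F \<nu>] by simp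
      also have "inner \<dots> \<nu> = 0"
        using inner_pi_act[of \<beta> "pi_act F \<nu>" \<nu>] \<beta>(1)
        by (simp add: inner_diff_left pi\<beta> pi_act_simps)
      finally show ?thesis by simp
    qed
    then show ?thesis by (metis inner_eq_zero_iff eq_iff_diff_eq_0)
  qed
  \<comment> \<open>The value that makes M - c beta orthogonal to beta, given pi(beta) nu = |beta|^2
    nu. The difference then lies in \<open>psym\<close>, and the first variation makes it orthogonal
    to itself.\<close>
  define c where "c = (norm \<nu>)^2 / 4"
  have cpos: "c > 0" using norm\<nu> m0 \<epsilon>(1) by (simp add: c_def)
  have M\<beta>: "inner (Mop \<nu>) \<beta> = c * inner \<beta> \<beta>"
    by (simp add: inner_Mop pi\<beta> c_def power2_norm_eq_inner)
  define Z where "Z = Mop \<nu> - c *\<^sub>R \<beta>"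
  have Z: "Z \<in> psym \<beta>"
    unfolding Z_def psym_def using M\<beta> comm \<beta>(1) Mop_sym[of \<nu>]
    by (simp add: mmul_simps inner_diff_left)
  have "inner Z Z = inner (Mop \<nu>) Z - c * inner Z \<beta>"
    by (simp add: Z_def inner_diff_left inner_diff_right inner_commute algebra_simps)
  also have "\<dots> = 0" using crit[OF Z] Z by (simp add: inner_Mop psym_def)
  finally have M: "Mop \<nu> = c *\<^sub>R \<beta>" by (simp add: Z_def)
  have "minimal_bracket \<nu> \<beta> c K"
  proof
    show "is_lie \<nu>" by (rule is_lie_closed[OF lim]) (rule is_lie_gl[OF inv lie])
    show "dword \<nu> K f = 0" for f
      by (rule dword_closed[OF lim]) (simp add: dword_gl[OF inv] solv)
  qed (use \<beta> cpos D\<nu> M in auto)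
  then show thesis using that s lim by blast
qed

text \<open>Traces of powers of ad are invariant under the group and homogeneous in X, so they
  vanish at the vectors g_n X rescaled to length 1. A limit point would be a unit vector of degree
  zero with vanishing traces for \<open>\<nu>\<close>, which \<open>traceless_zero\<close>
  excludes.\<close>

lemma semistable_traceless_zero:
  assumes mb: "minimal_bracket \<nu> \<beta> c K" and S: "\<And>n::nat. S n \<in> psym \<beta>"
    and lim: "(\<lambda>n. gl_act (mexp (S n)) \<mu>) \<longlonglongrightarrow> \<nu>"
    and X: "X \<in> szero \<beta>" and tr: "\<And>m. trace (matpow (ad \<mu> X) (Suc m)) = 0"
  shows "X = 0"
proof (rule ccontr)
  assume X0: "X \<noteq> 0"
  interpret minimal_bracket \<nu> \<beta> c K by fact
  define g where "g n = mexp (S n)" for n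
  have inv: "minverse (g n) (mexp (- S n))" for n
    unfolding g_def using S by (intro minverse_mexp) (simp add: psym_def)
  define x where "x n = (g n *v X) /\<^sub>R norm (g n *v X)" for n
  have gX: "g n *v X \<noteq> 0" for n
    using inv[of n] X0 by (metis matrix_vector_mul_assoc matrix_vector_mul_lid matrix_vector_mult_0_right minverse_def)
  have xs: "x n \<in> szero \<beta>" for n
  proof -
    have "\<beta> ** g n - g n ** \<beta> = 0"
      using mexp_commute[of "S n" \<beta>] S[of n] \<beta>(1) by (simp add: psym_def g_def)
    from preserves_szero[OF this X] show ?thesis
      unfolding x_def by (intro subspace_scale[OF subspace_szero])
  qed
  have "x n \<in> sphere 0 1" for n using gX[of n] by (simp add: x_def)
  then obtain y r where r: "strict_mono r" "y \<in> sphere 0 1" "(x \<circ> r) \<longlonglongrightarrow> y"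
    using compact_imp_seq_compact[OF compact_sphere] unfolding seq_compact_def by metis
  have ys: "y \<in> szero \<beta>"
    by (rule closed_sequentially[OF closed_subspace[OF subspace_szero] _ r(3)]) (simp add: xs)
  have l: "(\<lambda>n. ad (gl_act (g (r n)) \<mu>) (x (r n))) \<longlonglongrightarrow> ad \<nu> y"
    using LIMSEQ_subseq_LIMSEQ[OF lim r(1)] r(3)
    by (intro tendsto_ad) (simp_all add: o_def g_def)
  have conj: "matpow (h ** A ** k) m = h ** matpow A m ** k" if "minverse h k" for h A k :: "'a mat" and m
  proof (induction m)
    case (Suc m)
    have "k ** (h ** C) = C" for C :: "real^'a^'a" using that by (simp add: minverse_def matrix_mul_assoc)
    then show ?case unfolding matpow_Suc Suc by (simp add: matrix_mul_assoc[symmetric])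
  qed (use that in \<open>simp add: matpow_0 minverse_def\<close>)
  have scal: "matpow (t *\<^sub>R A) m = t ^ m *\<^sub>R matpow A m" for t A m
    by (induction m) (simp_all add: matpow_0 matpow_Suc mmul_simps mult.commute)
  have "trace (matpow (ad \<nu> y) (Suc m)) = 0" for m
  proof (rule LIMSEQ_unique)
    show "(\<lambda>n. trace (matpow (ad (gl_act (g (r n)) \<mu>) (x (r n))) (Suc m))) \<longlonglongrightarrow> trace (matpow (ad \<nu> y) (Suc m))"
      by (intro tendsto_trace tendsto_matpow l)
    have "trace (matpow (ad (gl_act (g n) \<mu>) (x n)) (Suc m)) = 0" for n
    proof -
      let ?k = "mexp (- S n)"
      have "?k *v x n = (1 / norm (g n *v X)) *\<^sub>R X"
        using inv[of n] by (simp add: x_def mvec_simps matrix_vector_mul_assoc minverse_def divide_inverse)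
      then have "ad (gl_act (g n) \<mu>) (x n) = (1 / norm (g n *v X)) *\<^sub>R (g n ** ad \<mu> X ** ?k)"
        by (simp add: ad_gl[OF inv] ad_simps mmul_simps)
      moreover have "trace (g n ** matpow (ad \<mu> X) (Suc m) ** ?k) = trace (matpow (ad \<mu> X) (Suc m))"
        using trace_mul_sym[of "g n" "matpow (ad \<mu> X) (Suc m) ** ?k"] inv[of n]
        by (simp add: minverse_def flip: matrix_mul_assoc)
      ultimately show ?thesis
        using tr[of m] by (simp add: scal conj[OF inv] trace_scaleR)
    qed
    then show "(\<lambda>n. trace (matpow (ad (gl_act (g (r n)) \<mu>) (x (r n))) (Suc m))) \<longlonglongrightarrow> 0" by simp
  qed
  from traceless_zero[OF ys this] r(2) show False by simp
qed

section \<open>Orthogonal projections and the projection onto the parabolic subalgebra\<close>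

lemma orthproj_eq:
  fixes S :: "'a::real_inner set"
  assumes S: "subspace S" and p: "p \<in> S" "\<And>y. y \<in> S \<Longrightarrow> inner (x - p) y = 0"
  shows "orthproj S x = p"
  unfolding orthproj_def
proof (rule the_equality)
  fix q assume q: "q \<in> S \<and> (\<forall>y\<in>S. inner (x - q) y = 0)"
  have "p - q \<in> S" using S p(1) q by (simp add: subspace_diff)
  then have "inner (x - q) (p - q) - inner (x - p) (p - q) = 0" using p q by simp
  then have "inner (p - q) (p - q) = 0" by (simp flip: inner_diff_left)
  then show "q = p" by simp
qed (use p in auto)

lemma orthproj:
  fixes S :: "'a::euclidean_space set"
  assumes S: "subspace S"
  shows "orthproj S x \<in> S" "y \<in> S \<Longrightarrow> inner (x - orthproj S x) y = 0"
proof -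
  obtain p z where p: "p \<in> span S" "\<And>w. w \<in> span S \<Longrightarrow> orthogonal z w" "x = p + z"
    using orthogonal_subspace_decomp_exists[of S x] by metis
  have sp: "span S = S" using S by (rule span_eq_iff[THEN iffD2])
  have "orthproj S x = p"
    using S by (rule orthproj_eq) (use p in \<open>auto simp: sp orthogonal_def\<close>)
  with p show "orthproj S x \<in> S" "y \<in> S \<Longrightarrow> inner (x - orthproj S x) y = 0"
    by (auto simp: sp orthogonal_def)
qed

lemma linear_orthproj:
  fixes S :: "'a::euclidean_space set"
  assumes S: "subspace S" shows "linear (orthproj S)"
proof (rule linearI)
  note o = orthproj[OF S]
  show "orthproj S (x + y) = orthproj S x + orthproj S y" for x y
  proof (rule orthproj_eq[OF S])
    show "orthproj S x + orthproj S y \<in> S" using o(1) S by (simp add: subspace_add)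
    fix z assume "z \<in> S"
    then show "inner (x + y - (orthproj S x + orthproj S y)) z = 0"
      using o(2)[of z x] o(2)[of z y] by (simp add: inner_simps)
  qed
  show "orthproj S (r *\<^sub>R x) = r *\<^sub>R orthproj S x" for r x
  proof (rule orthproj_eq[OF S])
    show "r *\<^sub>R orthproj S x \<in> S" using o(1) S by (simp add: subspace_scale)
    fix z assume "z \<in> S"
    then show "inner (r *\<^sub>R x - r *\<^sub>R orthproj S x) z = 0"
      using o(2)[of z x] by (simp flip: scaleR_diff_right)
  qed
qed

text \<open>Commutation with beta as a self-adjoint operator on matrices; its positive, zero and
  negative spectral subspaces are ub, gb and the transpose of ub.\<close>
locale symmetric_label =
  fixes \<beta> :: "'n::finite mat"
  assumes sym: "transpose \<beta> = \<beta>"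
begin

lemma commutator_selfadjoint: "inner (\<beta> ** A - A ** \<beta>) E = inner A (\<beta> ** E - E ** \<beta>)"
  using inner_mmul_left[of \<beta> A E] inner_mmul_right[of A \<beta> E] sym
  by (simp add: inner_diff_left inner_diff_right)

lemma ub_span: "ub \<beta> = span {A. \<exists>r>0. \<beta> ** A - A ** \<beta> = r *\<^sub>R A}"
  unfolding ub_def glr_def by (rule arg_cong[where f=span]) blast

lemma gb_iff: "A \<in> gb \<beta> \<longleftrightarrow> \<beta> ** A - A ** \<beta> = 0"
  by (simp add: gb_def glr_def)

lemma subspace_gb: "subspace (gb \<beta>)"
  by (auto simp: subspace_def gb_iff mmul_simps)

lemma subspace_ub: "subspace (ub \<beta>)"
  by (simp add: ub_def)

lemma gb_transpose: "A \<in> gb \<beta> \<Longrightarrow> transpose A \<in> gb \<beta>"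
  using transpose_commute[OF sym, of A] by (simp add: gb_iff)

text \<open>Transposition reverses the sign of an eigenvalue of [beta, .] because beta is
  symmetric.\<close>

lemma transpose_of_negative:
  assumes "A \<in> span {A. \<exists>r<0. \<beta> ** A - A ** \<beta> = r *\<^sub>R A}"
  shows "transpose A \<in> ub \<beta>"
  using assms
proof (induction rule: span_induct)
  case base
  show ?case using subspace_ub by (auto simp: subspace_def mmul_simps)
next
  case (step A)
  then obtain r where r: "r < 0" "\<beta> ** A - A ** \<beta> = r *\<^sub>R A" by blast
  have "\<beta> ** transpose A - transpose A ** \<beta> = (- r) *\<^sub>R transpose A"
    using arg_cong[OF r(2), of "\<lambda>X. - transpose X"] by (simp add: mmul_simps sym)
  then show ?case unfolding ub_span using r(1)
    by (intro span_base) (metis (mono_tags, lifting) mem_Collect_eq neg_0_less_iff_less)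
qed

lemma transpose_negative:
  assumes "A \<in> ub \<beta>"
  shows "transpose A \<in> span {A. \<exists>r<0. \<beta> ** A - A ** \<beta> = r *\<^sub>R A}"
  using assms unfolding ub_span
proof (induction rule: span_induct)
  case base
  show ?case by (auto simp: subspace_def mmul_simps intro: span_zero span_add span_scale)
next
  case (step A)
  then obtain r where r: "r > 0" "\<beta> ** A - A ** \<beta> = r *\<^sub>R A" by blast
  have "\<beta> ** transpose A - transpose A ** \<beta> = (- r) *\<^sub>R transpose A"
    using arg_cong[OF r(2), of "\<lambda>X. - transpose X"] by (simp add: mmul_simps sym)
  then show ?case using r(1)
    by (intro span_base) (metis (mono_tags, lifting) mem_Collect_eq neg_less_0_iff_less)
qed

lemma gb_ub_orthogonal:
  assumes "A \<in> ub \<beta>"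
  shows "C \<in> gb \<beta> \<Longrightarrow> inner C A = 0" "E \<in> ub \<beta> \<Longrightarrow> inner (transpose E) A = 0"
proof -
  note so = selfadjoint_span_orthogonal[OF commutator_selfadjoint]
  show "inner C A = 0" if "C \<in> gb \<beta>"
    by (rule so[of _ "\<lambda>r. r = 0" _ "\<lambda>r. r > 0"])
       (use assms that in \<open>auto simp: gb_iff ub_span intro: span_base\<close>)
  show "inner (transpose E) A = 0" if "E \<in> ub \<beta>"
    by (rule so[OF transpose_negative[OF that], of _ "\<lambda>r. r > 0"]) (use assms in \<open>auto simp: ub_span\<close>)
qed

lemma commutator_ub: "A \<in> ub \<beta> \<Longrightarrow> \<beta> ** A - A ** \<beta> \<in> ub \<beta>"
  unfolding ub_span
proof (induction rule: span_induct)
  case base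
  have lin: "linear (\<lambda>A. \<beta> ** A - A ** \<beta>)"
    by (rule linearI) (simp_all add: mmul_simps algebra_simps)
  show ?case by (rule linear_subspace_vimage[OF lin subspace_span, unfolded vimage_def])
next
  case (step A)
  then obtain r where r: "r > 0" "\<beta> ** A - A ** \<beta> = r *\<^sub>R A" by blast
  show ?case unfolding r(2) by (rule span_scale[OF span_base]) (use r step in blast)
qed

text \<open>Strict positivity on u_beta: a zero value puts A into g_beta as well, which is
  orthogonal to u_beta.\<close>

lemma commutator_ub_pos:
  assumes "A \<in> ub \<beta>"
  shows "inner (\<beta> ** A - A ** \<beta>) A \<ge> 0" and "inner (\<beta> ** A - A ** \<beta>) A = 0 \<Longrightarrow> A = 0"
proof -
  have lin: "linear (\<lambda>A. \<beta> ** A - A ** \<beta>)"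
    by (rule linearI) (simp_all add: mmul_simps algebra_simps)
  have "A \<in> span {A. \<exists>r\<ge>0. \<beta> ** A - A ** \<beta> = r *\<^sub>R A}"
    using assms unfolding ub_span by (rule span_mono[THEN subsetD, rotated]) (auto intro: less_imp_le)
  note nn = selfadjoint_nonneg_part[OF lin commutator_selfadjoint this]
  show "inner (\<beta> ** A - A ** \<beta>) A \<ge> 0" by (rule nn(1))
  assume "inner (\<beta> ** A - A ** \<beta>) A = 0"
  from nn(2)[OF this] have "A \<in> gb \<beta>" by (simp add: gb_iff)
  from gb_ub_orthogonal(1)[OF assms this] show "A = 0" by simp
qed

lemma subspace_qb: "subspace (qb \<beta>)"
  unfolding qb_def by (rule subspace_sums[OF subspace_gb subspace_ub])

lemma subspace_kub: "subspace (kub \<beta>)"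
proof -
  have "kub \<beta> = (\<lambda>A. A - transpose A) ` ub \<beta>" by (auto simp: kub_def)
  then show ?thesis
    by (simp only:) (rule linear_subspace_image[OF _ subspace_ub], rule linearI, simp_all add: mmul_simps algebra_simps)
qed

text \<open>The definite description needs q_beta and the skew complement to meet in 0. If U - U^t
  lies in q_beta, then so does U^t, although it is orthogonal to g_beta + u_beta.\<close>

lemma projq_eq:
  assumes Q: "Q \<in> qb \<beta>" "A - Q \<in> kub \<beta>" shows "projq \<beta> A = Q"
  unfolding projq_def
proof (rule the_equality)
  fix Q' assume Q': "Q' \<in> qb \<beta> \<and> A - Q' \<in> kub \<beta>"
  have "Q - Q' \<in> qb \<beta>" using Q Q' by (simp add: subspace_diff[OF subspace_qb])
  then obtain Z0 Z1 where Z: "Z0 \<in> gb \<beta>" "Z1 \<in> ub \<beta>" "Q - Q' = Z0 + Z1" by (auto simp: qb_def)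
  have "(A - Q') - (A - Q) \<in> kub \<beta>" using Q Q' subspace_diff[OF subspace_kub, of "A - Q'" "A - Q"] by blast
  then obtain U where U: "U \<in> ub \<beta>" "Q - Q' = U - transpose U" by (auto simp: kub_def)
  have "transpose U = U - Z1 - Z0" using U(2) Z(3) by (simp add: algebra_simps)
  then have "inner (transpose U) (transpose U) = inner (transpose U) (U - Z1 - Z0)" by simp
  also have "\<dots> = inner (transpose U) U - inner (transpose U) Z1 - inner (transpose U) Z0"
    by (simp add: inner_diff_right)
  also have "inner (transpose U) Z0 = inner (transpose Z0) U"
    using inner_transpose[of "transpose U" Z0] by (simp add: inner_commute)
  also have "inner (transpose U) U - inner (transpose U) Z1 - inner (transpose Z0) U = 0"
    using gb_ub_orthogonal U(1) Z gb_transpose by simp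
  finally have "transpose U = 0" by simp
  then have "U = 0" by (metis transpose_transpose transpose_zero)
  then show "Q' = Q" using U(2) by (simp add: transpose_zero)
qed (use Q in auto)

lemma projq: "projq \<beta> A \<in> qb \<beta>" "A - projq \<beta> A \<in> kub \<beta>"
proof -
  have lin: "linear (\<lambda>A. \<beta> ** A - A ** \<beta>)"
    by (rule linearI) (simp_all add: mmul_simps algebra_simps)
  obtain M Z U where MZU: "A = M + Z + U" "M \<in> span {A. \<exists>r<0. \<beta> ** A - A ** \<beta> = r *\<^sub>R A}"
    "\<beta> ** Z - Z ** \<beta> = 0" "U \<in> ub \<beta>"
    using selfadjoint_trichotomy[OF lin commutator_selfadjoint, of A] unfolding ub_span by blast
  \<comment> \<open>The negative part M is traded for its transpose at the cost of the skew matrix M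
    - M^t.\<close>
  define Q where "Q = Z + (U + transpose M)"
  have M: "transpose M \<in> ub \<beta>" using transpose_of_negative MZU(2) .
  have Q1: "Q \<in> qb \<beta>" unfolding Q_def qb_def
    using MZU(3,4) M subspace_add[OF subspace_ub] by (auto simp: gb_iff)
  have "A - Q = - transpose M - transpose (- transpose M)"
    unfolding Q_def MZU(1) by (simp add: transpose_minus)
  then have Q2: "A - Q \<in> kub \<beta>"
    unfolding kub_def using subspace_neg[OF subspace_ub M] by blast
  from projq_eq[OF Q1 Q2] Q1 Q2 show "projq \<beta> A \<in> qb \<beta>" "A - projq \<beta> A \<in> kub \<beta>" by simp_all
qed

lemma linear_projq: "linear (projq \<beta>)"
proof (rule linearI)
  show "projq \<beta> (x + y) = projq \<beta> x + projq \<beta> y" for x y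
  proof (rule projq_eq)
    show "projq \<beta> x + projq \<beta> y \<in> qb \<beta>" by (intro subspace_add[OF subspace_qb] projq)
    have "(x - projq \<beta> x) + (y - projq \<beta> y) \<in> kub \<beta>" by (intro subspace_add[OF subspace_kub] projq)
    then show "x + y - (projq \<beta> x + projq \<beta> y) \<in> kub \<beta>" by (simp add: algebra_simps)
  qed
  show "projq \<beta> (r *\<^sub>R x) = r *\<^sub>R projq \<beta> x" for r x
  proof (rule projq_eq)
    show "r *\<^sub>R projq \<beta> x \<in> qb \<beta>" by (intro subspace_scale[OF subspace_qb] projq)
    have "r *\<^sub>R (x - projq \<beta> x) \<in> kub \<beta>" by (intro subspace_scale[OF subspace_kub] projq)
    then show "r *\<^sub>R x - r *\<^sub>R projq \<beta> x \<in> kub \<beta>" by (simp add: algebra_simps)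
  qed
qed

lemma projq_label: "projq \<beta> \<beta> = \<beta>"
proof (rule projq_eq)
  show "\<beta> \<in> qb \<beta>" unfolding qb_def mem_Collect_eq
    by (rule exI[of _ \<beta>], rule exI[of _ 0]) (simp add: gb_iff subspace_0[OF subspace_ub])
  show "\<beta> - \<beta> \<in> kub \<beta>" using subspace_0[OF subspace_kub] by simp
qed

text \<open>On symmetric matrices the projection doubles the component in ub, which is why the
  linearization is self-adjoint only for a rescaled inner product.\<close>
lemma projq_symmetric:
  assumes P: "transpose P = P"
  obtains Q0 Q1 where "projq \<beta> P = Q0 + Q1" "Q0 \<in> gb \<beta>" "Q1 \<in> ub \<beta>"
    "\<And>E. E \<in> gb \<beta> \<Longrightarrow> inner P E = inner Q0 E" "\<And>E. E \<in> ub \<beta> \<Longrightarrow> 2 * inner P E = inner Q1 E"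
proof -
  obtain Q0 Q1 where Q: "Q0 \<in> gb \<beta>" "Q1 \<in> ub \<beta>" "projq \<beta> P = Q0 + Q1"
    using projq(1)[of P] by (auto simp: qb_def)
  obtain U where U: "U \<in> ub \<beta>" "P - projq \<beta> P = U - transpose U"
    using projq(2)[of P] by (auto simp: kub_def)
  have Pe: "P = Q0 + Q1 + U - transpose U" using U(2) Q(3) by (simp add: algebra_simps)
  \<comment> \<open>Symmetry of P forces X to vanish: X - X^t lies in g_beta, and the three spectral
    parts are orthogonal. Then Q1 = -2 U, the source of the factor 2.\<close>
  define X where "X = Q1 + U + U"
  have X: "X \<in> ub \<beta>" unfolding X_def using Q U subspace_add[OF subspace_ub] by blast
  have "P - transpose P = (Q0 - transpose Q0) + (X - transpose X)"
    unfolding Pe X_def by (simp only: transpose_add transpose_diff transpose_transpose) simp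
  then have "X = transpose X - Q0 + transpose Q0" using P by (simp add: algebra_simps)
  then have "inner X X = inner (transpose X - Q0 + transpose Q0) X" by simp
  also have "\<dots> = 0" using gb_ub_orthogonal[OF X] X Q(1) gb_transpose by (simp add: inner_add_left inner_diff_left)
  finally have "Q1 + U + U = 0" by (simp add: X_def)
  then have Q1: "Q1 = - (2 *\<^sub>R U)" by (simp add: eq_neg_iff_add_eq_0 scaleR_2 add.assoc)
  have g: "inner P E = inner Q0 E" if E: "E \<in> gb \<beta>" for E
  proof -
    have "inner (transpose U) E = inner (transpose E) U"
      using inner_transpose[of "transpose U" E] by (simp add: inner_commute)
    then have "inner (transpose U) E = 0" using gb_ub_orthogonal(1)[OF U(1)] gb_transpose[OF E] by simp
    moreover have "inner U E = 0" "inner Q1 E = 0"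
      using gb_ub_orthogonal(1)[OF U(1) E] gb_ub_orthogonal(1)[OF Q(2) E] by (simp_all add: inner_commute)
    ultimately show ?thesis unfolding Pe by (simp add: inner_diff_left inner_add_left)
  qed
  have u: "2 * inner P E = inner Q1 E" if E: "E \<in> ub \<beta>" for E
    unfolding Pe Q1 using gb_ub_orthogonal[OF E] Q(1) U(1) by (simp add: inner_diff_left inner_add_left inner_minus_left)
  show thesis using that Q g u by blast
qed

end



section \<open>The solvsoliton\<close>

lemma pi_act_Vs: "\<mu> \<in> Vs \<Longrightarrow> pi_act A \<mu> \<in> Vs"
proof -
  assume "\<mu> \<in> Vs"
  then have "br \<mu> X Y = - br \<mu> Y X" for X Y by (rule br_skew)
  then show ?thesis unfolding Vs_iff br_pi_act
    by (metis (no_types, opaque_lifting) add.commute diff_diff_eq minus_add_distrib minus_diff_eq mvec_minus_right uminus_add_conv_diff)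
qed

text \<open>A full contraction does not depend on the orthonormal basis, which permits an eigenbasis
  of beta+ in place of the coordinate basis.\<close>

lemma orthonormal_trace_basis:
  fixes g :: "real^'n \<Rightarrow> real^'n \<Rightarrow> real"
  assumes lin: "\<And>X. linear (g X)" "\<And>Y. linear (\<lambda>X. g X Y)"
    and Bs: "finite Bs" "pairwise orthogonal Bs" "\<And>b. b \<in> Bs \<Longrightarrow> norm b = 1" "span Bs = UNIV"
  shows "(\<Sum>i\<in>UNIV. g (axis i 1) (axis i 1)) = (\<Sum>b\<in>Bs. g b b)"
proof -
  have ex: "(\<Sum>b\<in>Bs. inner x b *\<^sub>R b) = x" for x
    using orthonormal_basis_expand[OF Bs(2,3) _ Bs(1)] Bs(4) by simp
  have 1: "g x y = (\<Sum>b\<in>Bs. \<Sum>b'\<in>Bs. inner x b * inner y b' * g b b')" for x y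
  proof -
    have "g (\<Sum>b\<in>Bs. inner x b *\<^sub>R b) (\<Sum>b\<in>Bs. inner y b *\<^sub>R b) =
      (\<Sum>b'\<in>Bs. \<Sum>b\<in>Bs. inner x b * inner y b' * g b b')"
      by (simp add: linear_sum[OF lin(1)] linear_sum[OF lin(2)] linear_cmul[OF lin(1)]
          linear_cmul[OF lin(2)] sum_distrib_left mult.left_commute mult.assoc)
    then show ?thesis unfolding ex by (subst sum.swap)
  qed
  have o: "(\<Sum>i\<in>UNIV. inner (axis i 1) b * inner (axis i 1) b') = inner b b'" for b b' :: "real^'n"
    by (simp add: inner_vec_def[of b] inner_axis' )
  have "(\<Sum>i\<in>UNIV. g (axis i 1) (axis i 1)) =
     (\<Sum>b\<in>Bs. \<Sum>b'\<in>Bs. (\<Sum>i\<in>UNIV. inner (axis i 1) b * inner (axis i 1) b') * g b b')"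
    unfolding 1[of "axis _ 1"] sum_distrib_right
    by (subst sum.swap, intro sum.cong refl, rule sum.swap)
  also have "\<dots> = (\<Sum>b\<in>Bs. \<Sum>b'\<in>Bs. inner b b' * g b b')" unfolding o ..
  also have "\<dots> = (\<Sum>b\<in>Bs. g b b)"
  proof (intro sum.cong refl)
    fix b assume b: "b \<in> Bs"
    have "(\<Sum>b'\<in>Bs. inner b b' * g b b') = (\<Sum>b'\<in>Bs. if b' = b then g b b else 0)"
      using Bs(2,3) b by (intro sum.cong) (auto simp: pairwise_def orthogonal_def dot_square_norm)
    then show "(\<Sum>b'\<in>Bs. inner b b' * g b b') = g b b" using Bs(1) b by simp
  qed
  finally show ?thesis .
qed

lemma matrix_zero_on_span:
  fixes A :: "real^'n^'n"
  assumes "span Bs = (UNIV :: (real^'n) set)" "\<And>b. b \<in> Bs \<Longrightarrow> A *v b = 0"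
  shows "A = 0"
proof (rule mat_eqI)
  fix x :: "real^'n"
  have "x \<in> span Bs" by (simp add: assms(1))
  then show "A *v x = 0 *v x"
  proof (induction rule: span_induct)
    case base
    show ?case by (auto simp: subspace_def mvec_simps)
  qed (use assms(2) in auto)
qed

text \<open>|A|^2 + tr A^2 is what arises when the Killing form meets the norm of ad; in this form
  it is visibly nonnegative, and zero only for skew A.\<close>

lemma sym_part_square: "inner (A + transpose A) (A + transpose A) = 2 * (inner A A + trace (A ** A))"
  for A :: "real^'n^'n"
proof -
  have "inner A (transpose A) = trace (A ** A)" by (simp add: inner_mat_trace)
  then show ?thesis by (simp add: inner_add_left inner_add_right inner_transpose inner_commute[of "transpose A" A])
qed

text \<open>Interface between the degeneration argument and the linearization: \<open>nonneg\<close>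
  and \<open>ab\<close> are obtained through the limit bracket, \<open>D\<close> from the soliton
  equation.\<close>

locale semistable_soliton =
  fixes \<mu> :: "'n::finite brk" and \<beta> :: "'n mat"
  assumes lie: "is_lie \<mu>" and R: "Ricst \<mu> = \<beta>" and \<beta>0: "\<beta> \<noteq> 0"
    and D: "pi_act (betaplus \<beta>) \<mu> = 0"
    and nonneg: "\<And>X r. betaplus \<beta> *v X = r *\<^sub>R X \<Longrightarrow> r < 0 \<Longrightarrow> X = 0"
    and ab: "\<And>X Y. X \<in> szero \<beta> \<Longrightarrow> Y \<in> szero \<beta> \<Longrightarrow> br \<mu> X Y = 0"
begin

abbreviation "B \<equiv> Bop \<mu>"
abbreviation "\<delta> A \<equiv> pi_act A \<mu>"

lemma V: "\<mu> \<in> Vs" using lie by (simp add: is_lie_def)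

lemma \<beta>: "transpose \<beta> = \<beta>" using Ricst_sym[of \<mu>] R by simp

sublocale symmetric_label \<beta> by unfold_locales (rule \<beta>)

lemma Mop_eq: "Mop \<mu> = \<beta> + (1/2) *\<^sub>R B"
  using R by (simp add: Ricst_def algebra_simps)

lemma zero_on_eigenvectors:
  assumes "\<And>b r. betaplus \<beta> *v b = r *\<^sub>R b \<Longrightarrow> r \<ge> 0 \<Longrightarrow> A *v b = 0"
  shows "A = (0 :: 'n mat)"
proof -
  obtain Bs e where Bs: "finite Bs" "pairwise orthogonal Bs" "\<And>b. b \<in> Bs \<Longrightarrow> norm b = 1"
    "span Bs = UNIV" "\<And>b. b \<in> Bs \<Longrightarrow> betaplus \<beta> *v b = e b *\<^sub>R b"
    using betaplus_eigenbasis[OF \<beta>] by metis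
  show ?thesis
  proof (rule matrix_zero_on_span[OF Bs(4)])
    fix b assume b: "b \<in> Bs"
    then show "A *v b = 0"
      using assms[OF Bs(5)] nonneg[OF Bs(5)] Bs(3) by (metis linorder_not_le norm_zero zero_neq_one)
  qed
qed

text \<open>For b of degree e at least 0, the product ad X ad b raises degrees by r + e > 0 and so
  has trace zero.\<close>

lemma Bop_positive:
  assumes X: "betaplus \<beta> *v X = r *\<^sub>R X" and r: "r > 0" shows "B *v X = 0"
proof -
  \<comment> \<open>A rank one matrix replaces the vector so that the eigenvector test for matrices
    applies.\<close>
  have "outer (B *v X) (B *v X) = 0"
  proof (rule zero_on_eigenvectors)
    fix b e assume b: "betaplus \<beta> *v b = e *\<^sub>R b" and e: "e \<ge> 0"
    let ?C = "ad \<mu> X" and ?E = "ad \<mu> b" and ?D = "betaplus \<beta>"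
    have 1: "?D ** ?C = r *\<^sub>R ?C + ?C ** ?D" "?D ** ?E = e *\<^sub>R ?E + ?E ** ?D"
      using ad_derivation[OF D, of X] ad_derivation[OF D, of b] X b by (simp_all add: ad_simps)
    have "?D ** (?C ** ?E) = r *\<^sub>R (?C ** ?E) + ?C ** (?D ** ?E)"
      unfolding matrix_mul_assoc 1(1) by (simp add: mmul_simps)
    then have "?D ** (?C ** ?E) = (r + e) *\<^sub>R (?C ** ?E) + ?C ** ?E ** ?D"
      unfolding 1(2) by (simp add: mmul_simps algebra_simps)
    then have "trace (?D ** (?C ** ?E)) = (r + e) * trace (?C ** ?E) + trace (?C ** ?E ** ?D)"
      by (simp add: trace_simps)
    then have "(r + e) * trace (?C ** ?E) = 0"
      using trace_mul_sym[of ?D "?C ** ?E"] by simp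
    then have "inner (B *v X) b = 0" using r e by (simp add: inner_Bop)
    then show "outer (B *v X) (B *v X) *v b = 0" by (simp add: outer_mvec)
  qed
  then have "inner (B *v X) (B *v X) *\<^sub>R (B *v X) = 0"
    using outer_mvec[of "B *v X" "B *v X" "B *v X"] by simp
  then show ?thesis by auto
qed

lemma Bop_betaplus: "B ** betaplus \<beta> = 0" "betaplus \<beta> ** B = 0"
proof -
  show "B ** betaplus \<beta> = 0"
  proof (rule zero_on_eigenvectors)
    fix b r assume b: "betaplus \<beta> *v b = r *\<^sub>R b" "r \<ge> 0"
    then show "(B ** betaplus \<beta>) *v b = 0"
      using Bop_positive[OF b(1)]
      by (cases "r = 0") (simp_all add: mvec_simps flip: matrix_vector_mul_assoc)
  qed
  then show "betaplus \<beta> ** B = 0"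
    by (metis matrix_transpose_mul Bop_sym betaplus_sym[OF \<beta>] transpose_zero)
qed

lemma Bop_beta: "B ** \<beta> = - ((norm \<beta>)^2 *\<^sub>R B)" "\<beta> ** B = - ((norm \<beta>)^2 *\<^sub>R B)"
  using Bop_betaplus by (simp_all add: betaplus_def mmul_simps eq_neg_iff_add_eq_0)

lemma Bop_range: "B *v x \<in> szero \<beta>"
  using Bop_betaplus(2) by (simp add: szero_def matrix_vector_mul_assoc)

text \<open>Degree zero is abelian and B annihilates positive degrees, so B after ad Y is zero; the
  range of B has degree zero, so ad Y after B is zero.\<close>

lemma Bop_ad_szero:
  assumes Y: "Y \<in> szero \<beta>"
  shows "B ** ad \<mu> Y = 0" "ad \<mu> Y ** B = 0"
proof -
  show "B ** ad \<mu> Y = 0"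
  proof (rule zero_on_eigenvectors)
    fix b r assume b: "betaplus \<beta> *v b = r *\<^sub>R b" "r \<ge> 0"
    have "B *v br \<mu> Y b = 0"
    proof (cases "r = 0")
      case True
      then show ?thesis using ab[OF Y, of b] b(1) by (simp add: szero_def)
    next
      case False
      have "betaplus \<beta> *v br \<mu> Y b = r *\<^sub>R br \<mu> Y b"
        using betaplus_br[OF D, of Y 0 b r] Y b(1) by (simp add: szero_def)
      then show ?thesis using False b(2) by (intro Bop_positive) auto
    qed
    then show "(B ** ad \<mu> Y) *v b = 0" by (simp add: ad_mvec flip: matrix_vector_mul_assoc)
  qed
  show "ad \<mu> Y ** B = 0"
    by (rule mat_eqI) (simp add: ad_mvec ab[OF Y Bop_range] flip: matrix_vector_mul_assoc)
qed

text \<open>The norm of pi(E^t) mu is computed by M = beta + B/2. Both pairings with [E, E^t]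
  vanish, the first because E has degree zero, the second because B and E annihilate each
  other.\<close>

lemma transpose_ad_derivation:
  assumes "Y \<in> szero \<beta>" shows "\<delta> (transpose (ad \<mu> Y)) = 0"
proof -
  let ?E = "ad \<mu> Y"
  have "(norm (\<delta> (transpose ?E)))^2 = 4 * inner (Mop \<mu>) (?E ** transpose ?E - transpose ?E ** ?E)"
    by (rule Mop_commutator_derivation[OF pi_act_ad[OF lie]])
  also have "\<dots> = 0"
    using ad_szero_commute[OF D assms] Bop_ad_szero[OF assms]
    by (simp add: Mop_eq inner_add_left inner_commutator_transpose \<beta> Bop_sym)
  finally show ?thesis by simp
qed

lemma transpose_ad_zero: "X \<in> szero \<beta> \<Longrightarrow> Y \<in> szero \<beta> \<Longrightarrow> transpose (ad \<mu> X) *v Y = 0"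
  by (rule transpose_ad_szero[OF \<beta> D ab])

text \<open>For skew ad Z the |ad Z|^2 and Killing terms of Ric* cancel and leave |J_Z|^2 / 4,
  whereas Ric* = beta acts by -|beta|^2 in degree zero.\<close>

lemma szero_skew_zero:
  assumes Z: "Z \<in> szero \<beta>" and sk: "ad \<mu> Z + transpose (ad \<mu> Z) = 0" shows "Z = 0"
proof -
  have "inner (ad \<mu> Z) (ad \<mu> Z) + trace (ad \<mu> Z ** ad \<mu> Z) = 0"
    using sym_part_square[of "ad \<mu> Z"] sk by simp
  then have "inner (Ricst \<mu> *v Z) Z = inner (jmat \<mu> Z) (jmat \<mu> Z) / 4"
    by (simp add: Ricst_def mvec_simps inner_diff_left inner_Mop_mvec[OF V] inner_Bop)
  moreover have "inner (Ricst \<mu> *v Z) Z = - ((norm \<beta>)^2 * inner Z Z)"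
  proof -
    have "\<beta> *v Z = - ((norm \<beta>)^2 *\<^sub>R Z)"
      using Z by (simp add: szero_def betaplus_mvec eq_neg_iff_add_eq_0)
    then show ?thesis by (simp add: R)
  qed
  ultimately have "(norm \<beta>)^2 * inner Z Z \<le> 0"
    using inner_ge_zero[of "jmat \<mu> Z"] by linarith
  then have "inner Z Z \<le> 0" using \<beta>0 by (simp add: mult_le_0_iff)
  then show ?thesis by (metis inner_eq_zero_iff inner_ge_zero order_antisym)
qed

text \<open>The pairing of E with the derivative of Ricst in the direction pi(A) mu.\<close>
definition dric :: "'n mat \<Rightarrow> 'n mat \<Rightarrow> real" where
  "dric A E = inner (\<delta> (E + transpose E)) (\<delta> A) / 4 + inner (transpose A ** B + B ** A) E / 2"

lemma dric_add: "dric (A + A') E = dric A E + dric A' E" "dric A (E + E') = dric A E + dric A E'"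
  by (simp_all add: dric_def mmul_simps pi_act_simps inner_add_left inner_add_right add_divide_distrib)

lemma dric_scaleR: "dric A (r *\<^sub>R E) = r * dric A E"
  by (simp add: dric_def mmul_simps pi_act_simps inner_add_left distrib_left)

lemma dric_sym:
  assumes "transpose F = F"
  shows "dric A F = inner (\<delta> F) (\<delta> A) / 2 + inner (transpose A ** B) F / 2 + inner (B ** A) F / 2"
  unfolding dric_def assms inner_add_left pi_act_simps by simp

lemma dric_transpose: "dric A (transpose E) = dric A E"
proof -
  have "inner (transpose A ** B + B ** A) (transpose E) = inner (transpose A ** B + B ** A) E"
    using inner_transpose[of "transpose A ** B + B ** A" E]
    by (simp add: mmul_simps Bop_sym add.commute)
  then show ?thesis by (simp add: dric_def add.commute)
qed

lemma inner_pi_skew_sym: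
  assumes "transpose K = - K" "transpose F = F"
  shows "inner (\<delta> F) (\<delta> K) = 2 * inner (Mop \<mu>) (F ** K - K ** F)"
proof -
  have "4 * inner (Mop \<mu>) (F ** K - K ** F) = inner (pi_act F (\<delta> K) - pi_act K (\<delta> F)) \<mu>"
    using pi_act_commute[of F K \<mu>] by (simp add: inner_Mop)
  also have "\<dots> = 2 * inner (\<delta> F) (\<delta> K)"
    using inner_pi_act[of F "\<delta> K" \<mu>] inner_pi_act[of K "\<delta> F" \<mu>] assms
    by (simp add: inner_diff_left pi_act_simps inner_commute[of "\<delta> K"])
  finally show ?thesis by simp
qed

text \<open>Ric* is equivariant under rotations, so its derivative along pi(K) mu is a commutator of
  K with beta, which is zero for K in k_beta.\<close>

lemma dric_kb:
  assumes K: "K \<in> kb \<beta>" shows "dric K E = 0"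
proof -
  have k: "transpose K = - K" "\<beta> ** K - K ** \<beta> = 0" using K by (auto simp: kb_def gb_def glr_def)
  define F where "F = (1/2) *\<^sub>R (E + transpose E)"
  have F: "transpose F = F" by (simp add: F_def mmul_simps add.commute)
  have c: "inner S (F ** K - K ** F) = inner (K ** S - S ** K) F" if "transpose S = S" for S
    using inner_mmul_right[of S K F] inner_mmul_left[of K S F] that k(1)
      inner_mmul_right[of F K S] inner_mmul_left[of K F S]
    by (simp add: inner_diff_left inner_diff_right mmul_simps inner_commute[of S])
  have "dric K E = dric K F"
    unfolding F_def dric_scaleR dric_add dric_transpose by simp
  also have "\<dots> = inner (\<delta> F) (\<delta> K) / 2 + inner (B ** K - K ** B) F / 2"
    by (simp add: dric_sym[OF F] k(1) mmul_simps inner_diff_left diff_divide_distrib)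
  also have "\<dots> = 0"
    using c[OF \<beta>] c[OF Bop_sym, of \<mu>] k(2)
    by (simp add: inner_pi_skew_sym[OF k(1) F] Mop_eq inner_add_left inner_diff_left diff_divide_distrib)
  finally show ?thesis .
qed

text \<open>As pi(beta+) kills mu, pi carries the grading of gl(s) by [beta, .] to the grading of
  brackets by pi(beta+).\<close>

lemma pi_grading:
  assumes "\<beta> ** A - A ** \<beta> = r *\<^sub>R A"
  shows "pi_act (betaplus \<beta>) (\<delta> A) = r *\<^sub>R \<delta> A"
  using pi_act_commute[of "betaplus \<beta>" A \<mu>] assms by (simp add: betaplus_commutator D pi_act_simps)

lemma pi_betaplus_selfadjoint:
  "inner (pi_act (betaplus \<beta>) x) y = inner x (pi_act (betaplus \<beta>) y)"
  by (simp add: inner_pi_act betaplus_sym[OF \<beta>])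

lemma pi_ub:
  assumes "A \<in> ub \<beta>"
  shows "\<delta> A \<in> span {y. \<exists>r>0. pi_act (betaplus \<beta>) y = r *\<^sub>R y}"
    and "\<delta> (transpose A) \<in> span {y. \<exists>r<0. pi_act (betaplus \<beta>) y = r *\<^sub>R y}"
proof -
  let ?P = "span {y. \<exists>r>0. pi_act (betaplus \<beta>) y = r *\<^sub>R y}"
  let ?N = "span {y. \<exists>r<0. pi_act (betaplus \<beta>) y = r *\<^sub>R y}"
  have "\<delta> A \<in> ?P \<and> \<delta> (transpose A) \<in> ?N"
    using assms unfolding ub_span
  proof (induction rule: span_induct)
    case base
    show ?case
      by (auto simp: subspace_def pi_act_simps mmul_simps intro: span_zero span_add span_scale)
  next
    case (step A)
    then obtain r where r: "r > 0" "\<beta> ** A - A ** \<beta> = r *\<^sub>R A" by blast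
    have "\<beta> ** transpose A - transpose A ** \<beta> = (- r) *\<^sub>R transpose A"
      using arg_cong[OF r(2), of "\<lambda>X. - transpose X"] by (simp add: mmul_simps \<beta>)
    from pi_grading[OF this] pi_grading[OF r(2)] r(1) show ?case
      by (metis (mono_tags, lifting) mem_Collect_eq neg_less_0_iff_less span_base)
  qed
  then show "\<delta> A \<in> ?P" "\<delta> (transpose A) \<in> ?N" by auto
qed

lemma pi_gb:
  assumes "A \<in> gb \<beta>"
  shows "\<delta> A \<in> span {y. \<exists>r. r = 0 \<and> pi_act (betaplus \<beta>) y = r *\<^sub>R y}"
  using pi_grading[of A 0] assms by (intro span_base) (simp add: gb_def glr_def)

lemma pi_orthogonal:
  assumes "A \<in> ub \<beta>" "E \<in> ub \<beta>" "C \<in> gb \<beta>"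
  shows "inner (\<delta> C) (\<delta> A) = 0" "inner (\<delta> (transpose C)) (\<delta> A) = 0"
    "inner (\<delta> (transpose E)) (\<delta> A) = 0" "inner (\<delta> (transpose E)) (\<delta> C) = 0" "inner (\<delta> E) (\<delta> C) = 0"
proof -
  note so = selfadjoint_span_orthogonal[OF pi_betaplus_selfadjoint]
  show "inner (\<delta> C) (\<delta> A) = 0"
    by (rule so[OF pi_gb[OF assms(3)] pi_ub(1)[OF assms(1)]]) simp
  show "inner (\<delta> (transpose C)) (\<delta> A) = 0"
    by (rule so[OF pi_gb[OF gb_transpose[OF assms(3)]] pi_ub(1)[OF assms(1)]]) simp
  show "inner (\<delta> (transpose E)) (\<delta> A) = 0"
    by (rule so[OF pi_ub(2)[OF assms(2)] pi_ub(1)[OF assms(1)]]) simp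
  show "inner (\<delta> (transpose E)) (\<delta> C) = 0"
    by (rule so[OF pi_ub(2)[OF assms(2)] pi_gb[OF assms(3)]]) simp
  show "inner (\<delta> E) (\<delta> C) = 0"
    by (rule so[OF pi_ub(1)[OF assms(2)] pi_gb[OF assms(3)]]) simp
qed

text \<open>A raises degrees strictly and all degrees are nonnegative, so the image of A has no
  component in degree zero, where B lives.\<close>

lemma Bop_ub:
  assumes "A \<in> ub \<beta>" shows "B ** A = 0"
  using assms unfolding ub_span
proof (induction rule: span_induct)
  case base
  show ?case by (auto simp: subspace_def mmul_simps)
next
  case (step A)
  then obtain r where r: "r > 0" "\<beta> ** A - A ** \<beta> = r *\<^sub>R A" by blast
  have "B ** (betaplus \<beta> ** A - A ** betaplus \<beta>) = r *\<^sub>R (B ** A)"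
    unfolding betaplus_commutator r(2) by (simp add: mmul_simps)
  then have 1: "(B ** A) ** betaplus \<beta> = - (r *\<^sub>R (B ** A))"
    using Bop_betaplus(1) by (simp add: mmul_diff_right matrix_mul_assoc mmul_zero_left)
       (metis minus_minus)
  show ?case
  proof (rule zero_on_eigenvectors)
    fix b e assume b: "betaplus \<beta> *v b = e *\<^sub>R b" and e: "e \<ge> 0"
    have "e *\<^sub>R ((B ** A) *v b) = ((B ** A) ** betaplus \<beta>) *v b"
      using b by (simp add: mvec_simps flip: matrix_vector_mul_assoc)
    also have "\<dots> = - r *\<^sub>R ((B ** A) *v b)" unfolding 1 by (simp add: mvec_simps)
    finally have "(e + r) *\<^sub>R ((B ** A) *v b) = 0" by (simp add: algebra_simps)
    then show "(B ** A) *v b = 0" using e r(1) by simp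
  qed
qed

lemma gb_mult: "A \<in> gb \<beta> \<Longrightarrow> C \<in> gb \<beta> \<Longrightarrow> A ** C \<in> gb \<beta>"
  by (auto simp: gb_def glr_def) (metis matrix_mul_assoc)

lemma Bop_gb: "B \<in> gb \<beta>"
  by (simp add: gb_def glr_def Bop_beta)

text \<open>Mixed terms pair objects of different degree. On u_beta the Killing part is zero and
  only the pairing of pi(E1) mu with pi(A1) mu is left.\<close>

lemma dric_split:
  assumes "A0 \<in> gb \<beta>" "A1 \<in> ub \<beta>" "E0 \<in> gb \<beta>" "E1 \<in> ub \<beta>"
  shows "dric (A0 + A1) (E0 + E1) = dric A0 E0 + inner (\<delta> E1) (\<delta> A1) / 4"
proof -
  have B1: "B ** A1 = 0" "transpose A1 ** B = 0"
    using Bop_ub[OF assms(2)] by (simp, metis matrix_transpose_mul Bop_sym transpose_zero)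
  have "inner (transpose A0 ** B + B ** A0) E1 = 0"
    using gb_ub_orthogonal(1)[OF assms(4)] gb_mult[OF gb_transpose[OF assms(1)] Bop_gb] gb_mult[OF Bop_gb assms(1)]
    by (simp add: inner_add_left)
  then have "dric A0 E1 = 0"
    using pi_orthogonal[OF assms(2,4,1)] by (simp add: dric_def pi_act_simps inner_add_left)
  moreover have "dric A1 E0 = 0"
    using pi_orthogonal[OF assms(2,4,3)] by (simp add: dric_def pi_act_simps inner_add_left B1)
  moreover have "dric A1 E1 = inner (\<delta> E1) (\<delta> A1) / 4"
    using pi_orthogonal[OF assms(2,4,3)] by (simp add: dric_def pi_act_simps inner_add_left B1)
  ultimately show ?thesis by (simp add: dric_add)
qed

lemma dric_sym_part:
  assumes "A \<in> gb \<beta>" shows "dric A E = dric ((1/2) *\<^sub>R (A + transpose A)) E"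
proof -
  have "(1/2) *\<^sub>R (A - transpose A) \<in> kb \<beta>"
    using assms gb_transpose[OF assms] by (simp add: kb_def gb_def glr_def mmul_simps scaleR_right_diff_distrib)
  moreover have "A = (1/2) *\<^sub>R (A + transpose A) + (1/2) *\<^sub>R (A - transpose A)"
    by (simp add: algebra_simps flip: scaleR_add_left)
  ultimately show ?thesis by (metis add.right_neutral dric_add(1) dric_kb)
qed

lemma dric_sym_sym:
  assumes "transpose S = S" "transpose T = T" shows "dric S T = dric T S"
proof -
  have 1: "inner (S ** B) T = inner (T ** B) S" if "transpose S = S" "transpose T = T" for S T :: "'n mat"
  proof -
    have "inner (S ** B) T = inner B (S ** T)" using inner_mmul_left[of S B T] that by simp
    also have "\<dots> = inner B (transpose (S ** T))" using inner_transpose[of B "S ** T"] by (simp add: Bop_sym)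
    also have "\<dots> = inner (T ** B) S" using inner_mmul_left[of T B S] that by (simp add: matrix_transpose_mul)
    finally show ?thesis .
  qed
  have 2: "inner (B ** S) T = inner (B ** T) S" if "transpose S = S" "transpose T = T" for S T :: "'n mat"
  proof -
    have "inner (B ** S) T = inner B (T ** S)" using inner_mmul_right[of B S T] that by simp
    also have "\<dots> = inner B (transpose (T ** S))" using inner_transpose[of B "T ** S"] by (simp add: Bop_sym)
    also have "\<dots> = inner (B ** T) S" using inner_mmul_right[of B T S] that by (simp add: matrix_transpose_mul)
    finally show ?thesis .
  qed
  show ?thesis
    using 1[OF assms] 2[OF assms] assms
    by (simp add: dric_sym inner_commute[of "\<delta> T"])
qed

text \<open>Skew parts are invisible in the first argument by \<open>dric_kb\<close> and in the
  second by transpose invariance, which reduces the claim to symmetric matrices.\<close>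

lemma dric_gb_sym:
  assumes "A \<in> gb \<beta>" "E \<in> gb \<beta>" shows "dric A E = dric E A"
proof -
  let ?s = "\<lambda>A. (1/2) *\<^sub>R (A + transpose A)"
  have s: "transpose (?s A) = ?s A" for A :: "'n mat" by (simp add: mmul_simps add.commute)
  have r: "dric A (?s E) = dric A E" for A E
    unfolding dric_scaleR dric_add dric_transpose by simp
  have "dric A E = dric (?s A) (?s E)" unfolding r by (rule dric_sym_part[OF assms(1)])
  also have "\<dots> = dric (?s E) (?s A)" by (rule dric_sym_sym[OF s s])
  also have "\<dots> = dric E A" unfolding r by (rule dric_sym_part[OF assms(2), symmetric])
  finally show ?thesis .
qed

text \<open>In degree zero ad consists of commuting normal operators, so the indefinite term
  tr(B S S) is dominated by the part of the first term seen by the degree-zero subspace.\<close>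
lemma dric_sym_nonneg:
  assumes S: "transpose S = S" "S \<in> gb \<beta>"
  shows "dric S S \<ge> 0" and "dric S S = 0 \<Longrightarrow> \<delta> S = 0"
proof -
  obtain Bs e where Bs: "finite Bs" "pairwise orthogonal Bs" "\<And>b. b \<in> Bs \<Longrightarrow> norm b = 1"
    "span Bs = UNIV" "\<And>b. b \<in> Bs \<Longrightarrow> betaplus \<beta> *v b = e b *\<^sub>R b"
    using betaplus_eigenbasis[OF \<beta>] by metis
  note tb = orthonormal_trace_basis[OF _ _ Bs(1-4)]
  define I where "I = {b \<in> Bs. b \<in> szero \<beta>}"
  have Sc: "\<beta> ** S - S ** \<beta> = 0" using S(2) by (simp add: gb_def glr_def)
  have Sz: "S *v X \<in> szero \<beta>" if "X \<in> szero \<beta>" for X by (rule preserves_szero[OF Sc that])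
  have p: "dric S S = inner (\<delta> S) (\<delta> S) / 2 + inner (B ** S) S"
  proof -
    have "inner (S ** B) S = inner (B ** S) S"
      using inner_transpose[of "S ** B" S] by (simp add: matrix_transpose_mul S(1) Bop_sym)
    then show ?thesis by (simp add: dric_sym S(1))
  qed
  \<comment> \<open>Only basis vectors of degree zero matter, because S preserves degrees and B is
    zero in positive degree.\<close>
  have BS: "inner (B ** S) S = (\<Sum>b\<in>I. trace (ad \<mu> (S *v b) ** ad \<mu> (S *v b)))"
  proof -
    have "inner (B ** S) S = (\<Sum>i\<in>UNIV. inner (B *v (S *v axis i 1)) (S *v axis i 1))"
      unfolding inner_mat_columns[of "B ** S"] by (simp flip: matrix_vector_mul_assoc)
    also have "\<dots> = (\<Sum>b\<in>Bs. inner (B *v (S *v b)) (S *v b))"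
      by (rule tb) (auto intro!: linearI simp: mvec_simps inner_add_left inner_add_right)
    also have "\<dots> = (\<Sum>b\<in>I. inner (B *v (S *v b)) (S *v b))"
    proof (rule sum.mono_neutral_right)
      show "\<forall>b\<in>Bs - I. inner (B *v (S *v b)) (S *v b) = 0"
      proof
        fix b assume b: "b \<in> Bs - I"
        have e0: "e b \<noteq> 0" using b Bs(5)[of b] by (auto simp: I_def szero_def)
        have "e b \<ge> 0" using nonneg[OF Bs(5), of b] Bs(3)[of b] b by force
        then have e: "e b > 0" using e0 by simp
        have "betaplus \<beta> ** S = S ** betaplus \<beta>"
          using Sc betaplus_commutator[of \<beta> S] by simp
        then have "betaplus \<beta> *v (S *v b) = e b *\<^sub>R (S *v b)"
          using Bs(5)[of b] b by (metis DiffD1 matrix_vector_mul_assoc matrix_vector_mult_scaleR)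
        from Bop_positive[OF this e] show "inner (B *v (S *v b)) (S *v b) = 0" by simp
      qed
    qed (use Bs(1) in \<open>auto simp: I_def\<close>)
    finally show ?thesis by (simp add: inner_Bop)
  qed
  define a where "a x y = inner (br (\<delta> S) x y) (br (\<delta> S) x y)" for x y
  have n1: "inner (ad (\<delta> S) x) (ad (\<delta> S) x) = (\<Sum>b\<in>Bs. a x b)" for x
    unfolding inner_mat_columns ad_mvec a_def
    by (rule tb) (auto intro!: linearI simp: br_simps inner_add_left inner_add_right)
  have n2: "inner (\<delta> S) (\<delta> S) = (\<Sum>b\<in>Bs. \<Sum>b'\<in>Bs. a b b')"
    unfolding inner_brk_ad n1[symmetric]
    by (rule tb) (auto intro!: linearI simp: ad_simps inner_add_left inner_add_right)
  have asym: "a x y = a y x" for x y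
    unfolding a_def using br_skew[OF pi_act_Vs[OF V], of S x y] by simp
  have a0: "a x y = 0" if "x \<in> I" "y \<in> I" for x y
    using that ab Sz by (simp add: a_def I_def br_pi_act)
  have apos: "a x y \<ge> 0" for x y by (simp add: a_def)
  have fin: "finite I" "finite (Bs - I)" "Bs = I \<union> (Bs - I)" "I \<inter> (Bs - I) = {}" using Bs(1) by (auto simp: I_def)
  have split: "(\<Sum>b\<in>Bs. f b) = (\<Sum>b\<in>I. f b) + (\<Sum>b\<in>Bs - I. f b)" for f :: "_ \<Rightarrow> real"
    by (subst fin(3)) (rule sum.union_disjoint[OF fin(1,2,4)])
  \<comment> \<open>The block of pairs from I vanishes by commutativity in degree zero and the two
    mixed blocks are equal, so the total is at least twice the rows over I. This offsets the factor
    1/2 in \<open>p\<close>.\<close>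
  have half: "inner (\<delta> S) (\<delta> S) \<ge> 2 * (\<Sum>b\<in>I. inner (ad (\<delta> S) b) (ad (\<delta> S) b))"
  proof -
    have z: "(\<Sum>b\<in>I. \<Sum>b'\<in>I. a b b') = 0" using a0 by simp
    have sw: "(\<Sum>b\<in>Bs - I. \<Sum>b'\<in>I. a b b') = (\<Sum>b\<in>I. \<Sum>b'\<in>Bs - I. a b b')"
      by (subst sum.swap) (simp add: asym)
    have "(\<Sum>b\<in>Bs - I. \<Sum>b'\<in>Bs - I. a b b') \<ge> 0" by (intro sum_nonneg apos)
    then show ?thesis unfolding n1 n2 split sum.distrib using z sw by simp
  qed
  \<comment> \<open>The two parts [S, ad b] and ad (S b) are orthogonal, because ad (S b) commutes
    with the transpose of ad b.\<close>
  have bterm: "inner (ad (\<delta> S) b) (ad (\<delta> S) b) =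
      inner (S ** ad \<mu> b - ad \<mu> b ** S) (S ** ad \<mu> b - ad \<mu> b ** S) + inner (ad \<mu> (S *v b)) (ad \<mu> (S *v b))"
    if b: "b \<in> I" for b
  proof -
    let ?E = "ad \<mu> b" and ?Z = "S *v b"
    have bz: "b \<in> szero \<beta>" using b by (simp add: I_def)
    have "ad \<mu> (transpose ?E *v ?Z) = transpose ?E ** ad \<mu> ?Z - ad \<mu> ?Z ** transpose ?E"
      by (rule ad_derivation[OF transpose_ad_derivation[OF bz]])
    then have 0: "transpose ?E ** ad \<mu> ?Z = ad \<mu> ?Z ** transpose ?E"
      using transpose_ad_zero[OF bz Sz[OF bz]] by (simp add: ad_simps)
    have "inner (S ** ?E - ?E ** S) (ad \<mu> ?Z) = inner S (ad \<mu> ?Z ** transpose ?E - transpose ?E ** ad \<mu> ?Z)"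
      using inner_mmul_right[of S ?E "ad \<mu> ?Z"] inner_mmul_left[of ?E S "ad \<mu> ?Z"]
      by (simp add: inner_diff_left inner_diff_right)
    then have "inner (S ** ?E - ?E ** S) (ad \<mu> ?Z) = 0" by (simp add: 0)
    then show ?thesis
      unfolding ad_pi_act
      by (simp add: inner_diff_left[of _ "ad \<mu> ?Z"] inner_diff_right[of _ _ "ad \<mu> ?Z"] inner_commute[of "ad \<mu> ?Z" "S ** ?E - ?E ** S"])
  qed
  have T: "inner (ad \<mu> Z) (ad \<mu> Z) + trace (ad \<mu> Z ** ad \<mu> Z) =
    inner (ad \<mu> Z + transpose (ad \<mu> Z)) (ad \<mu> Z + transpose (ad \<mu> Z)) / 2" for Z
    by (simp add: sym_part_square)
  let ?t = "\<lambda>b. inner (S ** ad \<mu> b - ad \<mu> b ** S) (S ** ad \<mu> b - ad \<mu> b ** S) +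
      (inner (ad \<mu> (S *v b)) (ad \<mu> (S *v b)) + trace (ad \<mu> (S *v b) ** ad \<mu> (S *v b)))"
  have "(\<Sum>b\<in>I. inner (ad (\<delta> S) b) (ad (\<delta> S) b)) + inner (B ** S) S = (\<Sum>b\<in>I. ?t b)"
    unfolding BS sum.distrib[symmetric] by (intro sum.cong) (simp_all add: bterm)
  then have ge: "dric S S \<ge> (\<Sum>b\<in>I. ?t b)" using half p by linarith
  have tpos: "?t b \<ge> 0" for b unfolding T by simp
  then have "(\<Sum>b\<in>I. ?t b) \<ge> 0" by (intro sum_nonneg)
  with ge show "dric S S \<ge> 0" by linarith
  assume z: "dric S S = 0"
  have "(\<Sum>b\<in>I. ?t b) = 0" using z ge \<open>(\<Sum>b\<in>I. ?t b) \<ge> 0\<close> by linarith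
  then have t0: "?t b = 0" if "b \<in> I" for b
    using sum_nonneg_eq_0_iff[OF fin(1), of ?t] tpos that by blast
  \<comment> \<open>In the equality case each ad (S b) is skew, and degree zero has no nonzero
    element of that kind.\<close>
  have S0: "S *v b = 0" if b: "b \<in> I" for b
  proof (rule szero_skew_zero)
    show "S *v b \<in> szero \<beta>" using Sz b by (simp add: I_def)
    let ?A = "ad \<mu> (S *v b) + transpose (ad \<mu> (S *v b))"
    have "inner (S ** ad \<mu> b - ad \<mu> b ** S) (S ** ad \<mu> b - ad \<mu> b ** S) \<ge> 0" "inner ?A ?A \<ge> 0" by simp_all
    then have "inner ?A ?A = 0" using t0[OF b] unfolding T by linarith
    then show "?A = 0" by simp
  qed
  have "inner (B ** S) S = 0" unfolding BS by (intro sum.neutral) (simp add: S0 ad_simps mmul_simps trace_simps)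
  then show "\<delta> S = 0" using z p by simp
qed

lemma dric_nonneg:
  assumes A: "A \<in> gb \<beta>" shows "dric A A \<ge> 0" and "dric A A = 0 \<Longrightarrow> \<exists>K\<in>kb \<beta>. \<delta> A = \<delta> K"
proof -
  define S where "S = (1/2) *\<^sub>R (A + transpose A)"
  define K where "K = (1/2) *\<^sub>R (A - transpose A)"
  have S: "transpose S = S" "S \<in> gb \<beta>"
    using A gb_transpose[OF A] by (simp_all add: S_def gb_def glr_def mmul_simps add.commute algebra_simps)
  have K: "K \<in> kb \<beta>"
    using A gb_transpose[OF A] by (simp add: K_def kb_def gb_def glr_def mmul_simps scaleR_right_diff_distrib)
  have AK: "A = S + K" by (simp add: S_def K_def algebra_simps flip: scaleR_add_left)
  have Kg: "K \<in> gb \<beta>" using K by (simp add: kb_def)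
  have "dric A A = dric S S"
    unfolding AK dric_add dric_kb[OF K] using dric_gb_sym[OF S(2) Kg] dric_kb[OF K] by simp
  then show "dric A A \<ge> 0" "dric A A = 0 \<Longrightarrow> \<exists>K\<in>kb \<beta>. \<delta> A = \<delta> K"
    using dric_sym_nonneg[OF S] K AK by (auto simp: pi_act_simps)
qed

text \<open>pi(beta) multiplies mu by |beta|^2, and <mu, pi(A) mu> is twice the pairing of A with B,
  which the explicit Killing terms cancel. Thus |Ric*|^2 is stationary along sl_beta.\<close>

lemma dric_beta:
  assumes "inner A \<beta> = 0" shows "dric A \<beta> = 0"
proof -
  have b: "\<delta> \<beta> = (norm \<beta>)^2 *\<^sub>R \<mu>"
    using D by (simp add: betaplus_def pi_act_simps pi_act_id)
  have m: "inner \<mu> (\<delta> A) = 2 * inner B A"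
    using inner_Mop[of \<mu> A] assms
    by (simp add: Mop_eq inner_add_left inner_commute[of \<beta>] inner_commute[of "\<delta> A"])
  have "inner (transpose A ** B) \<beta> = inner (B ** A) \<beta>"
    using inner_transpose[of "B ** A" \<beta>] by (simp add: matrix_transpose_mul \<beta> Bop_sym)
  moreover have "inner (B ** A) \<beta> = - ((norm \<beta>)^2 * inner B A)"
    using inner_mmul_left[of B A \<beta>] by (simp add: Bop_sym Bop_beta inner_commute)
  ultimately show ?thesis
    by (simp add: dric_sym[OF \<beta>] b m)
qed

end

section \<open>Symmetrizable operators on quotients\<close>

text \<open>The quotient of T by the kernel of d is realized by the orthogonal complement for
  the inner product pulled back along J.\<close>
lemma symmetrizable_quotient:
  fixes d :: "'a::euclidean_space \<Rightarrow> 'b::real_vector" and J :: "'a \<Rightarrow> 'a"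
  assumes T: "subspace T" and d: "linear d" and J: "linear J" "\<And>x. J x = 0 \<Longrightarrow> x = 0"
    and \<Phi>: "\<And>A. A \<in> T \<Longrightarrow> \<Phi> A \<in> T"
    and \<Phi>sym: "\<And>A E. A \<in> T \<Longrightarrow> E \<in> T \<Longrightarrow> inner (J (\<Phi> A)) (J E) = inner (J A) (J (\<Phi> E))"
    and \<Phi>pos: "\<And>A. A \<in> T \<Longrightarrow> inner (J (\<Phi> A)) (J A) \<ge> 0"
    and \<Phi>ker: "\<And>A. A \<in> T \<Longrightarrow> d A = 0 \<Longrightarrow> d (\<Phi> A) = 0"
    and L: "\<And>A. A \<in> T \<Longrightarrow> L (d A) = - d (\<Phi> A)"
  shows "A \<in> T \<Longrightarrow> L (d A) = 0 \<Longrightarrow> \<exists>E\<in>T. d E = d A \<and> inner (J (\<Phi> E)) (J E) = 0"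
    and "x \<in> d ` T \<Longrightarrow> y \<in> d ` T \<Longrightarrow> x \<noteq> 0 \<or> y \<noteq> 0 \<Longrightarrow> L x = a *\<^sub>R x - b *\<^sub>R y \<Longrightarrow>
      L y = b *\<^sub>R x + a *\<^sub>R y \<Longrightarrow> a \<noteq> 0 \<or> b \<noteq> 0 \<Longrightarrow> b = 0 \<and> a < 0"
proof -
  define N where "N = {A \<in> T. d A = 0}"
  have N: "subspace N"
    using T by (auto simp: N_def subspace_def linear_0[OF d] linear_add[OF d] linear_cmul[OF d])
  have JN: "subspace (J ` N)" by (rule linear_subspace_image[OF J(1) N])
  have rep: "\<exists>E\<in>T. d E = d A \<and> (\<forall>n\<in>N. inner (J E) (J n) = 0)" if A: "A \<in> T" for A
  proof -
    obtain p z where p: "p \<in> span (J ` N)" "\<And>w. w \<in> span (J ` N) \<Longrightarrow> orthogonal z w" "J A = p + z"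
      using orthogonal_subspace_decomp_exists[of "J ` N" "J A"] by metis
    have sp: "span (J ` N) = J ` N" using JN by (rule span_eq_iff[THEN iffD2])
    obtain n where n: "n \<in> N" "p = J n" using p(1) sp by auto
    have "A - n \<in> T" using A n T by (simp add: N_def subspace_diff)
    moreover have "d (A - n) = d A" using n by (simp add: N_def linear_diff[OF d])
    moreover have "J (A - n) = z" using p(3) n(2) by (simp add: linear_diff[OF J(1)])
    ultimately show ?thesis using p(2) sp by (intro bexI[of _ "A - n"]) (auto simp: orthogonal_def)
  qed
  show "\<exists>E\<in>T. d E = d A \<and> inner (J (\<Phi> E)) (J E) = 0" if A: "A \<in> T" and z: "L (d A) = 0"
  proof -
    obtain E where E: "E \<in> T" "d E = d A" "\<forall>n\<in>N. inner (J E) (J n) = 0" using rep[OF A] by blast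
    have "d (\<Phi> E) = 0" using L[OF E(1)] E(2) z by simp
    then have "\<Phi> E \<in> N" using \<Phi>[OF E(1)] by (simp add: N_def)
    then show ?thesis using E by (metis inner_commute)
  qed
  \<comment> \<open>The two relations say that x + i y is an eigenvector of the complexification for
    a + i b.\<close>
  show "b = 0 \<and> a < 0" if xy: "x \<in> d ` T" "y \<in> d ` T" "x \<noteq> 0 \<or> y \<noteq> 0"
    and Lx: "L x = a *\<^sub>R x - b *\<^sub>R y" and Ly: "L y = b *\<^sub>R x + a *\<^sub>R y" and ab: "a \<noteq> 0 \<or> b \<noteq> 0"
  proof -
    obtain r where r: "r \<in> T" "d r = x" "\<forall>n\<in>N. inner (J r) (J n) = 0" using rep xy(1) by (metis imageE)
    obtain s where s: "s \<in> T" "d s = y" "\<forall>n\<in>N. inner (J s) (J n) = 0" using rep xy(2) by (metis imageE)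
    have NN: "A = 0" if A: "A \<in> N" and o: "\<forall>n\<in>N. inner (J A) (J n) = 0" for A
    proof -
      have "inner (J A) (J A) = 0" using o A by blast
      then have "J A = 0" by simp
      then show ?thesis by (rule J(2))
    qed
    have o\<Phi>: "inner (J (\<Phi> u)) (J n) = 0" if "u \<in> T" "\<forall>n\<in>N. inner (J u) (J n) = 0" "n \<in> N" for u n
    proof -
      have "\<Phi> n \<in> N" using that(3) \<Phi> \<Phi>ker by (simp add: N_def)
      then show ?thesis using that \<Phi>sym[of u n] by (simp add: N_def)
    qed
    have d\<Phi>: "d (\<Phi> A) = - L (d A)" if "A \<in> T" for A
      using L[OF that] by simp
    \<comment> \<open>For representatives orthogonal to N the eigenvalue equation holds exactly and
      not only modulo N: the defect lies in N and is orthogonal to N.\<close>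
    have 1: "\<Phi> r + a *\<^sub>R r - b *\<^sub>R s = 0"
    proof (rule NN)
      have "d (\<Phi> r + a *\<^sub>R r - b *\<^sub>R s) = 0"
        using d\<Phi>[OF r(1)] by (simp add: linear_add[OF d] linear_diff[OF d] linear_cmul[OF d] r(2) s(2) Lx)
      then show "\<Phi> r + a *\<^sub>R r - b *\<^sub>R s \<in> N"
        using T \<Phi> r s by (simp add: N_def subspace_diff subspace_add subspace_scale)
      show "\<forall>n\<in>N. inner (J (\<Phi> r + a *\<^sub>R r - b *\<^sub>R s)) (J n) = 0"
        using o\<Phi>[OF r(1,3)] r(3) s(3)
        by (simp add: linear_add[OF J(1)] linear_diff[OF J(1)] linear_cmul[OF J(1)] inner_diff_left inner_add_left)
    qed
    have 2: "\<Phi> s + b *\<^sub>R r + a *\<^sub>R s = 0"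
    proof (rule NN)
      have "d (\<Phi> s + b *\<^sub>R r + a *\<^sub>R s) = 0"
        using d\<Phi>[OF s(1)] by (simp add: linear_add[OF d] linear_cmul[OF d] r(2) s(2) Ly)
      then show "\<Phi> s + b *\<^sub>R r + a *\<^sub>R s \<in> N"
        using T \<Phi> r s by (simp add: N_def subspace_add subspace_scale)
      show "\<forall>n\<in>N. inner (J (\<Phi> s + b *\<^sub>R r + a *\<^sub>R s)) (J n) = 0"
        using o\<Phi>[OF s(1,3)] r(3) s(3)
        by (simp add: linear_add[OF J(1)] linear_cmul[OF J(1)] inner_add_left)
    qed
    have e1: "J (\<Phi> r) = b *\<^sub>R J s - a *\<^sub>R J r" and e2: "J (\<Phi> s) = - (b *\<^sub>R J r) - a *\<^sub>R J s"
    proof -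
      have "\<Phi> r = b *\<^sub>R s - a *\<^sub>R r" using 1 by (simp add: algebra_simps)
      then show "J (\<Phi> r) = b *\<^sub>R J s - a *\<^sub>R J r" by (simp add: linear_diff[OF J(1)] linear_cmul[OF J(1)])
      have "\<Phi> s = - (b *\<^sub>R r) - a *\<^sub>R s" using 2 by (simp add: algebra_simps eq_neg_iff_add_eq_0)
      then show "J (\<Phi> s) = - (b *\<^sub>R J r) - a *\<^sub>R J s"
        by (simp add: linear_diff[OF J(1)] linear_neg[OF J(1)] linear_cmul[OF J(1)])
    qed
    \<comment> \<open>Symmetry of \<open>\<Phi>\<close> between r and s isolates the imaginary part
      b.\<close>
    have "b * (inner (J r) (J r) + inner (J s) (J s)) = 0"
      using \<Phi>sym[OF r(1) s(1)] unfolding e1 e2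
      by (simp add: inner_diff_left inner_diff_right inner_minus_right algebra_simps)
    moreover have rs: "J r \<noteq> 0 \<or> J s \<noteq> 0"
      using xy(3) r(2) s(2) J(2) linear_0[OF d] by metis
    then have "inner (J r) (J r) + inner (J s) (J s) > 0"
      by (metis add_nonneg_pos add_pos_nonneg inner_ge_zero inner_gt_zero_iff)
    ultimately have b: "b = 0" by simp
    have "a * inner (J r) (J r) \<le> 0" "a * inner (J s) (J s) \<le> 0"
      using \<Phi>pos[OF r(1)] \<Phi>pos[OF s(1)] unfolding e1 e2 by (simp_all add: b)
    then have "a \<le> 0" using rs by (metis inner_gt_zero_iff mult_pos_pos not_le)
    then show ?thesis using b ab by simp
  qed
qed

section \<open>The linearization\<close>

text \<open>A bilinear expression, not symmetrized, with Ric* on the diagonal. Clearing the norm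
  from the moment map makes Ric* quadratic, so its derivative follows from the product rule.\<close>

definition ricpol :: "'n::finite brk \<Rightarrow> 'n brk \<Rightarrow> 'n mat" where
  "ricpol \<nu> \<xi> = (\<chi> a b. inner (pi_act (Emat a b) \<nu>) \<xi> / 4 -
     trace (ad \<nu> (axis a 1) ** ad \<xi> (axis b 1)) / 2)"

lemma Ricst_ricpol: "Ricst \<nu> = ricpol \<nu> \<nu>"
proof -
  have "inner (Emat a b) A = A $ a $ b" for a b and A :: "'a mat"
  proof -
    have "Emat a b = outer (axis a 1) (axis b (1::real))"
      by (simp add: Emat_def outer_def axis_def vec_eq_iff)
    then show ?thesis
      by (simp add: inner_commute[of _ A] inner_outer matrix_vector_mult_basis inner_axis column_def)
  qed
  then have "Mop \<nu> $ a $ b = inner (pi_act (Emat a b) \<nu>) \<nu> / 4" for a b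
    using inner_Mop[of \<nu> "Emat a b"] by (simp add: inner_commute)
  then show ?thesis by (simp add: Ricst_def ricpol_def Bop_def vec_eq_iff)
qed

lemma bounded_bilinear_ricpol: "bounded_bilinear (ricpol :: 'n::finite brk \<Rightarrow> _)"
  unfolding bilinear_conv_bounded_bilinear[symmetric] bilinear_def
  by (auto intro!: linearI simp: ricpol_def vec_eq_iff pi_act_simps ad_simps inner_add_left inner_add_right
      mmul_simps trace_simps add_divide_distrib diff_divide_distrib algebra_simps)

lemma bounded_bilinear_pi_act: "bounded_bilinear (pi_act :: 'n::finite mat \<Rightarrow> _)"
  unfolding bilinear_conv_bounded_bilinear[symmetric] bilinear_def
  using linear_pi_act by blast

lemma inner_ricpol:
  "inner (ricpol \<nu> \<xi>) E = inner (pi_act E \<nu>) \<xi> / 4 -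
    inner (\<chi> a b. trace (ad \<nu> (axis a 1) ** ad \<xi> (axis b 1))) E / 2"
proof -
  have l: "linear (\<lambda>A. inner (pi_act A \<nu>) \<xi>)"
    by (rule linearI) (simp_all add: pi_act_simps inner_simps)
  have "inner (pi_act E \<nu>) \<xi> = (\<Sum>a\<in>UNIV. \<Sum>b\<in>UNIV. E$a$b * inner (pi_act (Emat a b) \<nu>) \<xi>)"
    by (subst Emat_expand[of E]) (simp only: linear_sum[OF l] linear_cmul[OF l] real_scaleR_def)
  then have "inner (\<chi> a b. inner (pi_act (Emat a b) \<nu>) \<xi> / 4) E = inner (pi_act E \<nu>) \<xi> / 4"
    by (simp add: inner_vec_def[of "vec_lambda _"] inner_vec_def[of "vec_lambda _ $ _"] sum_divide_distrib mult.commute)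
  moreover have "ricpol \<nu> \<xi> = (\<chi> a b. inner (pi_act (Emat a b) \<nu>) \<xi> / 4) -
     (1/2) *\<^sub>R (\<chi> a b. trace (ad \<nu> (axis a 1) ** ad \<xi> (axis b 1)))"
    by (simp add: ricpol_def vec_eq_iff)
  ultimately show ?thesis by (simp add: inner_diff_left)
qed

context semistable_soliton
begin

definition ricder :: "'n brk \<Rightarrow> 'n mat" where
  "ricder v = ricpol \<mu> v + ricpol v \<mu>"

text \<open>The Killing part is \<open>Bop_pi_act\<close>; in the moment part adjointness merges the
  two product-rule terms into E + E^t.\<close>

lemma inner_ricder: "inner (ricder (\<delta> A)) E = dric A E"
proof -
  let ?X = "\<chi> a b. trace (ad \<mu> (axis a 1) ** ad (\<delta> A) (axis b 1))"
  let ?Y = "\<chi> a b. trace (ad (\<delta> A) (axis a 1) ** ad \<mu> (axis b 1))"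
  have "?X + ?Y = - (transpose A ** B + B ** A)"
  proof (rule mat_eqI, rule vec_eqI_inner)
    fix x y
    have "inner (?X *v x) y = trace (ad \<mu> y ** ad (\<delta> A) x)"
      by (rule inner_bilinear_matrix[of "\<lambda>x y. trace (ad \<mu> y ** ad (\<delta> A) x)"])
         (auto intro!: linearI simp: ad_simps mmul_simps trace_simps)
    moreover have "inner (?Y *v x) y = trace (ad (\<delta> A) y ** ad \<mu> x)"
      by (rule inner_bilinear_matrix[of "\<lambda>x y. trace (ad (\<delta> A) y ** ad \<mu> x)"])
         (auto intro!: linearI simp: ad_simps mmul_simps trace_simps)
    ultimately show "inner ((?X + ?Y) *v x) y = inner (- (transpose A ** B + B ** A) *v x) y"
      using Bop_pi_act[of \<mu> A x y]
      by (simp add: mvec_simps inner_add_left inner_diff_left inner_minus_left inner_mvec_left[of "transpose A"]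
          trace_mul_sym[of "ad \<mu> y"] trace_mul_sym[of "ad (\<delta> A) y"] flip: matrix_vector_mul_assoc)
  qed
  then have "inner (?X + ?Y) E = inner (- (transpose A ** B + B ** A)) E" by (rule arg_cong)
  then have "inner ?X E + inner ?Y E = - inner (transpose A ** B + B ** A) E"
    unfolding inner_add_left[of ?X] inner_minus_left .
  moreover have "inner (\<delta> E) (\<delta> A) + inner (pi_act E (\<delta> A)) \<mu> = inner (\<delta> (E + transpose E)) (\<delta> A)"
    using inner_pi_act[of E "\<delta> A" \<mu>] by (simp add: pi_act_simps inner_add_left inner_commute[of "\<delta> A"])
  ultimately show ?thesis
    unfolding ricder_def inner_add_left[of "ricpol \<mu> _"] inner_ricpol dric_def by argo
qed

lemma ricder_sym: "transpose (ricder (\<delta> A)) = ricder (\<delta> A)"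
proof (rule vec_eqI_inner)
  fix E
  have "inner (transpose (ricder (\<delta> A))) E = inner (ricder (\<delta> A)) (transpose E)"
    using inner_transpose[of "ricder (\<delta> A)" "transpose E"] by simp
  then show "inner (transpose (ricder (\<delta> A))) E = inner (ricder (\<delta> A)) E"
    by (simp add: inner_ricder dric_transpose)
qed

lemma Ricst_has_derivative: "(Ricst has_derivative ricder) (at \<mu> within X)"
proof -
  have "((\<lambda>\<nu>. ricpol \<nu> \<nu>) has_derivative (\<lambda>v. ricpol \<mu> v + ricpol v \<mu>)) (at \<mu> within X)"
    by (rule bounded_bilinear.FDERIV[OF bounded_bilinear_ricpol has_derivative_ident has_derivative_ident])
  then show ?thesis by (simp add: Ricst_ricpol[abs_def] ricder_def[abs_def])
qed

text \<open>The product rule at mu, where the coefficient matrix of the field is beta+; the factor 2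
  comes from the squared norm.\<close>

definition Lin :: "'n brk \<Rightarrow> 'n brk" where
  "Lin v = - (pi_act (betaplus \<beta>) v +
      pi_act (projq \<beta> (ricder v) + (2 * inner \<beta> (ricder v)) *\<^sub>R mat 1) \<mu>)"

lemma Xfield_zero: "Xfield \<beta> \<mu> = 0"
  by (simp add: Xfield_def R projq_label D flip: betaplus_def)

lemma Xfield_has_derivative: "(Xfield \<beta> has_derivative Lin) (at \<mu> within X)"
proof -
  have p: "((\<lambda>\<nu>. projq \<beta> (Ricst \<nu>)) has_derivative (\<lambda>v. projq \<beta> (ricder v))) (at \<mu> within X)"
    by (rule bounded_linear.has_derivative[OF linear_conv_bounded_linear[THEN iffD1, OF linear_projq] Ricst_has_derivative])
  have n: "((\<lambda>\<nu>. inner (Ricst \<nu>) (Ricst \<nu>)) has_derivative (\<lambda>v. 2 * inner \<beta> (ricder v))) (at \<mu> within X)"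
    using has_derivative_inner[OF Ricst_has_derivative Ricst_has_derivative, of X]
    by (simp add: R inner_commute[of _ \<beta>])
  have "((\<lambda>\<nu>. projq \<beta> (Ricst \<nu>) + inner (Ricst \<nu>) (Ricst \<nu>) *\<^sub>R mat 1) has_derivative
      (\<lambda>v. projq \<beta> (ricder v) + (2 * inner \<beta> (ricder v)) *\<^sub>R mat 1)) (at \<mu> within X)"
    by (intro has_derivative_add p has_derivative_scaleR_left n)
  from has_derivative_minus[OF bounded_bilinear.FDERIV[OF bounded_bilinear_pi_act this has_derivative_ident]]
  show ?thesis
    by (simp add: Xfield_def[abs_def] Lin_def[abs_def] power2_norm_eq_inner R projq_label betaplus_def)
qed

definition Phi :: "'n mat \<Rightarrow> 'n mat" where
  "Phi A = projq \<beta> (ricder (\<delta> A)) + (\<beta> ** A - A ** \<beta>)"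

lemma subspace_slb: "subspace (slb \<beta>)"
proof -
  have "subspace (hb \<beta>)" using subspace_gb by (auto simp: hb_def subspace_def inner_add_left)
  then show ?thesis unfolding slb_def by (rule subspace_sums[OF _ subspace_ub])
qed

lemma label_gb: "\<beta> \<in> gb \<beta>" by (simp add: gb_iff)

lemma slbE:
  assumes "A \<in> slb \<beta>"
  obtains A0 A1 where "A = A0 + A1" "A0 \<in> gb \<beta>" "inner A0 \<beta> = 0" "A1 \<in> ub \<beta>"
  using assms by (auto simp: slb_def hb_def)

lemma slb_label: "A \<in> slb \<beta> \<Longrightarrow> inner A \<beta> = 0"
  using gb_ub_orthogonal(1)[OF _ label_gb] by (auto elim!: slbE simp: inner_add_right inner_commute[of _ \<beta>])

text \<open>The scalar term drops out because |Ric*|^2 is stationary, and moving pi(beta+), which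
  kills mu, past pi(A) leaves [beta, A].\<close>

lemma Lin_tangent:
  assumes A: "A \<in> slb \<beta>" shows "Lin (\<delta> A) = - \<delta> (Phi A)"
proof -
  have "inner \<beta> (ricder (\<delta> A)) = 0"
    using dric_beta[OF slb_label[OF A]] by (simp add: inner_commute[of \<beta>] inner_ricder)
  moreover have "pi_act (betaplus \<beta>) (\<delta> A) = \<delta> (\<beta> ** A - A ** \<beta>)"
    using pi_act_commute[of "betaplus \<beta>" A \<mu>] by (simp add: betaplus_commutator D pi_act_simps)
  ultimately show ?thesis by (simp add: Lin_def Phi_def pi_act_simps)
qed

lemma commutator_slb:
  assumes "A0 \<in> gb \<beta>" shows "\<beta> ** (A0 + A1) - (A0 + A1) ** \<beta> = \<beta> ** A1 - A1 ** \<beta>"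
  using assms by (simp add: gb_iff mmul_simps)

lemma Phi_slb:
  assumes A: "A \<in> slb \<beta>" shows "Phi A \<in> slb \<beta>"
proof -
  obtain A0 A1 where As: "A = A0 + A1" "A0 \<in> gb \<beta>" "inner A0 \<beta> = 0" "A1 \<in> ub \<beta>" using slbE[OF A] .
  obtain Q0 Q1 where Q: "projq \<beta> (ricder (\<delta> A)) = Q0 + Q1" "Q0 \<in> gb \<beta>" "Q1 \<in> ub \<beta>"
    "\<And>E. E \<in> gb \<beta> \<Longrightarrow> inner (ricder (\<delta> A)) E = inner Q0 E"
    using projq_symmetric[OF ricder_sym] by metis
  have "inner Q0 \<beta> = 0"
    using Q(4)[OF label_gb] dric_beta[OF slb_label[OF A]] by (simp add: inner_ricder)
  then have "Q0 \<in> hb \<beta>" using Q(2) by (simp add: hb_def)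
  moreover have "Q1 + (\<beta> ** A1 - A1 ** \<beta>) \<in> ub \<beta>"
    by (rule subspace_add[OF subspace_ub Q(3) commutator_ub[OF As(4)]])
  moreover have "\<beta> ** A - A ** \<beta> = \<beta> ** A1 - A1 ** \<beta>"
    using As(1) commutator_slb[OF As(2)] by simp
  then have "Phi A = Q0 + (Q1 + (\<beta> ** A1 - A1 ** \<beta>))" by (simp add: Phi_def Q(1) add.assoc)
  ultimately show ?thesis unfolding slb_def by blast
qed

text \<open>The scaling that makes the pulled-back inner product equal to 2<A0,E0> + <A1,E1> on
  gb + ub, compensating the doubling in projq_symmetric.\<close>
definition Jsc :: "'n mat \<Rightarrow> 'n mat" where
  "Jsc A = A + (sqrt 2 - 1) *\<^sub>R orthproj (gb \<beta>) A"

lemma orthproj_gb: "A0 \<in> gb \<beta> \<Longrightarrow> A1 \<in> ub \<beta> \<Longrightarrow> orthproj (gb \<beta>) (A0 + A1) = A0"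
  by (rule orthproj_eq[OF subspace_gb]) (simp_all add: gb_ub_orthogonal(1) inner_commute[of A1])

lemma linear_Jsc: "linear Jsc"
  unfolding Jsc_def[abs_def]
  by (rule linearI)
     (simp_all add: linear_add[OF linear_orthproj[OF subspace_gb]] linear_cmul[OF linear_orthproj[OF subspace_gb]] algebra_simps)

lemma inner_Jsc: "inner (Jsc A) (Jsc E) = inner A E + inner (orthproj (gb \<beta>) A) (orthproj (gb \<beta>) E)"
proof -
  let ?p = "orthproj (gb \<beta>)" and ?s = "sqrt 2 - 1"
  have 1: "inner A (?p E) = inner (?p A) (?p E)" for A E
    using orthproj(2)[OF subspace_gb orthproj(1)[OF subspace_gb], of A E] by (simp add: inner_diff_left)
  have 2: "inner (?p A) E = inner (?p A) (?p E)"
    using 1[of E A] by (simp add: inner_commute)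
  have "inner (Jsc A) (Jsc E) = inner A E + (?s + ?s + ?s * ?s) * inner (?p A) (?p E)"
    unfolding Jsc_def by (simp add: inner_add_left inner_add_right 1[of A E] 2 algebra_simps)
  also have "?s + ?s + ?s * ?s = 1" by (simp add: algebra_simps)
  finally show ?thesis by simp
qed

lemma Jsc_zero: "Jsc A = 0 \<Longrightarrow> A = 0"
proof -
  assume "Jsc A = 0"
  then have "inner A A + inner (orthproj (gb \<beta>) A) (orthproj (gb \<beta>) A) = 0"
    using inner_Jsc[of A A] by simp
  then have "inner A A \<le> 0" using inner_ge_zero[of "orthproj (gb \<beta>) A"] by linarith
  then show "A = 0" by (metis inner_eq_zero_iff inner_ge_zero order_antisym)
qed

text \<open>The weight 2 on g_beta from \<open>Jsc\<close> and the doubling on u_beta from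
  \<open>projq\<close> produce the same multiple of \<open>dric\<close>.\<close>

lemma inner_Jsc_Phi:
  assumes A: "A \<in> slb \<beta>" and E: "E \<in> slb \<beta>"
  shows "inner (Jsc (Phi A)) (Jsc E) = 2 * dric A E + inner (\<beta> ** A - A ** \<beta>) E"
proof -
  obtain A0 A1 where As: "A = A0 + A1" "A0 \<in> gb \<beta>" "A1 \<in> ub \<beta>" using slbE[OF A] .
  obtain E0 E1 where Es: "E = E0 + E1" "E0 \<in> gb \<beta>" "E1 \<in> ub \<beta>" using slbE[OF E] .
  obtain Q0 Q1 where Q: "projq \<beta> (ricder (\<delta> A)) = Q0 + Q1" "Q0 \<in> gb \<beta>" "Q1 \<in> ub \<beta>"
    "\<And>E. E \<in> gb \<beta> \<Longrightarrow> inner (ricder (\<delta> A)) E = inner Q0 E"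
    "\<And>E. E \<in> ub \<beta> \<Longrightarrow> 2 * inner (ricder (\<delta> A)) E = inner Q1 E"
    using projq_symmetric[OF ricder_sym] by metis
  let ?f = "\<beta> ** A1 - A1 ** \<beta>"
  have f: "?f \<in> ub \<beta>" by (rule commutator_ub[OF As(3)])
  have fA: "\<beta> ** A - A ** \<beta> = ?f" using As(1) commutator_slb[OF As(2)] by simp
  then have \<Phi>: "Phi A = Q0 + (Q1 + ?f)" by (simp add: Phi_def Q(1) add.assoc)
  have o: "orthproj (gb \<beta>) (Phi A) = Q0" "orthproj (gb \<beta>) E = E0"
    unfolding \<Phi> Es(1) by (rule orthproj_gb[OF Q(2) subspace_add[OF subspace_ub Q(3) f]], rule orthproj_gb[OF Es(2,3)])
  have z: "inner Q0 E1 = 0" "inner Q1 E0 = 0" "inner ?f E0 = 0"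
    using gb_ub_orthogonal(1)[OF Es(3) Q(2)] gb_ub_orthogonal(1)[OF Q(3) Es(2)] gb_ub_orthogonal(1)[OF f Es(2)] by (simp_all add: inner_commute)
  have "inner (Jsc (Phi A)) (Jsc E) = 2 * inner Q0 E0 + inner Q1 E1 + inner ?f E1"
    unfolding inner_Jsc o unfolding \<Phi> Es(1) using z by (simp add: inner_add_left inner_add_right)
  also have "\<dots> = 2 * dric A E0 + 2 * dric A E1 + inner ?f E"
    using Q(4)[OF Es(2)] Q(5)[OF Es(3)] z unfolding Es(1) by (simp add: inner_ricder inner_add_right)
  also have "\<dots> = 2 * dric A E + inner (\<beta> ** A - A ** \<beta>) E"
    unfolding fA by (simp add: Es(1) dric_add)
  finally show ?thesis .
qed

lemma Phi_symmetric:
  assumes A: "A \<in> slb \<beta>" and E: "E \<in> slb \<beta>"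
  shows "inner (Jsc (Phi A)) (Jsc E) = inner (Jsc A) (Jsc (Phi E))"
proof -
  obtain A0 A1 where As: "A = A0 + A1" "A0 \<in> gb \<beta>" "A1 \<in> ub \<beta>" using slbE[OF A] .
  obtain E0 E1 where Es: "E = E0 + E1" "E0 \<in> gb \<beta>" "E1 \<in> ub \<beta>" using slbE[OF E] .
  have "dric A E = dric E A"
    unfolding As(1) Es(1) dric_split[OF As(2,3) Es(2,3)] dric_split[OF Es(2,3) As(2,3)]
    using dric_gb_sym[OF As(2) Es(2)] by (simp add: inner_commute)
  moreover have "inner (\<beta> ** A - A ** \<beta>) E = inner (\<beta> ** E - E ** \<beta>) A"
    unfolding commutator_selfadjoint[of A E] by (rule inner_commute)
  ultimately show ?thesis
    using inner_Jsc_Phi[OF A E] inner_Jsc_Phi[OF E A] by (simp add: inner_commute[of "Jsc A"])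
qed

text \<open>Three nonnegative terms: \<open>dric\<close> on g_beta, a squared norm, and [beta, .] on
  u_beta. If they vanish, the last removes the u_beta part and the first leaves a skew
  generator.\<close>

lemma Phi_nonneg:
  assumes A: "A \<in> slb \<beta>"
  shows "inner (Jsc (Phi A)) (Jsc A) \<ge> 0"
    and "inner (Jsc (Phi A)) (Jsc A) = 0 \<Longrightarrow> \<exists>K\<in>kb \<beta>. \<delta> A = \<delta> K"
proof -
  obtain A0 A1 where As: "A = A0 + A1" "A0 \<in> gb \<beta>" "A1 \<in> ub \<beta>" using slbE[OF A] .
  have f: "inner (\<beta> ** A - A ** \<beta>) A = inner (\<beta> ** A1 - A1 ** \<beta>) A1"
    unfolding As(1) commutator_slb[OF As(2)]
    using gb_ub_orthogonal(1)[OF commutator_ub[OF As(3)] As(2)] by (simp add: inner_add_right inner_commute[of _ A0])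
  have e: "inner (Jsc (Phi A)) (Jsc A) = 2 * dric A0 A0 + inner (\<delta> A1) (\<delta> A1) / 2 + inner (\<beta> ** A1 - A1 ** \<beta>) A1"
    unfolding inner_Jsc_Phi[OF A A] f unfolding As(1) dric_split[OF As(2,3) As(2,3)] by simp
  note p = dric_nonneg(1)[OF As(2)] inner_ge_zero[of "\<delta> A1"] commutator_ub_pos(1)[OF As(3)]
  show "inner (Jsc (Phi A)) (Jsc A) \<ge> 0" unfolding e using p by simp
  assume "inner (Jsc (Phi A)) (Jsc A) = 0"
  then have "dric A0 A0 = 0" "inner (\<beta> ** A1 - A1 ** \<beta>) A1 = 0" unfolding e using p by linarith+
  then show "\<exists>K\<in>kb \<beta>. \<delta> A = \<delta> K"
    using dric_nonneg(2)[OF As(2)] commutator_ub_pos(2)[OF As(3)] As(1) by auto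
qed

lemma Tsp_image: "Tsp \<beta> \<mu> = (\<lambda>A. \<delta> A) ` slb \<beta>"
  by (auto simp: Tsp_def)

lemma Lin_Tsp: "Lin ` Tsp \<beta> \<mu> \<subseteq> Tsp \<beta> \<mu>"
proof safe
  fix v assume "v \<in> Tsp \<beta> \<mu>"
  then obtain A where A: "A \<in> slb \<beta>" "v = \<delta> A" by (auto simp: Tsp_image)
  have "Lin v = \<delta> (- Phi A)" using Lin_tangent[OF A(1)] A(2) by (simp add: pi_act_simps)
  then show "Lin v \<in> Tsp \<beta> \<mu>" using subspace_neg[OF subspace_slb Phi_slb[OF A(1)]] by (auto simp: Tsp_image)
qed

text \<open>\<open>Lin\<close> depends on the tangent vector alone, so \<open>Phi\<close> must
  respect the stabilizer of mu.\<close>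

lemma Phi_kernel:
  assumes "A \<in> slb \<beta>" "\<delta> A = 0" shows "\<delta> (Phi A) = 0"
proof -
  have "Lin 0 = 0"
    using linear_0[OF has_derivative_linear[OF Xfield_has_derivative[of UNIV]]] .
  then show ?thesis using Lin_tangent[OF assms(1)] assms(2) by simp
qed

lemmas Phi_facts = subspace_slb linear_pi_act(2) linear_Jsc Phi_slb Phi_symmetric Phi_nonneg(1)
  Phi_kernel Lin_tangent Jsc_zero

lemma Lin_kernel_representative:
  "A \<in> slb \<beta> \<Longrightarrow> Lin (\<delta> A) = 0 \<Longrightarrow> \<exists>E\<in>slb \<beta>. \<delta> E = \<delta> A \<and> inner (Jsc (Phi E)) (Jsc E) = 0"
  by (rule symmetrizable_quotient(1)[where T = "slb \<beta>" and d = "\<lambda>A. \<delta> A" and J = Jsc and \<Phi> = Phi and L = Lin])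
     (assumption | rule Phi_facts)+

lemma Lin_eigenvalue:
  assumes "x \<in> Tsp \<beta> \<mu>" "y \<in> Tsp \<beta> \<mu>" "x \<noteq> 0 \<or> y \<noteq> 0"
    "Lin x = a *\<^sub>R x - b *\<^sub>R y" "Lin y = b *\<^sub>R x + a *\<^sub>R y" "a \<noteq> 0 \<or> b \<noteq> 0"
  shows "b = 0 \<and> a < 0"
  by (rule symmetrizable_quotient(2)[where T = "slb \<beta>" and d = "\<lambda>A. \<delta> A" and J = Jsc and \<Phi> = Phi
        and L = Lin and x = x and y = y])
     (fact assms[unfolded Tsp_image] | assumption | rule Phi_facts)+

lemma kb_slb:
  assumes "K \<in> kb \<beta>" shows "K \<in> slb \<beta>"
proof -
  have "inner K \<beta> = 0" using assms inner_sym_skew[OF \<beta>, of K] by (simp add: kb_def inner_commute)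
  then have "K \<in> hb \<beta>" using assms by (simp add: hb_def kb_def)
  then show ?thesis using subspace_0[OF subspace_ub] unfolding slb_def by force
qed

lemma Lin_kernel: "{v \<in> Tsp \<beta> \<mu>. Lin v = 0} = {\<delta> A | A. A \<in> kb \<beta>}"
proof safe
  fix v assume v: "v \<in> Tsp \<beta> \<mu>" "Lin v = 0"
  then obtain A where A: "A \<in> slb \<beta>" "v = \<delta> A" by (auto simp: Tsp_image)
  from Lin_kernel_representative[OF A(1)] v A(2) obtain E where E: "E \<in> slb \<beta>" "\<delta> E = \<delta> A" "inner (Jsc (Phi E)) (Jsc E) = 0"
    by blast
  from Phi_nonneg(2)[OF E(1,3)] E(2) A(2) show "\<exists>A. v = \<delta> A \<and> A \<in> kb \<beta>" by metis
next
  fix K assume K: "K \<in> kb \<beta>"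
  then show "\<delta> K \<in> Tsp \<beta> \<mu>" using kb_slb by (auto simp: Tsp_image)
  \<comment> \<open>Rotations in k_beta change neither Ric* nor beta to first order, so both
    summands of \<open>Phi\<close> vanish.\<close>
  have "ricder (\<delta> K) = 0" by (rule vec_eqI_inner) (simp add: inner_ricder dric_kb[OF K])
  then have "Phi K = 0" using K by (simp add: Phi_def linear_0[OF linear_projq] kb_def gb_iff)
  then show "Lin (\<delta> K) = 0" using Lin_tangent[OF kb_slb[OF K]] by (simp add: pi_act_simps)
qed

end

section \<open>From the solvsoliton hypotheses to the linearization\<close>

lemma subspace_Vs: "subspace Vs"
  unfolding subspace_def
proof (intro conjI ballI allI)
  fix x y :: "'a brk" and r :: real
  assume x: "x \<in> Vs"
  show "r *\<^sub>R x \<in> Vs"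
    unfolding Vs_iff br_simps by (metis x br_skew scaleR_minus_right)
  assume y: "y \<in> Vs"
  show "x + y \<in> Vs"
    unfolding Vs_iff br_simps by (metis x y br_skew minus_add_distrib)
qed (simp add: Vs_def)

text \<open>Once beta+ is a derivation, mu lies in \<open>V0 \<beta>\<close> and equals its own
  projection, so semistability speaks about the orbit of mu itself and the minimal bracket can be
  taken in its closure.\<close>

lemma solvsoliton_semistable:
  assumes "trace \<beta> = -1" and ss: "\<mu> \<in> Vge0ss \<beta>" and sol: "solvsoliton \<mu>" and R: "Ricst \<mu> = \<beta>"
  shows "semistable_soliton \<mu> \<beta>"
proof -
  have lie: "is_lie \<mu>" and sv: "solvable_br \<mu>" using sol by (auto simp: solvsoliton_def)
  obtain c D where cD: "Ric \<mu> = c *\<^sub>R mat 1 + D" "pi_act D \<mu> = 0"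
    using sol by (auto simp: solvsoliton_def is_derivation_iff)
  have \<beta>: "transpose \<beta> = \<beta>" using Ricst_sym[of \<mu>] R by simp
  have \<beta>0: "\<beta> \<noteq> 0" using assms(1) by (auto simp: trace_zero)
  have sa: "inner (pi_act (betaplus \<beta>) x) y = inner x (pi_act (betaplus \<beta>) y)" for x y
    by (simp add: inner_pi_act betaplus_sym[OF \<beta>])
  have "\<mu> \<in> span (\<Union>r\<in>{r. r \<ge> 0}. Veig \<beta> r)" using ss by (simp add: Vge0ss_def Vge0_def)
  then have "\<mu> \<in> span {y. \<exists>r\<ge>0. pi_act (betaplus \<beta>) y = r *\<^sub>R y}"
    by (rule span_mono[THEN subsetD, rotated]) (auto simp: Veig_def)
  from selfadjoint_nonneg_part(2)[OF linear_pi_act(1) sa this solvsoliton_pi_betaplus[OF lie R assms(1) cD]]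
  have D: "pi_act (betaplus \<beta>) \<mu> = 0" .
  have V: "\<mu> \<in> V0 \<beta>" using D lie by (simp add: V0_def Veig_def is_lie_def)
  have sV: "subspace (V0 \<beta> :: 'a brk set)"
  proof -
    have "subspace {\<mu> :: 'a brk. pi_act (betaplus \<beta>) \<mu> = 0}"
      by (auto simp: subspace_def pi_act_simps)
    moreover have "V0 \<beta> = Vs \<inter> {\<mu>. pi_act (betaplus \<beta>) \<mu> = 0}" by (auto simp: V0_def Veig_def)
    ultimately show ?thesis using subspace_inter[OF subspace_Vs] by simp
  qed
  have "orthproj (V0 \<beta>) \<mu> = \<mu>" by (rule orthproj_eq[OF sV V]) simp
  then have cl: "0 \<notin> closure ((\<lambda>h. gl_act h \<mu>) ` Hgrp \<beta>)"
    using ss by (simp add: Vge0ss_def V0ss_def)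
  obtain K where K: "\<And>f. dword \<mu> K f = 0" using solvable_dword[OF sv] by blast
  obtain \<nu> c S where mb: "minimal_bracket \<nu> \<beta> c K" and S: "\<And>n::nat. S n \<in> psym \<beta>"
    and lim: "(\<lambda>n. gl_act (mexp (S n)) \<mu>) \<longlonglongrightarrow> \<nu>"
    using orbit_minimal_bracket[OF lie K D \<beta> \<beta>0 cl] by blast
  interpret nu: minimal_bracket \<nu> \<beta> c K by fact
  show ?thesis
  proof
    show "br \<mu> X Y = 0" if "X \<in> szero \<beta>" "Y \<in> szero \<beta>" for X Y
      using lie K subspace_szero szero_br[OF D] _ that
    proof (rule solvable_subalgebra_abelian)
      fix W X
      assume "W \<subseteq> szero \<beta>" "X \<in> W" and tr: "\<And>m. trace (matpow (ad \<mu> X) (Suc m)) = 0"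
      then have "X \<in> szero \<beta>" by blast
      from semistable_traceless_zero[OF mb S lim this tr] show "X = 0" .
    qed
    show "X = 0" if "betaplus \<beta> *v X = r *\<^sub>R X" "r < 0" for X r
      using nu.betaplus_nonneg that .
  qed (fact lie R \<beta>0 D)+
qed

theorem theorem8p1:
  fixes \<beta> :: "real^'n::finite^'n" and \<mu>C \<mu>b :: "real^'n^'n^'n"
  assumes "critF \<mu>C" and "\<beta> = mm \<mu>C"
    and "\<mu>b \<in> Vge0ss \<beta>" and "solvsoliton \<mu>b" and "Ricst \<mu>b = \<beta>"
  shows "Xfield \<beta> \<mu>b = 0 \<and>
    (\<exists>L. (Xfield \<beta> has_derivative L) (at \<mu>b within Vs) \<and>
         L ` Tsp \<beta> \<mu>b \<subseteq> Tsp \<beta> \<mu>b \<and>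
         {v \<in> Tsp \<beta> \<mu>b. L v = 0} = {pi_act A \<mu>b | A. A \<in> kb \<beta>} \<and>
         (\<forall>a b x y. x \<in> Tsp \<beta> \<mu>b \<and> y \<in> Tsp \<beta> \<mu>b \<and> (x \<noteq> 0 \<or> y \<noteq> 0) \<and>
            L x = a *\<^sub>R x - b *\<^sub>R y \<and> L y = b *\<^sub>R x + a *\<^sub>R y \<and> (a \<noteq> 0 \<or> b \<noteq> 0)
            \<longrightarrow> b = 0 \<and> a < 0))"
proof -
  have "trace \<beta> = -1" using assms(1,2) trace_mm[of \<mu>C] by (simp add: critF_def)
  then interpret semistable_soliton \<mu>b \<beta> by (rule solvsoliton_semistable) (fact assms)+
  have "\<forall>a b x y. x \<in> Tsp \<beta> \<mu>b \<and> y \<in> Tsp \<beta> \<mu>b \<and> (x \<noteq> 0 \<or> y \<noteq> 0) \<and>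
      Lin x = a *\<^sub>R x - b *\<^sub>R y \<and> Lin y = b *\<^sub>R x + a *\<^sub>R y \<and> (a \<noteq> 0 \<or> b \<noteq> 0) \<longrightarrow> b = 0 \<and> a < 0"
    using Lin_eigenvalue by blast
  then show ?thesis
    using Xfield_zero Xfield_has_derivative[of Vs] Lin_Tsp Lin_kernel by blast
qed

end
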